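(* Let $\Omega\subset\mathbb{R}^2$ be a bounded simply connected domain and $\psi:\partial\Omega\to\mathbb{R}$ a continuous function such that $(\Omega,\psi)$ satisfies a bounded slope condition. Let $f$ be an admissible Lagrangean, and let $(f_n)_{n\in\mathbb{N}}$ be a sequence of functions on $[0,+\infty)$, each strictly convex, in $C^1([0,+\infty))\cap C^{2,\lambda}_{loc}((0,+\infty))$, with $f_n'(0)=0$, and converging uniformly to $f$ on $[0,+\infty)$. Let $u_n$ be the minimizer of $\int_\Omega f_n(|\nabla w|)\,dx\,dy$ among all $w\in\mathrm{Lip}(\overline\Omega)$ with $w=\psi$ on $\partial\Omega$. Then the following assertions hold. (i) For every $n\in\mathbb{N}$ there exists a unique Lipschitz continuous solution $v_n$, in the sense of distributions in $\Omega$, of the system $$\partial_x v_n=-f_n'(|\nabla u_n|)\frac{\partial_y u_n}{|\nabla u_n|},\qquad \partial_y v_n=f_n'(|\nabla u_n|)\frac{\partial_x u_n}{|\nabla u_n|}$$ such that $\int_\Omega v_n=0$. (ii) If $\dfrac{\rho f_n''(\rho)}{f_n'(\rho)}$ converges to a positive constant as $\rho\to0^+$, then $v_n$ is a viscosity solution in $\Omega$ of $$-\big[1-\alpha_n(g_n'(|\nabla v|))\big]\Delta_\infty v-|\nabla v|^2\,\alpha_n(g_n'(|\nabla v|))\,\Delta v=0,$$ where $\alpha_n(\rho)=\rho f_n''(\rho)/f_n'(\rho)$ for $\rho>0$, $\alpha_n(0)=\lim_{\rho\to0^+}\rho f_n''(\rho)/f_n'(\rho)$, and $g_n'$ is the inverse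 function of $f_n'$.
   Context: An admissible Lagrangean is a function $f:[0,+\infty)\to\mathbb{R}$ that is strictly convex, belongs to $C^1([0,+\infty))\cap C^{2,\lambda}_{loc}((0,+\infty))$ for some $0<\lambda<1$, satisfies $f'(0)>0$, and is such that $\rho f''(\rho)/f'(\rho)$ has finite limits as $\rho\to0^+$ and as $\rho\to+\infty$, the limit at $+\infty$ being strictly positive. $\mathrm{Lip}(\overline\Omega)$ is the space of Lipschitz continuous functions on $\overline\Omega$. The pair $(\Omega,\psi)$ satisfies a bounded slope condition (with constant $Q>0$) if for every $x_0\in\partial\Omega$ there exist two affine functions $L^+,L^-$ such that $L^-\le\psi\le L^+$ on $\partial\Omega$, $L^-(x_0)=\psi(x_0)=L^+(x_0)$, and $\sup_{x,y\in\Omega,\,x\ne y}\frac{|L^\pm(x)-L^\pm(y)|}{|x-y|}\le Q$. The right-hand sides of the system in (i) are understood to be $0$ where $\nabla u_n=0$. $\Delta_\infty v=\langle\nabla^2v\,\nabla v,\nabla v\rangle$. Viscosity solutions are meant in the usual (Crandall–Ishii–Lions) sense. *)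

theory Defs
  imports "HOL-Analysis.Analysis"
begin

section \<open>Lagrangeans on the half line\<close>

text \<open>The derivative on \<open>[0, +\<infinity>)\<close>: one-sided at \<open>0\<close>, the ordinary one at positive points.\<close>

definition hderiv :: "(real \<Rightarrow> real) \<Rightarrow> real \<Rightarrow> real" where
  "hderiv f \<rho> = vector_derivative f (at \<rho> within {0..})"

definition hderiv2 :: "(real \<Rightarrow> real) \<Rightarrow> real \<Rightarrow> real" where
  "hderiv2 f \<rho> = deriv (hderiv f) \<rho>"

definition strictly_convex_on :: "'a::real_vector set \<Rightarrow> ('a \<Rightarrow> real) \<Rightarrow> bool" where
  "strictly_convex_on S f \<longleftrightarrow> convex S \<and>
     (\<forall>x\<in>S. \<forall>y\<in>S. \<forall>t. x \<noteq> y \<and> 0 < t \<and> t < 1 \<longrightarrow>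
        f ((1 - t) *\<^sub>R x + t *\<^sub>R y) < (1 - t) * f x + t * f y)"

definition C1_halfline :: "(real \<Rightarrow> real) \<Rightarrow> bool" where
  "C1_halfline f \<longleftrightarrow> f differentiable_on {0..} \<and> continuous_on {0..} (hderiv f)"

definition C2_Holder_loc :: "real \<Rightarrow> (real \<Rightarrow> real) \<Rightarrow> bool" where
  "C2_Holder_loc lam f \<longleftrightarrow>
     f differentiable_on {0<..} \<and> hderiv f differentiable_on {0<..} \<and>
     continuous_on {0<..} (hderiv2 f) \<and>
     (\<forall>K. compact K \<and> K \<subseteq> {0<..} \<longrightarrow>
        (\<exists>C. \<forall>x\<in>K. \<forall>y\<in>K. \<bar>hderiv2 f x - hderiv2 f y\<bar> \<le> C * \<bar>x - y\<bar> powr lam))"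

definition admissible_Lagrangean :: "real \<Rightarrow> (real \<Rightarrow> real) \<Rightarrow> bool" where
  "admissible_Lagrangean lam f \<longleftrightarrow>
     0 < lam \<and> lam < 1 \<and>
     strictly_convex_on {0..} f \<and> C1_halfline f \<and> C2_Holder_loc lam f \<and>
     hderiv f 0 > 0 \<and>
     (\<exists>l. ((\<lambda>\<rho>. \<rho> * hderiv2 f \<rho> / hderiv f \<rho>) \<longlongrightarrow> l) (at_right 0)) \<and>
     (\<exists>l>0. ((\<lambda>\<rho>. \<rho> * hderiv2 f \<rho> / hderiv f \<rho>) \<longlongrightarrow> l) at_top)"


section \<open>Gradients and Hessians\<close>

text \<open>The value \<open>0\<close> at points of non-differentiability is a convention; for Lipschitz functions
  these points form a null set.\<close>

definition grad :: "(real ^ 'n \<Rightarrow> real) \<Rightarrow> real ^ 'n \<Rightarrow> real ^ 'n" where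
  "grad w x = (if \<exists>D. GDERIV w x :> D then THE D. GDERIV w x :> D else 0)"

definition hessian :: "(real ^ 'n \<Rightarrow> real) \<Rightarrow> real ^ 'n \<Rightarrow> real ^ 'n ^ 'n" where
  "hessian w x = jacobian (grad w) (at x)"

text \<open>For open sets.\<close>

definition C2_on :: "(real ^ 'n) set \<Rightarrow> (real ^ 'n \<Rightarrow> real) \<Rightarrow> bool" where
  "C2_on U w \<longleftrightarrow>
     (\<forall>x\<in>U. w differentiable at x) \<and> (\<forall>x\<in>U. grad w differentiable at x) \<and>
     continuous_on U (hessian w)"


section \<open>The Dirichlet problem\<close>

definition Lip :: "'a::metric_space set \<Rightarrow> ('a \<Rightarrow> real) \<Rightarrow> bool" where
  "Lip S w \<longleftrightarrow> (\<exists>C. C-lipschitz_on S w)"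

definition affine_function :: "('a::real_inner \<Rightarrow> real) \<Rightarrow> bool" where
  "affine_function L \<longleftrightarrow> (\<exists>p c. \<forall>x. L x = p \<bullet> x + c)"

definition bounded_slope_condition ::
    "(real ^ 'n) set \<Rightarrow> (real ^ 'n \<Rightarrow> real) \<Rightarrow> real \<Rightarrow> bool" where
  "bounded_slope_condition \<Omega> \<psi> Q \<longleftrightarrow> Q > 0 \<and>
     (\<forall>x0\<in>frontier \<Omega>. \<exists>Lp Lm. affine_function Lp \<and> affine_function Lm \<and>
        (\<forall>x\<in>frontier \<Omega>. Lm x \<le> \<psi> x \<and> \<psi> x \<le> Lp x) \<and>
        Lm x0 = \<psi> x0 \<and> Lp x0 = \<psi> x0 \<and>
        (\<forall>x\<in>\<Omega>. \<forall>y\<in>\<Omega>. x \<noteq> y \<longrightarrow> \<bar>Lp x - Lp y\<bar> / norm (x - y) \<le> Q) \<and>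
        (\<forall>x\<in>\<Omega>. \<forall>y\<in>\<Omega>. x \<noteq> y \<longrightarrow> \<bar>Lm x - Lm y\<bar> / norm (x - y) \<le> Q))"

definition energy :: "(real ^ 'n) set \<Rightarrow> (real \<Rightarrow> real) \<Rightarrow> (real ^ 'n \<Rightarrow> real) \<Rightarrow> real" where
  "energy \<Omega> f w = (LINT x:\<Omega>|lebesgue. f (norm (grad w x)))"

definition is_minimizer ::
    "(real ^ 'n) set \<Rightarrow> (real ^ 'n \<Rightarrow> real) \<Rightarrow> (real \<Rightarrow> real) \<Rightarrow> (real ^ 'n \<Rightarrow> real) \<Rightarrow> bool" where
  "is_minimizer \<Omega> \<psi> f u \<longleftrightarrow>
     is_arg_min (energy \<Omega> f) (\<lambda>w. Lip (closure \<Omega>) w \<and> (\<forall>x\<in>frontier \<Omega>. w x = \<psi> x)) u"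


section \<open>Distributional partial derivatives\<close>

text \<open>All iterated partial derivatives are differentiable everywhere.\<close>

definition smooth :: "(real ^ 'n \<Rightarrow> real) \<Rightarrow> bool" where
  "smooth \<phi> \<longleftrightarrow>
     (\<forall>is. (foldr (\<lambda>i h x. grad h x $ i) is \<phi>) differentiable_on UNIV)"

definition test_function :: "(real ^ 'n) set \<Rightarrow> (real ^ 'n \<Rightarrow> real) \<Rightarrow> bool" where
  "test_function \<Omega> \<phi> \<longleftrightarrow>
     smooth \<phi> \<and> compact (closure {x. \<phi> x \<noteq> 0}) \<and> closure {x. \<phi> x \<noteq> 0} \<subseteq> \<Omega>"

definition locally_integrable :: "(real ^ 'n) set \<Rightarrow> (real ^ 'n \<Rightarrow> real) \<Rightarrow> bool" where
  "locally_integrable \<Omega> F \<longleftrightarrow>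
     (\<forall>K. compact K \<and> K \<subseteq> \<Omega> \<longrightarrow> set_integrable lebesgue K F)"

definition has_distributional_partial ::
    "(real ^ 'n) set \<Rightarrow> 'n \<Rightarrow> (real ^ 'n \<Rightarrow> real) \<Rightarrow> (real ^ 'n \<Rightarrow> real) \<Rightarrow> bool" where
  "has_distributional_partial \<Omega> i v F \<longleftrightarrow>
     locally_integrable \<Omega> v \<and> locally_integrable \<Omega> F \<and>
     (\<forall>\<phi>. test_function \<Omega> \<phi> \<longrightarrow>
        (LINT x:\<Omega>|lebesgue. v x * grad \<phi> x $ i) = - (LINT x:\<Omega>|lebesgue. F x * \<phi> x))"

definition flux :: "(real \<Rightarrow> real) \<Rightarrow> (real ^ 'n \<Rightarrow> real) \<Rightarrow> 'n \<Rightarrow> real ^ 'n \<Rightarrow> real" where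
  "flux f u i x =
     (if grad u x = 0 then 0 else hderiv f (norm (grad u x)) * (grad u x $ i) / norm (grad u x))"

text \<open>The normalized stream function: \<open>\<partial>\<^sub>x v = - flux\<^sub>y\<close>, \<open>\<partial>\<^sub>y v = flux\<^sub>x\<close> and \<open>v\<close> has mean zero.\<close>

definition conjugate_solution ::
    "(real ^ 2) set \<Rightarrow> (real \<Rightarrow> real) \<Rightarrow> (real ^ 2 \<Rightarrow> real) \<Rightarrow> (real ^ 2 \<Rightarrow> real) \<Rightarrow> bool" where
  "conjugate_solution \<Omega> f u v \<longleftrightarrow>
     Lip \<Omega> v \<and>
     has_distributional_partial \<Omega> 1 v (\<lambda>x. - flux f u 2 x) \<and>
     has_distributional_partial \<Omega> 2 v (\<lambda>x. flux f u 1 x) \<and>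
     (LINT x:\<Omega>|lebesgue. v x) = 0"


section \<open>Viscosity solutions\<close>

text \<open>Equations \<open>F (\<nabla>v) (\<nabla>\<^sup>2v) = 0\<close> with \<open>F\<close> degenerate elliptic, that is, nonincreasing in the
  second argument.\<close>

definition viscosity_subsolution ::
    "(real ^ 'n) set \<Rightarrow> (real ^ 'n \<Rightarrow> real ^ 'n ^ 'n \<Rightarrow> real) \<Rightarrow> (real ^ 'n \<Rightarrow> real) \<Rightarrow> bool" where
  "viscosity_subsolution \<Omega> F v \<longleftrightarrow>
     (\<forall>\<phi> x0. C2_on \<Omega> \<phi> \<and> x0 \<in> \<Omega> \<and> (\<forall>\<^sub>F x in nhds x0. v x - \<phi> x \<le> v x0 - \<phi> x0) \<longrightarrow>
        F (grad \<phi> x0) (hessian \<phi> x0) \<le> 0)"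

definition viscosity_supersolution ::
    "(real ^ 'n) set \<Rightarrow> (real ^ 'n \<Rightarrow> real ^ 'n ^ 'n \<Rightarrow> real) \<Rightarrow> (real ^ 'n \<Rightarrow> real) \<Rightarrow> bool" where
  "viscosity_supersolution \<Omega> F v \<longleftrightarrow>
     (\<forall>\<phi> x0. C2_on \<Omega> \<phi> \<and> x0 \<in> \<Omega> \<and> (\<forall>\<^sub>F x in nhds x0. v x0 - \<phi> x0 \<le> v x - \<phi> x) \<longrightarrow>
        F (grad \<phi> x0) (hessian \<phi> x0) \<ge> 0)"

definition viscosity_solution ::
    "(real ^ 'n) set \<Rightarrow> (real ^ 'n \<Rightarrow> real ^ 'n ^ 'n \<Rightarrow> real) \<Rightarrow> (real ^ 'n \<Rightarrow> real) \<Rightarrow> bool" where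
  "viscosity_solution \<Omega> F v \<longleftrightarrow>
     continuous_on \<Omega> v \<and> viscosity_subsolution \<Omega> F v \<and> viscosity_supersolution \<Omega> F v"

definition alpha :: "(real \<Rightarrow> real) \<Rightarrow> real \<Rightarrow> real" where
  "alpha f \<rho> =
     (if \<rho> > 0 then \<rho> * hderiv2 f \<rho> / hderiv f \<rho>
      else Lim (at_right 0) (\<lambda>r. r * hderiv2 f r / hderiv f r))"

text \<open>The inverse of \<open>f'\<close> on \<open>[0, +\<infinity>)\<close>; meaningful only on the range of \<open>f'\<close>.\<close>

definition gprime :: "(real \<Rightarrow> real) \<Rightarrow> real \<Rightarrow> real" where
  "gprime f = inv_into {0..} (hderiv f)"

text \<open>Here \<open>p\<close> stands for \<open>\<nabla>v\<close> and \<open>X\<close> for \<open>\<nabla>\<^sup>2v\<close>, so \<open>(X *v p) \<bullet> p\<close> is \<open>\<Delta>\<^sub>\<infinity> v\<close> and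
  \<open>trace X\<close> is \<open>\<Delta> v\<close>.\<close>

definition dual_operator ::
    "(real \<Rightarrow> real) \<Rightarrow> real ^ 'n \<Rightarrow> real ^ 'n ^ 'n \<Rightarrow> real" where
  "dual_operator f p X =
     - (1 - alpha f (gprime f (norm p))) * ((X *v p) \<bullet> p)
     - (norm p)\<^sup>2 * alpha f (gprime f (norm p)) * trace X"

end

theory Submission
  imports Defs "HOL-Complex_Analysis.Great_Picard"
begin

text \<open>A minimiser \<open>u\<close> is a critical point of its energy, so the field \<open>B (\<nabla>u)\<close> with
\<open>B q = (f'(|q|) / |q|) q\<close> has divergence zero in the weak sense. Let \<open>rot\<close> be the rotation of the plane
by a right angle. Then \<open>rot (B (\<nabla>u))\<close> has curl zero, and the system in the first assertion
says exactly that \<open>v\<close> is a Lipschitz potential of this field.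

\<^emph>\<open>Existence and uniqueness.\<close> Suppose that a segment with both ends in \<open>\<Omega>\<close> meets
the frontier at \<open>x0\<close>. If the two affine functions of the bounded slope condition at \<open>x0\<close> were distinct, then
\<open>{L\<^sup>- < L\<^sup>+}\<close> would be an open half-plane which contains \<open>\<Omega>\<close> and has \<open>x0\<close> on its boundary; but then it
would contain the whole segment, and \<open>x0\<close> with it. So \<open>L\<^sup>- = L\<^sup>+\<close>, and \<open>\<psi>\<close> agrees with an affine function on the
frontier. Hence either \<open>\<Omega>\<close> is convex or the boundary data are affine
(\<open>bounded_slope_affine_or_convex\<close>). For affine data the strict monotonicity of \<open>B\<close> forces \<open>\<nabla>u\<close> to be
constant (\<open>affine_boundary_grad_constant\<close>), and \<open>v\<close> is affine. On a convex domain the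
field is mollified, the mollified fields have potentials given by line integrals, and a limit of
these potentials is a potential of the original field (\<open>weak_poincare\<close>). Two potentials differ by a
Lipschitz function whose gradient vanishes almost everywhere; it is constant, and zero by the normalisation.

\<^emph>\<open>Viscosity solution.\<close> Rotating the system gives \<open>\<nabla>v = B (rot \<nabla>u)\<close>, so \<open>v\<close> is a weak solution
of \<open>div A (\<nabla>v) = 0\<close> with \<open>A = B\<^sup>-\<^sup>1\<close>: the field \<open>A (\<nabla>v) = rot \<nabla>u\<close> is divergence free
because it is a rotated gradient. Formally, \<open>div A (\<nabla>\<phi>)\<close> is a positive multiple of the operator of
the second assertion, with the opposite sign. Suppose that a test function \<open>\<phi>\<close> touches \<open>v\<close> from above
at \<open>x0\<close> and that the operator is positive there. Then \<open>\<nabla>\<phi> x0 \<noteq> 0\<close>, since the operator vanishes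
for zero gradient. Adding \<open>c |x - x0|\<^sup>2\<close> makes the contact strict, so that
\<open>\<eta> = (v - \<phi> + \<delta>)\<^sup>+\<close> is supported in a small ball, on which \<open>div A (\<nabla>\<phi>) \<le> 0\<close>
holds weakly. Testing both relations with \<open>\<eta>\<close> gives
\<open>\<integral> (A (\<nabla>v) - A (\<nabla>\<phi>)) \<bullet> \<nabla>\<eta> \<le> 0\<close>, whereas \<open>\<nabla>\<eta> = \<nabla>v - \<nabla>\<phi>\<close> where \<open>\<eta> > 0\<close>.
Strict monotonicity makes \<open>\<nabla>\<eta>\<close> zero almost everywhere, which contradicts \<open>\<eta> x0 = \<delta> > 0\<close>. Since \<open>f''\<close> may
vanish, \<open>A\<close> need not be differentiable; the divergence is therefore computed for the inverse of
\<open>B + \<epsilon> id\<close>, and \<open>\<epsilon>\<close> tends to zero (\<open>conjugate_viscosity_subsolution\<close>). The change of signs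
\<open>(u, v) \<mapsto> (-u, -v)\<close> exchanges sub- and supersolutions.

\<^emph>\<open>Calculus for Lipschitz functions.\<close> The functions \<open>u\<close>, \<open>v\<close> and \<open>\<eta>\<close> are merely Lipschitz. Rademacher's
theorem (\<open>rademacher_plane\<close>) makes them differentiable almost everywhere. Integration by parts then
reduces to the translation invariance of Lebesgue measure: it holds exactly for difference quotients,
which are bounded and converge almost everywhere to derivatives. The fundamental lemma of the
calculus of variations identifies distributional with pointwise partial derivatives.\<close>

section \<open>Lipschitz functions of one variable\<close>

text \<open>Adding a large multiple of the identity turns \<open>f\<close> into an increasing function \<open>F\<close> with a Lipschitz
inverse \<open>G\<close>. The image of Lebesgue measure under \<open>G\<close> gives \<open>{a..b}\<close> the mass \<open>F b - F a\<close>, and it is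
absolutely continuous because \<open>F\<close> is Lipschitz. Its Radon--Nikodym density is the derivative of
\<open>F\<close>.\<close>
lemma lipschitz_real_has_integral_derivative:
  fixes f :: "real \<Rightarrow> real"
  assumes lip: "C-lipschitz_on UNIV f"
  obtains g where "\<And>a b. a \<le> b \<Longrightarrow> (g has_integral (f b - f a)) {a..b}"
proof -
  have C0: "C \<ge> 0" using lip by (rule lipschitz_on_nonneg)
  have fl: "\<bar>f x - f y\<bar> \<le> C * \<bar>x - y\<bar>" for x y
    using lipschitz_onD[OF lip, of x y] by (simp add: dist_real_def)
  \<comment> \<open>The slopes of \<open>F\<close> lie between \<open>1\<close> and \<open>2 * C + 1\<close>, so \<open>F\<close> is
    a bi-Lipschitz bijection of the line.\<close>
  define F where "F x = f x + (C + 1) * x" for x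
  have Flow: "b - a \<le> F b - F a" if "a \<le> b" for a b
    using fl[of a b] that by (auto simp: F_def algebra_simps abs_if split: if_splits)
  have Fup: "\<bar>F b - F a\<bar> \<le> (2*C+1) * \<bar>b - a\<bar>" for a b
  proof -
    have "\<bar>F b - F a\<bar> \<le> \<bar>f b - f a\<bar> + \<bar>(C+1) * (b - a)\<bar>"
      unfolding F_def by (simp add: algebra_simps)
    also have "\<dots> \<le> C * \<bar>b - a\<bar> + (C+1) * \<bar>b - a\<bar>"
      using fl[of b a] C0 by (simp add: abs_mult)
    finally show ?thesis by (simp add: algebra_simps)
  qed
  have contF: "continuous_on UNIV F"
    unfolding F_def by (intro continuous_intros lipschitz_on_continuous_on[OF lip])
  have smF: "strict_mono F"
    unfolding strict_mono_def using Flow by (metis diff_gt_0_iff_gt less_le_trans order_less_imp_le)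
  have injF: "inj F" using smF by (rule strict_mono_imp_inj_on)
  have surjF: "\<exists>x. F x = y" for y
  proof -
    let ?R = "\<bar>y\<bar> + \<bar>F 0\<bar>"
    have "F (- ?R) \<le> y" "y \<le> F ?R"
      using Flow[of "- ?R" 0] Flow[of 0 ?R] by linarith+
    moreover have "- ?R \<le> ?R" by simp
    ultimately show ?thesis
      using IVT'[of F "- ?R" y ?R] continuous_on_subset[OF contF] by blast
  qed
  define G where "G = inv F"
  have FG[simp]: "F (G y) = y" and GF[simp]: "G (F x) = x" for x y
    unfolding G_def using surjF injF by (auto simp: f_inv_into_f[of _ F UNIV] image_iff)
       (metis surjF f_inv_into_f rangeI)
  have Glip: "\<bar>G x - G y\<bar> \<le> \<bar>x - y\<bar>" for x y
    using Flow[of "G x" "G y"] Flow[of "G y" "G x"] by (auto simp: abs_if)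
  have "1-lipschitz_on UNIV G"
    by (rule lipschitz_onI) (use Glip in \<open>auto simp: dist_real_def\<close>)
  then have contG: "continuous_on UNIV G" by (rule lipschitz_on_continuous_on)
  have Gm[measurable]: "G \<in> borel_measurable borel"
    using contG by (rule borel_measurable_continuous_onI)
  define N where "N = distr lborel borel G"
  have vimG: "G -` A = F ` A" for A by (auto intro: image_eqI[of _ F "G _"])
  have ac: "absolutely_continuous lborel N"
    unfolding absolutely_continuous_def
  proof
    fix A :: "real set" assume A: "A \<in> null_sets lborel"
    then have Ab: "A \<in> sets borel" by auto
    have "negligible A" using A by (simp add: negligible_iff_null_sets null_sets_completionI)
    then have "negligible (F ` A)"
      using Fup by (intro negligible_locally_Lipschitz_image) (auto intro!: exI[of _ UNIV])
    then have "emeasure lebesgue (G -` A) = 0"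
      unfolding vimG negligible_iff_null_sets by (rule null_setsD1)
    moreover have "G -` A \<in> sets borel"
      using measurable_sets[OF Gm Ab] by simp
    ultimately have "emeasure lborel (G -` A) = 0"
      by (simp add: emeasure_completion)
    then show "A \<in> null_sets N"
      using Ab by (auto simp: null_sets_def N_def emeasure_distr)
  qed
  obtain h where hm: "h \<in> borel_measurable lborel" and h: "density lborel h = N"
    using sigma_finite_measure.Radon_Nikodym[OF sigma_finite_lborel ac] by (auto simp: N_def)
  have hm'[measurable]: "h \<in> borel_measurable borel" using hm by simp
  have Nab: "(\<integral>\<^sup>+x. h x * indicator {a..b} x \<partial>lborel) = ennreal (F b - F a)" if "a \<le> b" for a b
  proof -
    have "(\<integral>\<^sup>+x. h x * indicator {a..b} x \<partial>lborel) = emeasure N {a..b}"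
      unfolding h[symmetric] by (subst emeasure_density) auto
    also have "\<dots> = emeasure lborel (G -` {a..b})"
      by (simp add: N_def emeasure_distr)
    also have "G -` {a..b} = {F a..F b}"
    proof -
      have "a \<le> G y \<longleftrightarrow> F a \<le> y" "G y \<le> b \<longleftrightarrow> y \<le> F b" for y
        using strict_mono_less_eq[OF smF, of a "G y"] strict_mono_less_eq[OF smF, of "G y" b] by auto
      then show ?thesis by auto
    qed
    also have "emeasure lborel {F a..F b} = ennreal (F b - F a)"
      using Flow[OF that] that by simp
    finally show ?thesis .
  qed
  have AEfin: "AE x in lborel. h x \<noteq> \<infinity>"
  proof -
    have "AE x in lborel. h x * indicator {- real n..real n} x \<noteq> \<infinity>" for n
      by (rule nn_integral_noteq_infinite) (auto simp: Nab)
    then have "AE x in lborel. \<forall>n. h x * indicator {- real n..real n} x \<noteq> \<infinity>"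
      by (simp add: AE_all_countable)
    then show ?thesis
    proof eventually_elim
      case (elim x)
      obtain n where "\<bar>x\<bar> \<le> real n" using real_arch_simple by blast
      then show ?case using elim[rule_format, of n] by (auto simp: indicator_def abs_le_iff split: if_splits)
    qed
  qed
  define g where "g x = enn2real (h x) - (C+1)" for x
  have "(g has_integral (f b - f a)) {a..b}" if ab: "a \<le> b" for a b
  proof -
    have "((\<lambda>x. enn2real (h x) * indicator {a..b} x) has_integral (F b - F a)) UNIV"
    proof (rule nn_integral_has_integral)
      have "(\<integral>\<^sup>+x. ennreal (enn2real (h x) * indicator {a..b} x) \<partial>lborel)
            = (\<integral>\<^sup>+x. h x * indicator {a..b} x \<partial>lborel)"
      proof (rule nn_integral_cong_AE)
        show "AE x in lborel. ennreal (enn2real (h x) * indicator {a..b} x) = h x * indicator {a..b} x"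
          using AEfin by eventually_elim (auto simp: indicator_def less_top)
      qed
      then show "(\<integral>\<^sup>+x. ennreal (enn2real (h x) * indicator {a..b} x) \<partial>lborel) = ennreal (F b - F a)"
        using Nab[OF ab] by simp
    qed (use Flow[OF ab] ab in auto)
    then have "((\<lambda>x. if x \<in> {a..b} then enn2real (h x) else 0) has_integral (F b - F a)) UNIV"
      by (rule has_integral_eq[rotated]) (auto simp: indicator_def)
    then have "((\<lambda>x. enn2real (h x)) has_integral (F b - F a)) {a..b}"
      by (simp only: has_integral_restrict_UNIV)
    from has_integral_diff[OF this has_integral_const_real[of "C+1" a b]]
    show ?thesis using ab by (simp add: g_def[abs_def] F_def algebra_simps)
  qed
  then show thesis by (rule that)
qed

text \<open>By Lebesgue's differentiation theorem the integral averages of the density \<open>g\<close> over intervals to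
the right of a point converge almost everywhere; these averages are the right difference quotients of \<open>f\<close>.
Left quotients are right quotients of the reflected function.\<close>
lemma lipschitz_real_differentiable_AE:
  fixes f :: "real \<Rightarrow> real"
  assumes lip: "C-lipschitz_on UNIV f"
  shows "negligible {x. \<not> f differentiable at x}"
proof -
  obtain g where g: "\<And>a b. a \<le> b \<Longrightarrow> (g has_integral (f b - f a)) {a..b}"
    using lipschitz_real_has_integral_derivative[OF lip] by blast
  have int: "g integrable_on cbox a b" for a b
    using g[of a b] by (cases "a \<le> b") (auto simp: integrable_on_def)
  obtain N1 where N1: "negligible N1"
    "\<And>x e. \<lbrakk>x \<notin> N1; 0 < e\<rbrakk> \<Longrightarrow> \<exists>d>0. \<forall>h. 0 < h \<and> h < d \<longrightarrow>
        norm(integral (cbox x (x + h *\<^sub>R One)) g /\<^sub>R h ^ DIM(real) - g x) < e"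
    using integrable_ccontinuous_explicit[OF int] by blast
  have g': "((\<lambda>x. g (- x)) has_integral (f (-a) - f (-b))) {a..b}" if "a \<le> b" for a b
    using has_integral_reflect_real[of g "f (-a) - f (-b)" "-a" "-b"] g[of "-b" "-a"] that
    by simp
  have int': "(\<lambda>x. g (- x)) integrable_on cbox a b" for a b
    using g'[of a b] by (cases "a \<le> b") (auto simp: integrable_on_def)
  obtain N2 where N2: "negligible N2"
    "\<And>x e. \<lbrakk>x \<notin> N2; 0 < e\<rbrakk> \<Longrightarrow> \<exists>d>0. \<forall>h. 0 < h \<and> h < d \<longrightarrow>
        norm(integral (cbox x (x + h *\<^sub>R One)) (\<lambda>x. g (- x)) /\<^sub>R h ^ DIM(real) - g (- x)) < e"
    using integrable_ccontinuous_explicit[OF int'] by blast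
  have "negligible (N1 \<union> uminus ` N2)"
    using N1(1) N2(1) by (intro negligible_Un negligible_differentiable_image_negligible) (auto intro!: derivative_intros)
  moreover have "{x. \<not> f differentiable at x} \<subseteq> N1 \<union> uminus ` N2"
  proof (rule ccontr)
    assume "\<not> ?thesis"
    then obtain x where nd: "\<not> f differentiable at x" and x1: "x \<notin> N1" and x2: "- x \<notin> N2"
      by force
    have "((\<lambda>h. (f (x + h) - f x) / h) \<longlongrightarrow> g x) (at 0)"
      unfolding LIM_eq
    proof (intro allI impI)
      fix e :: real assume "0 < e"
      obtain d1 where d1: "d1 > 0" "\<And>h. 0 < h \<Longrightarrow> h < d1 \<Longrightarrow>
         norm(integral (cbox x (x + h *\<^sub>R One)) g /\<^sub>R h ^ DIM(real) - g x) < e"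
        using N1(2)[OF x1 \<open>0 < e\<close>] by blast
      obtain d2 where d2: "d2 > 0" "\<And>h. 0 < h \<Longrightarrow> h < d2 \<Longrightarrow>
         norm(integral (cbox (-x) (-x + h *\<^sub>R One)) (\<lambda>x. g (-x)) /\<^sub>R h ^ DIM(real) - g x) < e"
        using N2(2)[OF x2 \<open>0 < e\<close>] by auto
      have "norm ((f (x + h) - f x) / h - g x) < e" if h: "h \<noteq> 0" "norm h < min d1 d2" for h
      proof (cases "h > 0")
        case True
        have "integral {x..x + h} g = f (x + h) - f x"
          using g[of x "x+h"] True by (simp add: integral_unique)
        then show ?thesis using d1(2)[of h] True h by (simp add: divide_inverse mult.commute)
      next
        case False
        define k where "k = - h"
        have k: "k > 0" "k < d2" "h = - k" using False h by (auto simp: k_def)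
        have "integral {-x..-x + k} (\<lambda>x. g (-x)) = f x - f (x - k)"
          using g'[of "-x" "-x+k"] k by (simp add: integral_unique)
        then have "norm ((f x - f (x - k)) / k - g x) < e"
          using d2(2)[of k] k by (simp add: divide_inverse mult.commute)
        moreover have "(f x - f (x - k)) / k = (f (x + h) - f x) / h"
          using k by (simp add: field_simps)
        ultimately show ?thesis by simp
      qed
      then show "\<exists>s>0. \<forall>h. h \<noteq> 0 \<and> norm (h - 0) < s \<longrightarrow> norm ((f (x + h) - f x) / h - g x) < e"
        using d1(1) d2(1) by (intro exI[of _ "min d1 d2"]) auto
    qed
    then have "DERIV f x :> g x" by (simp add: DERIV_def)
    then show False using nd by (metis real_differentiable_def)
  qed
  ultimately show ?thesis by (rule negligible_subset)
qed

section \<open>Directional derivatives of Lipschitz functions\<close>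

text \<open>Differentiability is a Cauchy condition on difference quotients, and by continuity rational increments
suffice. In this form it involves only countably many quantifiers, so the set of points where a partial
derivative exists is Borel, as Fubini's theorem requires.\<close>
lemma real_differentiable_iff_rational_quotients:
  fixes f :: "real \<Rightarrow> real"
  assumes cont: "continuous_on UNIV f"
  shows "f differentiable at y \<longleftrightarrow>
    (\<forall>n. \<exists>m. \<forall>s t :: rat. s \<noteq> 0 \<and> t \<noteq> 0 \<and> \<bar>real_of_rat s\<bar> < 1 / Suc m \<and> \<bar>real_of_rat t\<bar> < 1 / Suc m \<longrightarrow>
       \<bar>(f (y + of_rat s) - f y) / of_rat s - (f (y + of_rat t) - f y) / of_rat t\<bar> \<le> 1 / Suc n)"
    (is "_ \<longleftrightarrow> ?R")
proof
  define q where "q s = (f (y + s) - f y) / s" for s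
  show ?R if "f differentiable at y"
  proof
    fix n :: nat
    obtain l where "DERIV f y :> l" using \<open>f differentiable at y\<close> by (auto simp: real_differentiable_def)
    then have lim: "(q \<longlongrightarrow> l) (at 0)" by (simp add: DERIV_def q_def[abs_def])
    have "0 < 1 / (2 * real (Suc n))" by simp
    then obtain d where d: "d > 0" "\<And>s. s \<noteq> 0 \<Longrightarrow> \<bar>s\<bar> < d \<Longrightarrow> \<bar>q s - l\<bar> < 1 / (2 * real (Suc n))"
      using lim unfolding LIM_eq by (metis diff_zero real_norm_def)
    obtain m where m: "1 / Suc m < d" using \<open>d > 0\<close> nat_approx_posE by metis
    have "\<bar>q (of_rat s) - q (of_rat t)\<bar> \<le> 1 / Suc n"
      if "s \<noteq> 0" "t \<noteq> 0" "\<bar>real_of_rat s\<bar> < 1 / Suc m" "\<bar>real_of_rat t\<bar> < 1 / Suc m" for s t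
    proof -
      have "\<bar>q (of_rat s) - l\<bar> < 1 / (2 * real (Suc n))" "\<bar>q (of_rat t) - l\<bar> < 1 / (2 * real (Suc n))"
        using that m by (auto intro!: d(2) simp del: abs_of_rat of_nat_Suc dest: less_trans)
      then have "\<bar>q (of_rat s) - q (of_rat t)\<bar> \<le> 2 * (1 / (2 * real (Suc n)))" by argo
      then show ?thesis by (simp add: field_simps)
    qed
    then show "\<exists>m. \<forall>s t :: rat. s \<noteq> 0 \<and> t \<noteq> 0 \<and> \<bar>real_of_rat s\<bar> < 1 / Suc m \<and> \<bar>real_of_rat t\<bar> < 1 / Suc m \<longrightarrow>
       \<bar>(f (y + of_rat s) - f y) / of_rat s - (f (y + of_rat t) - f y) / of_rat t\<bar> \<le> 1 / Suc n"
      unfolding q_def by blast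
  qed
  show "f differentiable at y" if R: ?R
  proof -
    have qcont: "isCont q s" if "s \<noteq> 0" for s
    proof -
      have "isCont f (y + s)" using cont by (simp add: continuous_on_eq_continuous_at)
      then have "isCont (\<lambda>s. f (y + s)) s" by (intro isCont_o2[of s "\<lambda>s. y + s" f] continuous_intros)
      then show ?thesis unfolding q_def using that by (intro continuous_intros)
    qed
    have ratseq: "\<exists>r. (\<lambda>k. real_of_rat (r k)) \<longlonglongrightarrow> s" for s
    proof -
      have "\<exists>r. s < real_of_rat r \<and> real_of_rat r < s + 1 / Suc k" for k
        by (rule of_rat_dense) simp
      then obtain r where r: "\<And>k. s < real_of_rat (r k) \<and> real_of_rat (r k) < s + 1 / Suc k" by metis
      have "(\<lambda>k. real_of_rat (r k)) \<longlonglongrightarrow> s"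
      proof (rule tendsto_sandwich[of "\<lambda>_. s" _ _ "\<lambda>k. s + 1 / Suc k"])
        show "(\<lambda>k. s + 1 / Suc k) \<longlonglongrightarrow> s"
          using tendsto_add[OF tendsto_const LIMSEQ_inverse_real_of_nat, of s] by (simp add: inverse_eq_divide)
      qed (use r in \<open>auto intro!: always_eventually less_imp_le simp del: of_nat_Suc\<close>)
      then show ?thesis by blast
    qed
    have real: "\<exists>d>0. \<forall>s t. s \<noteq> 0 \<and> t \<noteq> 0 \<and> \<bar>s\<bar> < d \<and> \<bar>t\<bar> < d \<longrightarrow> \<bar>q s - q t\<bar> \<le> 1 / Suc n" for n
    proof -
      obtain m where m: "\<And>s t :: rat. s \<noteq> 0 \<Longrightarrow> t \<noteq> 0 \<Longrightarrow> \<bar>real_of_rat s\<bar> < 1 / Suc m \<Longrightarrow> \<bar>real_of_rat t\<bar> < 1 / Suc m \<Longrightarrow>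
         \<bar>q (of_rat s) - q (of_rat t)\<bar> \<le> 1 / Suc n" using R unfolding q_def by blast
      have "\<bar>q s - q t\<bar> \<le> 1 / Suc n" if st: "s \<noteq> 0" "t \<noteq> 0" "\<bar>s\<bar> < 1 / Suc m" "\<bar>t\<bar> < 1 / Suc m" for s t
      proof -
        obtain r1 where r1: "(\<lambda>k. real_of_rat (r1 k)) \<longlonglongrightarrow> s" using ratseq by blast
        obtain r2 where r2: "(\<lambda>k. real_of_rat (r2 k)) \<longlonglongrightarrow> t" using ratseq by blast
        have e1: "\<forall>\<^sub>F k in sequentially. real_of_rat (r1 k) \<noteq> 0 \<and> \<bar>real_of_rat (r1 k)\<bar> < 1 / Suc m"
          using tendsto_imp_eventually_ne[OF r1 st(1)] order_tendstoD(2)[OF tendsto_rabs[OF r1] st(3)]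
          by eventually_elim auto
        have e2: "\<forall>\<^sub>F k in sequentially. real_of_rat (r2 k) \<noteq> 0 \<and> \<bar>real_of_rat (r2 k)\<bar> < 1 / Suc m"
          using tendsto_imp_eventually_ne[OF r2 st(2)] order_tendstoD(2)[OF tendsto_rabs[OF r2] st(4)]
          by eventually_elim auto
        have "(\<lambda>k. \<bar>q (of_rat (r1 k)) - q (of_rat (r2 k))\<bar>) \<longlonglongrightarrow> \<bar>q s - q t\<bar>"
          by (intro tendsto_intros isCont_tendsto_compose[OF qcont] r1 r2 st)
        moreover have "\<forall>\<^sub>F k in sequentially. \<bar>q (of_rat (r1 k)) - q (of_rat (r2 k))\<bar> \<le> 1 / Suc n"
          using e1 e2 by eventually_elim (rule m, auto)
        ultimately show ?thesis by (rule tendsto_upperbound) simp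
      qed
      then show ?thesis by (intro exI[of _ "1 / Suc m"]) auto
    qed
    have "Cauchy (\<lambda>k. q (1 / Suc k))"
    proof (rule metric_CauchyI)
      fix e :: real assume "0 < e"
      then obtain n where n: "1 / Suc n < e" using nat_approx_posE by metis
      obtain d where d: "d > 0" "\<And>s t. s \<noteq> 0 \<and> t \<noteq> 0 \<and> \<bar>s\<bar> < d \<and> \<bar>t\<bar> < d \<Longrightarrow> \<bar>q s - q t\<bar> \<le> 1 / Suc n"
        using real[of n] by blast
      obtain M where M: "1 / Suc M < d" using \<open>d > 0\<close> nat_approx_posE by metis
      have "1 / real (Suc k) < d" if "k \<ge> M" for k
        using M that by (smt (verit) frac_le of_nat_le_iff Suc_le_mono of_nat_0_less_iff zero_less_Suc)
      then have "dist (q (1 / Suc j)) (q (1 / Suc k)) < e" if "j \<ge> M" "k \<ge> M" for j k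
        using d(2)[of "1 / Suc j" "1 / Suc k"] n that by (auto simp: dist_real_def)
      then show "\<exists>M. \<forall>m\<ge>M. \<forall>n\<ge>M. dist (q (1 / Suc m)) (q (1 / Suc n)) < e" by blast
    qed
    then obtain L where L: "(\<lambda>k. q (1 / Suc k)) \<longlonglongrightarrow> L"
      using Cauchy_convergent convergent_def by metis
    have "(q \<longlongrightarrow> L) (at 0)"
      unfolding LIM_eq
    proof (intro allI impI)
      fix e :: real assume "0 < e"
      then obtain n where n: "1 / Suc n < e" using nat_approx_posE by metis
      obtain d where d: "d > 0" "\<And>s t. s \<noteq> 0 \<and> t \<noteq> 0 \<and> \<bar>s\<bar> < d \<and> \<bar>t\<bar> < d \<Longrightarrow> \<bar>q s - q t\<bar> \<le> 1 / Suc n"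
        using real[of n] by blast
      have "\<bar>q s - L\<bar> \<le> 1 / Suc n" if s: "s \<noteq> 0" "\<bar>s\<bar> < d" for s
      proof -
        have "(\<lambda>k. \<bar>q s - q (1 / Suc k)\<bar>) \<longlonglongrightarrow> \<bar>q s - L\<bar>" by (intro tendsto_intros L)
        moreover have "\<forall>\<^sub>F k in sequentially. \<bar>q s - q (1 / Suc k)\<bar> \<le> 1 / Suc n"
          using order_tendstoD(2)[OF LIMSEQ_inverse_real_of_nat \<open>d > 0\<close>]
          by eventually_elim (rule d(2), use s in \<open>auto simp: inverse_eq_divide\<close>)
        ultimately show ?thesis by (rule tendsto_upperbound) simp
      qed
      then show "\<exists>r>0. \<forall>s. s \<noteq> 0 \<and> norm (s - 0) < r \<longrightarrow> norm (q s - L) < e"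
        using d(1) n by (intro exI[of _ d]) force
    qed
    then have "DERIV f y :> L" by (simp add: DERIV_def q_def[abs_def])
    then show ?thesis by (auto simp: real_differentiable_def)
  qed
qed

text \<open>On each vertical line the exceptional set is a null set; Fubini's theorem assembles these null sets.\<close>
lemma lipschitz_plane_vertical_derivative_AE:
  fixes u :: "real \<times> real \<Rightarrow> real"
  assumes lip: "C-lipschitz_on UNIV u"
  shows "negligible {p. \<not> (\<lambda>t. u (fst p, t)) differentiable at (snd p)}"
proof -
  have cu: "continuous_on UNIV u" using lip by (rule lipschitz_on_continuous_on)
  have [measurable]: "u \<in> borel_measurable borel" using cu by (rule borel_measurable_continuous_onI)
  have lipx: "C-lipschitz_on UNIV (\<lambda>t. u (x, t))" for x
  proof (rule lipschitz_onI)
    show "dist (u (x, s)) (u (x, t)) \<le> C * dist s t" for s t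
      using lipschitz_onD[OF lip, of "(x,s)" "(x,t)"] by (simp add: dist_Pair_Pair)
  qed (rule lipschitz_on_nonneg[OF lip])
  have cx: "continuous_on UNIV (\<lambda>t. u (x, t))" for x using lipx by (rule lipschitz_on_continuous_on)
  let ?P = "\<lambda>p. (\<lambda>t. u (fst p, t)) differentiable at (snd p)"
  have "Measurable.pred (borel \<Otimes>\<^sub>M borel) ?P"
    unfolding real_differentiable_iff_rational_quotients[OF cx] by measurable
  then have meas: "{p \<in> space (lborel \<Otimes>\<^sub>M lborel). ?P p} \<in> sets (lborel \<Otimes>\<^sub>M lborel)"
    by (simp add: pred_def space_pair_measure sets_pair_measure_cong[OF sets_lborel sets_lborel])
  have "AE p in lborel \<Otimes>\<^sub>M lborel. ?P p"
  proof (rule pair_sigma_finite.AE_pair_measure[OF _ meas])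
    show "pair_sigma_finite (lborel::real measure) (lborel::real measure)" ..
    show "AE x in lborel. AE y in lborel. ?P (x, y)"
    proof (rule AE_I2)
      fix x :: real assume "x \<in> space lborel"
      have "negligible {y. \<not> ?P (x, y)}"
        using lipschitz_real_differentiable_AE[OF lipx[of x]] by simp
      then have "AE y in lebesgue. ?P (x, y)"
        by (auto simp: eventually_ae_filter_negligible)
      then show "AE y in lborel. ?P (x, y)" by (simp add: AE_completion_iff)
    qed
  qed
  then have "AE p in lebesgue. ?P p"
    unfolding lborel_prod by (rule AE_completion)
  then show ?thesis
    by (auto simp: eventually_ae_filter_negligible intro: negligible_subset)
qed

text \<open>A linear change of coordinates turns \<open>e\<close> into the vertical direction, and linear maps preserve null
sets.\<close>
lemma lipschitz_directional_derivative_AE: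
  fixes u :: "real ^ 2 \<Rightarrow> real"
  assumes lip: "C-lipschitz_on UNIV u"
  shows "AE x in lebesgue. (\<lambda>t. u (x + t *\<^sub>R e)) differentiable (at 0)"
proof (cases "e = 0")
  case False
  \<comment> \<open>\<open>a\<close> is \<open>e\<close> rotated by a right angle, so \<open>a\<close> and \<open>e\<close> form a basis.\<close>
  define a :: "real ^ 2" where "a = vector [- (e $ 2), e $ 1]"
  define T where "T p = fst p *\<^sub>R a + snd p *\<^sub>R e" for p :: "real \<times> real"
  have blT: "bounded_linear T"
    unfolding T_def by (intro bounded_linear_add bounded_linear_scaleR_left[THEN bounded_linear_compose] bounded_linear_fst bounded_linear_snd)
  obtain K where K: "K-lipschitz_on UNIV T"
    using bounded_linear.lipschitz_boundE[OF blT] by blast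
  have lipuT: "(C*K)-lipschitz_on UNIV (u \<circ> T)"
    by (rule lipschitz_on_compose[OF K]) (rule lipschitz_on_subset[OF lip], simp)
  have surj: "\<exists>p. T p = x" for x
  proof -
    let ?n = "(e$1)\<^sup>2 + (e$2)\<^sup>2"
    have n: "?n \<noteq> 0" using False by (auto simp: vec_eq_iff forall_2 sum_power2_eq_zero_iff)
    have "T ((- (e$2) * x$1 + e$1 * x$2) / ?n, (e$1 * x$1 + e$2 * x$2) / ?n) = x"
      using n by (auto simp: T_def a_def vec_eq_iff forall_2 divide_simps) (auto simp: power2_eq_square algebra_simps)
    then show ?thesis by blast
  qed
  have neg: "negligible (T ` {p. \<not> (\<lambda>t. (u \<circ> T) (fst p, t)) differentiable at (snd p)})"
    by (rule negligible_differentiable_image_negligible[OF _ lipschitz_plane_vertical_derivative_AE[OF lipuT]])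
       (auto intro: bounded_linear_imp_differentiable_on blT)
  have "(\<lambda>t. u (x + t *\<^sub>R e)) differentiable (at 0)"
    if x: "x \<notin> T ` {p. \<not> (\<lambda>t. (u \<circ> T) (fst p, t)) differentiable at (snd p)}" for x
  proof -
    obtain p where p: "T p = x" using surj by blast
    with x have "(\<lambda>t. (u \<circ> T) (fst p, t)) differentiable at (snd p)" by blast
    then obtain l where "DERIV (\<lambda>t. (u \<circ> T) (fst p, t)) (snd p) :> l" by (auto simp: real_differentiable_def)
    then have "DERIV (\<lambda>t. (u \<circ> T) (fst p, t + snd p)) 0 :> l"
      using DERIV_shift[of "\<lambda>t. (u \<circ> T) (fst p, t)" l 0 "snd p"] by simp
    moreover have "(u \<circ> T) (fst p, t + snd p) = u (x + t *\<^sub>R e)" for t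
      unfolding p[symmetric] by (simp add: T_def algebra_simps)
    ultimately show ?thesis by (auto simp: real_differentiable_def)
  qed
  with neg show ?thesis by (auto simp: eventually_ae_filter_negligible)
qed simp

section \<open>Integration over Euclidean space\<close>

lemma distr_lebesgue_translate: "distr lebesgue lebesgue ((+) c) = (lebesgue :: 'a::euclidean_space measure)"
  and measurable_lebesgue_translate [measurable]: "(+) c \<in> lebesgue \<rightarrow>\<^sub>M (lebesgue :: 'a::euclidean_space measure)"
proof -
  have eq: "(\<lambda>x::'a. c + (\<Sum>j\<in>Basis. (1 * (x \<bullet> j)) *\<^sub>R j)) = (+) c"
    by (simp add: euclidean_representation fun_eq_iff)
  show "(+) c \<in> lebesgue \<rightarrow>\<^sub>M (lebesgue :: 'a measure)"
    using lebesgue_affine_measurable[of "\<lambda>_. 1" c] unfolding eq by simp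
  show "distr lebesgue lebesgue ((+) c) = (lebesgue :: 'a measure)"
    using lebesgue_affine_euclidean[of "\<lambda>_. 1" c] unfolding eq by (simp add: density_1)
qed

lemma lebesgue_integral_translate:
  fixes f :: "'a::euclidean_space \<Rightarrow> real"
  assumes "f \<in> borel_measurable lebesgue"
  shows "(LINT x|lebesgue. f (x + c)) = (LINT x|lebesgue. f x)"
proof -
  have "(LINT x|lebesgue. f x) = (LINT x|distr lebesgue lebesgue ((+) c). f x)"
    by (simp add: distr_lebesgue_translate)
  also have "\<dots> = (LINT x|lebesgue. f (c + x))"
    by (rule integral_distr[OF measurable_lebesgue_translate assms])
  finally show ?thesis by (simp add: add.commute)
qed

lemma AE_lebesgue_translate:
  assumes "AE x in lebesgue. P (x :: 'a::euclidean_space)"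
  shows "AE x in lebesgue. P (x + c)"
proof -
  have "AE x in distr lebesgue lebesgue ((+) c). P x"
    unfolding distr_lebesgue_translate by (rule assms)
  then have "AE x in lebesgue. P (c + x)"
    by (rule AE_distrD[OF measurable_lebesgue_translate])
  then show ?thesis by (simp add: add.commute)
qed

lemma integrable_bounded_support:
  fixes f :: "'a::euclidean_space \<Rightarrow> real"
  assumes f: "f \<in> borel_measurable lebesgue"
    and bd: "AE x in lebesgue. \<bar>f x\<bar> \<le> K * indicator B x"
    and B: "bounded B" "B \<in> sets lebesgue"
  shows "integrable lebesgue f"
proof (rule Bochner_Integration.integrable_bound[OF _ f])
  have "B \<in> lmeasurable" using B by (simp add: bounded_set_imp_lmeasurable)
  then show "integrable lebesgue (\<lambda>x. K * indicator B x :: real)"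
    by (intro integrable_mult_right) (simp add: lmeasurable_iff_integrable)
  show "AE x in lebesgue. norm (f x) \<le> norm (K * indicator B x)"
    using bd by eventually_elim auto
qed

lemma dominated_convergence_bounded_support:
  fixes f :: "nat \<Rightarrow> 'a::euclidean_space \<Rightarrow> real"
  assumes f: "\<And>n. f n \<in> borel_measurable lebesgue" "g \<in> borel_measurable lebesgue"
    and lim: "AE x in lebesgue. (\<lambda>n. f n x) \<longlonglongrightarrow> g x"
    and bd: "\<And>n. AE x in lebesgue. \<bar>f n x\<bar> \<le> K * indicator B x"
    and B: "bounded B" "B \<in> sets lebesgue"
  shows "(\<lambda>n. LINT x|lebesgue. f n x) \<longlonglongrightarrow> (LINT x|lebesgue. g x)"
proof (rule integral_dominated_convergence[where w="\<lambda>x. K * indicator B x"])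
  have "B \<in> lmeasurable" using B by (simp add: bounded_set_imp_lmeasurable)
  then show "integrable lebesgue (\<lambda>x. K * indicator B x :: real)"
    by (intro integrable_mult_right) (simp add: lmeasurable_iff_integrable)
  show "AE x in lebesgue. norm (f n x) \<le> K * indicator B x" for n
    using bd[of n] by (simp only: real_norm_def)
qed (rule f lim)+

text \<open>By Lebesgue's differentiation theorem, at almost every point the value of \<open>f\<close> is the limit of its
averages over cubes with that point as a corner.\<close>
lemma AE_zero_of_cube_integrals:
  fixes f :: "'a::euclidean_space \<Rightarrow> real"
  assumes int: "\<And>a b. f integrable_on cbox a b"
    and zero: "\<And>x. x \<in> U \<Longrightarrow> \<exists>d>0. \<forall>h. 0 < h \<and> h < d \<longrightarrow> integral (cbox x (x + h *\<^sub>R One)) f = 0"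
  shows "AE x in lebesgue. x \<in> U \<longrightarrow> f x = 0"
proof -
  obtain N where N: "negligible N" "\<And>x e. \<lbrakk>x \<notin> N; 0 < e\<rbrakk> \<Longrightarrow> \<exists>d>0. \<forall>h. 0 < h \<and> h < d \<longrightarrow>
        norm(integral (cbox x (x + h *\<^sub>R One)) f /\<^sub>R h ^ DIM('a) - f x) < e"
    using integrable_ccontinuous_explicit[OF int] by blast
  have "f x = 0" if xN: "x \<notin> N" and xU: "x \<in> U" for x
  proof (rule ccontr)
    assume "f x \<noteq> 0"
    then obtain d1 where d1: "d1 > 0" "\<And>h. 0 < h \<Longrightarrow> h < d1 \<Longrightarrow>
        norm(integral (cbox x (x + h *\<^sub>R One)) f /\<^sub>R h ^ DIM('a) - f x) < \<bar>f x\<bar>"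
      using N(2)[OF xN, of "\<bar>f x\<bar>"] by (meson zero_less_abs_iff)
    obtain d2 where d2: "d2 > 0" "\<And>h. 0 < h \<Longrightarrow> h < d2 \<Longrightarrow> integral (cbox x (x + h *\<^sub>R One)) f = 0"
      using zero[OF xU] by blast
    define h where "h = min d1 d2 / 2"
    have "0 < h" "h < d1" "h < d2" using d1(1) d2(1) by (auto simp: h_def)
    then show False using d1(2)[of h] d2(2)[of h] by simp
  qed
  then show ?thesis using N(1) by (auto simp: eventually_ae_filter_negligible)
qed

lemma bounded_measurable_integrable_on_cbox:
  fixes f :: "'a::euclidean_space \<Rightarrow> real"
  assumes f: "f \<in> borel_measurable lebesgue" and bd: "AE x in lebesgue. \<bar>f x\<bar> \<le> K"
  shows "f integrable_on cbox a b"
    and "integral (cbox a b) f = (LINT x|lebesgue. indicator (cbox a b) x * f x)"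
proof -
  have "integrable lebesgue (\<lambda>x. indicator (cbox a b) x * f x)"
  proof (rule integrable_bounded_support[where B="cbox a b" and K=K])
    show "(\<lambda>x. indicator (cbox a b) x * f x) \<in> borel_measurable lebesgue"
      using f by (intro borel_measurable_times borel_measurable_indicator) auto
    show "AE x in lebesgue. \<bar>indicator (cbox a b) x * f x\<bar> \<le> K * indicator (cbox a b) x"
      using bd by eventually_elim (auto simp: indicator_def)
  qed auto
  then have si: "set_integrable lebesgue (cbox a b) f"
    by (simp add: set_integrable_def)
  show "f integrable_on cbox a b" "integral (cbox a b) f = (LINT x|lebesgue. indicator (cbox a b) x * f x)"
    using set_lebesgue_integral_eq_integral[OF si] by (auto simp: set_lebesgue_integral_def)
qed

section \<open>Rademacher's theorem in the plane\<close>

text \<open>The increments run through the sequence \<open>1 / (n + 1)\<close>. A sequence of quotients is what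
dominated convergence and the measurability of limits apply to, and it determines the derivative wherever the
derivative exists.\<close>
definition diff_quot :: "(real ^ 2 \<Rightarrow> real) \<Rightarrow> real ^ 2 \<Rightarrow> nat \<Rightarrow> real ^ 2 \<Rightarrow> real" where
  "diff_quot u e n x = (u (x + (1 / real (Suc n)) *\<^sub>R e) - u x) * real (Suc n)"

definition dir_deriv :: "(real ^ 2 \<Rightarrow> real) \<Rightarrow> real ^ 2 \<Rightarrow> real ^ 2 \<Rightarrow> real" where
  "dir_deriv u e x = lim (\<lambda>n. diff_quot u e n x)"

lemma step_tendsto_0: "(\<lambda>n. 1 / real (Suc n)) \<longlonglongrightarrow> 0"
  using LIMSEQ_inverse_real_of_nat by (simp add: inverse_eq_divide)

lemma lipschitz_borel_measurable:
  fixes u :: "'a::euclidean_space \<Rightarrow> real"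
  assumes "C-lipschitz_on UNIV u" shows "u \<in> borel_measurable borel"
  using lipschitz_on_continuous_on[OF assms] by (rule borel_measurable_continuous_onI)

lemma borel_measurable_lebesgueI: "f \<in> borel_measurable borel \<Longrightarrow> f \<in> borel_measurable (lebesgue :: 'a::euclidean_space measure)"
  by (simp add: measurable_completion)

lemma open_indicator_measurable:
  fixes \<Omega> :: "'a::euclidean_space set"
  assumes "open \<Omega>" shows "(indicator \<Omega> :: _ \<Rightarrow> real) \<in> borel_measurable lebesgue"
  using assms by (intro borel_measurable_indicator) (simp add: borel_open)

lemma diff_quot_measurable:
  assumes "C-lipschitz_on UNIV u" shows "diff_quot u e n \<in> borel_measurable borel"
proof -
  note [measurable] = lipschitz_borel_measurable[OF assms]
  show ?thesis unfolding diff_quot_def[abs_def] by measurable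
qed

lemma dir_deriv_measurable:
  assumes "C-lipschitz_on UNIV u" shows "dir_deriv u e \<in> borel_measurable borel"
  unfolding dir_deriv_def[abs_def]
  by (intro borel_measurable_lim_metric diff_quot_measurable[OF assms])

lemma diff_quot_bound:
  assumes "C-lipschitz_on UNIV u" shows "\<bar>diff_quot u e n x\<bar> \<le> C * norm e"
proof -
  have "\<bar>u (x + (1 / real (Suc n)) *\<^sub>R e) - u x\<bar> \<le> C * norm ((1 / real (Suc n)) *\<^sub>R e)"
    using lipschitz_onD[OF assms, of "x + (1 / real (Suc n)) *\<^sub>R e" x] by (simp add: dist_norm)
  then have "\<bar>u (x + (1 / real (Suc n)) *\<^sub>R e) - u x\<bar> * real (Suc n) \<le> C * norm e"
    by (simp add: field_simps del: of_nat_Suc)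
  then show ?thesis by (simp add: diff_quot_def abs_mult)
qed

lemma diff_quot_tendsto_derivative:
  assumes "DERIV (\<lambda>t. u (x + t *\<^sub>R e)) 0 :> l"
  shows "(\<lambda>n. diff_quot u e n x) \<longlonglongrightarrow> l"
proof -
  have "((\<lambda>h. (u (x + h *\<^sub>R e) - u x) / h) \<longlongrightarrow> l) (at 0)"
    using assms by (simp add: DERIV_def)
  moreover have "filterlim (\<lambda>n. 1 / real (Suc n)) (at 0) sequentially"
    unfolding filterlim_at using step_tendsto_0 by simp
  ultimately have "(\<lambda>n. (u (x + (1 / real (Suc n)) *\<^sub>R e) - u x) / (1 / real (Suc n))) \<longlonglongrightarrow> l"
    by (rule filterlim_compose)
  then show ?thesis by (simp add: diff_quot_def)
qed

lemma diff_quot_tendsto_AE: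
  assumes "C-lipschitz_on UNIV u"
  shows "AE x in lebesgue. (\<lambda>n. diff_quot u e n x) \<longlonglongrightarrow> dir_deriv u e x"
  using lipschitz_directional_derivative_AE[OF assms, of e]
proof eventually_elim
  case (elim x)
  then obtain l where "DERIV (\<lambda>t. u (x + t *\<^sub>R e)) 0 :> l" by (auto simp: real_differentiable_def)
  from diff_quot_tendsto_derivative[OF this] show ?case
    by (simp add: dir_deriv_def limI)
qed

lemma dir_deriv_bound_AE:
  assumes "C-lipschitz_on UNIV u"
  shows "AE x in lebesgue. \<bar>dir_deriv u e x\<bar> \<le> C * norm e"
  using diff_quot_tendsto_AE[OF assms, of e]
proof eventually_elim
  case (elim x)
  show ?case
    by (rule LIMSEQ_le_const2[OF tendsto_rabs[OF elim]]) (use diff_quot_bound[OF assms] in auto)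
qed

text \<open>Difference quotients are additive up to a shift: the quotient in direction \<open>v + w\<close> at \<open>x\<close> is the quotient in
direction \<open>v\<close> at \<open>x\<close> plus the quotient in direction \<open>w\<close> at \<open>x + \<tau> v\<close>, where \<open>\<tau>\<close> is the step. Under an
integral over a cube, translation invariance moves the shift to the cube, where it disappears as
\<open>\<tau>\<close> tends to zero. So the two sides have the same integral over every cube.\<close>
lemma dir_deriv_add_AE:
  assumes lip: "C-lipschitz_on UNIV u"
  shows "AE x in lebesgue. dir_deriv u (v + w) x = dir_deriv u v x + dir_deriv u w x"
proof -
  have C0: "C \<ge> 0" using lip by (rule lipschitz_on_nonneg)
  define D where "D x = dir_deriv u (v + w) x - dir_deriv u v x - dir_deriv u w x" for x
  note [measurable] = dir_deriv_measurable[OF lip] diff_quot_measurable[OF lip]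
  note lebI = borel_measurable_lebesgueI
  have Dm: "D \<in> borel_measurable lebesgue" unfolding D_def[abs_def] by (rule lebI) measurable
  have Db: "AE x in lebesgue. \<bar>D x\<bar> \<le> C * norm (v + w) + C * norm v + C * norm w"
    using dir_deriv_bound_AE[OF lip, of "v+w"] dir_deriv_bound_AE[OF lip, of v] dir_deriv_bound_AE[OF lip, of w]
    unfolding D_def by eventually_elim linarith
  have "integral (cbox z (z + h *\<^sub>R One)) D = 0" for z :: "real ^ 2" and h :: real
  proof -
    define Q where "Q = cbox z (z + h *\<^sub>R One)"
    have bQ: "bounded Q" "Q \<in> sets lebesgue" and [measurable]: "Q \<in> sets borel" and cl: "closed Q"
      by (auto simp: Q_def intro: closed_cbox)
    obtain R where R: "\<And>x. x \<in> Q \<Longrightarrow> norm x \<le> R" using bQ(1) by (auto simp: bounded_iff)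
    define B where "B = cball (0 :: real ^ 2) (R + norm v)"
    define \<tau> where "\<tau> n = 1 / real (Suc n)" for n
    have \<tau>: "0 < \<tau> n" "\<tau> n \<le> 1" for n by (auto simp: \<tau>_def)
    have conv: "(\<lambda>n. LINT x|lebesgue. indicator Q x * diff_quot u e n x) \<longlonglongrightarrow> (LINT x|lebesgue. indicator Q x * dir_deriv u e x)" for e
    proof (rule dominated_convergence_bounded_support[where B=Q and K="C * norm e"])
      show "AE x in lebesgue. (\<lambda>n. indicator Q x * diff_quot u e n x) \<longlonglongrightarrow> indicator Q x * dir_deriv u e x"
        using diff_quot_tendsto_AE[OF lip, of e] by eventually_elim (intro tendsto_intros)
      show "AE x in lebesgue. \<bar>indicator Q x * diff_quot u e n x\<bar> \<le> C * norm e * indicator Q x" for n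
        using diff_quot_bound[OF lip, of e n] by (auto simp: indicator_def)
      show "(\<lambda>x. indicator Q x * diff_quot u e n x) \<in> borel_measurable lebesgue" for n
        by (rule lebI) measurable
      show "(\<lambda>x. indicator Q x * dir_deriv u e x) \<in> borel_measurable lebesgue"
        by (rule lebI) measurable
    qed (rule bQ)+
    have conv': "(\<lambda>n. LINT x|lebesgue. indicator Q (x - \<tau> n *\<^sub>R v) * diff_quot u w n x) \<longlonglongrightarrow> (LINT x|lebesgue. indicator Q x * dir_deriv u w x)"
    proof (rule dominated_convergence_bounded_support[where B=B and K="C * norm w"])
      \<comment> \<open>Off the frontier the indicator of the shifted cube is eventually that of \<open>Q\<close>.\<close>
      have "AE x in lebesgue. x \<notin> frontier Q"
        using negligible_convex_frontier[of Q] by (auto simp: Q_def eventually_ae_filter_negligible intro!: exI[of _ "frontier Q"])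
      then show "AE x in lebesgue. (\<lambda>n. indicator Q (x - \<tau> n *\<^sub>R v) * diff_quot u w n x) \<longlonglongrightarrow> indicator Q x * dir_deriv u w x"
        using diff_quot_tendsto_AE[OF lip, of w]
      proof eventually_elim
        case (elim x)
        have lim: "(\<lambda>n. x - \<tau> n *\<^sub>R v) \<longlonglongrightarrow> x"
          using tendsto_diff[OF tendsto_const tendsto_scaleR[OF step_tendsto_0 tendsto_const], of x v] by (simp add: \<tau>_def)
        have "\<forall>\<^sub>F n in sequentially. indicator Q (x - \<tau> n *\<^sub>R v) = (indicator Q x :: real)"
        proof (cases "x \<in> Q")
          case True
          then have "x \<in> interior Q" using elim(1) cl by (auto simp: frontier_def)
          then have "\<forall>\<^sub>F n in sequentially. x - \<tau> n *\<^sub>R v \<in> interior Q"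
            using lim by (intro topological_tendstoD) auto
          then show ?thesis by eventually_elim (use True interior_subset in \<open>auto simp: indicator_def\<close>)
        next
          case False
          then have "\<forall>\<^sub>F n in sequentially. x - \<tau> n *\<^sub>R v \<in> - Q"
            using lim cl by (intro topological_tendstoD) auto
          then show ?thesis by eventually_elim (use False in \<open>auto simp: indicator_def\<close>)
        qed
        then have "(\<lambda>n. indicator Q (x - \<tau> n *\<^sub>R v) :: real) \<longlonglongrightarrow> indicator Q x"
          by (rule tendsto_eventually)
        then show ?case using elim(2) by (intro tendsto_intros)
      qed
      have "indicator Q (x - \<tau> n *\<^sub>R v) \<le> (indicator B x :: real)" for n x
      proof (cases "x - \<tau> n *\<^sub>R v \<in> Q")
        case True
        have "norm x \<le> norm (x - \<tau> n *\<^sub>R v) + norm (\<tau> n *\<^sub>R v)" using norm_triangle_ineq[of "x - \<tau> n *\<^sub>R v" "\<tau> n *\<^sub>R v"] by simp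
        also have "\<dots> \<le> R + 1 * norm v" using R[OF True] \<tau>[of n] by (auto intro!: add_mono mult_left_le_one_le)
        finally show ?thesis using True by (simp add: B_def indicator_def)
      qed auto
      then show "AE x in lebesgue. \<bar>indicator Q (x - \<tau> n *\<^sub>R v) * diff_quot u w n x\<bar> \<le> C * norm w * indicator B x" for n
        using diff_quot_bound[OF lip, of w n] C0
        by (intro AE_I2, subst mult.commute) (auto simp: abs_mult intro!: mult_mono)
      show "(\<lambda>x. indicator Q (x - \<tau> n *\<^sub>R v) * diff_quot u w n x) \<in> borel_measurable lebesgue" for n
        by (rule lebI) measurable
      show "(\<lambda>x. indicator Q x * dir_deriv u w x) \<in> borel_measurable lebesgue"
        by (rule lebI) measurable
    qed (simp_all add: B_def)
    have int: "integrable lebesgue (\<lambda>x. indicator Q x * diff_quot u e n x)" for e n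
    proof (rule integrable_bounded_support[where B=Q and K="C * norm e"])
      show "(\<lambda>x. indicator Q x * diff_quot u e n x) \<in> borel_measurable lebesgue"
        by (rule lebI) measurable
      show "AE x in lebesgue. \<bar>indicator Q x * diff_quot u e n x\<bar> \<le> C * norm e * indicator Q x"
        using diff_quot_bound[OF lip, of e n] by (auto simp: indicator_def)
    qed (rule bQ)+
    have split: "(LINT x|lebesgue. indicator Q x * diff_quot u (v+w) n x) =
       (LINT x|lebesgue. indicator Q x * diff_quot u v n x) + (LINT x|lebesgue. indicator Q (x - \<tau> n *\<^sub>R v) * diff_quot u w n x)" for n
    proof -
      have eq: "diff_quot u (v+w) n x = diff_quot u v n x + diff_quot u w n (x + \<tau> n *\<^sub>R v)" for x
        by (simp add: diff_quot_def \<tau>_def algebra_simps)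
      have eq2: "indicator Q x * diff_quot u w n (x + \<tau> n *\<^sub>R v) = indicator Q x * diff_quot u (v+w) n x - indicator Q x * diff_quot u v n x" for x
        by (simp add: eq algebra_simps)
      have int2: "integrable lebesgue (\<lambda>x. indicator Q x * diff_quot u w n (x + \<tau> n *\<^sub>R v))"
        unfolding eq2 by (intro Bochner_Integration.integrable_diff int)
      have "(LINT x|lebesgue. indicator Q x * diff_quot u (v+w) n x) = (LINT x|lebesgue. indicator Q x * diff_quot u v n x + indicator Q x * diff_quot u w n (x + \<tau> n *\<^sub>R v))"
        by (simp add: eq algebra_simps)
      also have "\<dots> = (LINT x|lebesgue. indicator Q x * diff_quot u v n x) + (LINT x|lebesgue. indicator Q x * diff_quot u w n (x + \<tau> n *\<^sub>R v))"
        by (rule Bochner_Integration.integral_add[OF int int2])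
      also have "(LINT x|lebesgue. indicator Q x * diff_quot u w n (x + \<tau> n *\<^sub>R v))
         = (LINT x|lebesgue. (\<lambda>x. indicator Q (x - \<tau> n *\<^sub>R v) * diff_quot u w n x) (x + \<tau> n *\<^sub>R v))" by simp
      also have "\<dots> = (LINT x|lebesgue. indicator Q (x - \<tau> n *\<^sub>R v) * diff_quot u w n x)"
        by (rule lebesgue_integral_translate, rule lebI) measurable
      finally show ?thesis .
    qed
    have intD: "integrable lebesgue (\<lambda>x. indicator Q x * dir_deriv u e x)" for e
    proof (rule integrable_bounded_support[where B=Q and K="C * norm e"])
      show "AE x in lebesgue. \<bar>indicator Q x * dir_deriv u e x\<bar> \<le> C * norm e * indicator Q x"
        using dir_deriv_bound_AE[OF lip, of e] by eventually_elim (auto simp: indicator_def)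
      show "(\<lambda>x. indicator Q x * dir_deriv u e x) \<in> borel_measurable lebesgue"
        by (rule lebI) measurable
    qed (rule bQ)+
    have "(LINT x|lebesgue. indicator Q x * dir_deriv u (v+w) x) =
       (LINT x|lebesgue. indicator Q x * dir_deriv u v x) + (LINT x|lebesgue. indicator Q x * dir_deriv u w x)"
      using LIMSEQ_unique[OF conv[of "v+w", unfolded split] tendsto_add[OF conv[of v] conv']] .
    then have "(LINT x|lebesgue. indicator Q x * D x) = 0"
      using intD by (simp add: D_def algebra_simps)
    then show ?thesis
      using bounded_measurable_integrable_on_cbox(2)[OF Dm Db] by (simp add: Q_def)
  qed
  then have "AE x in lebesgue. x \<in> UNIV \<longrightarrow> D x = 0"
    using bounded_measurable_integrable_on_cbox(1)[OF Dm Db]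
    by (intro AE_zero_of_cube_integrals) (blast intro: zero_less_one)+
  then show ?thesis by eventually_elim (simp add: D_def)
qed

lemma dir_deriv_DERIV_AE:
  assumes "C-lipschitz_on UNIV u"
  shows "AE x in lebesgue. DERIV (\<lambda>t. u (x + t *\<^sub>R e)) 0 :> dir_deriv u e x"
  using lipschitz_directional_derivative_AE[OF assms, of e]
proof eventually_elim
  case (elim x)
  then obtain l where l: "DERIV (\<lambda>t. u (x + t *\<^sub>R e)) 0 :> l" by (auto simp: real_differentiable_def)
  from diff_quot_tendsto_derivative[OF l] l show ?case
    by (simp add: dir_deriv_def limI)
qed

lemma DERIV_direction_scaleR:
  fixes u :: "real ^ 2 \<Rightarrow> real"
  assumes "DERIV (\<lambda>t. u (x + t *\<^sub>R e)) 0 :> l"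
  shows "DERIV (\<lambda>t. u (x + t *\<^sub>R (a *\<^sub>R e))) 0 :> a * l"
proof -
  have "DERIV (\<lambda>t. (\<lambda>t. u (x + t *\<^sub>R e)) (a * t)) 0 :> l * a"
    by (rule DERIV_chain2[where g="\<lambda>t. a * t"]) (use assms in \<open>auto intro!: derivative_eq_intros\<close>)
  then show ?thesis by (simp add: mult.commute)
qed

text \<open>Almost everywhere the derivatives in all directions with rational coordinates exist and depend linearly
on the direction. At such a point finitely many rational directions come close to every unit vector, so the
one-dimensional expansions hold uniformly on them, and the Lipschitz bound carries the
expansion over to all directions.\<close>
theorem rademacher_plane:
  fixes u :: "real ^ 2 \<Rightarrow> real"
  assumes lip: "C-lipschitz_on UNIV u"
  shows "AE x in lebesgue. (u has_derivative
    (\<lambda>h. dir_deriv u (axis 1 1) x * h $ 1 + dir_deriv u (axis 2 1) x * h $ 2)) (at x)"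
proof -
  have C0: "C \<ge> 0" using lip by (rule lipschitz_on_nonneg)
  define ev :: "rat \<times> rat \<Rightarrow> real ^ 2" where
    "ev k = of_rat (fst k) *\<^sub>R axis 1 1 + of_rat (snd k) *\<^sub>R axis 2 1" for k
  have ae: "AE x in lebesgue. DERIV (\<lambda>t. u (x + t *\<^sub>R ev k)) 0 :>
     dir_deriv u (axis 1 1) x * ev k $ 1 + dir_deriv u (axis 2 1) x * ev k $ 2" for k
    using dir_deriv_DERIV_AE[OF lip, of "ev k"] dir_deriv_DERIV_AE[OF lip, of "axis 1 1"]
      dir_deriv_DERIV_AE[OF lip, of "axis 2 1"]
      dir_deriv_add_AE[OF lip, of "of_rat (fst k) *\<^sub>R axis 1 1" "of_rat (snd k) *\<^sub>R axis 2 1"]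
  proof eventually_elim
    case (elim x)
    have sc: "dir_deriv u (a *\<^sub>R axis i 1) x = a * dir_deriv u (axis i 1) x"
      if "DERIV (\<lambda>t. u (x + t *\<^sub>R axis i 1)) 0 :> dir_deriv u (axis i 1) x" for a i
      using diff_quot_tendsto_derivative[OF DERIV_direction_scaleR[OF that, of a]]
      by (simp add: dir_deriv_def[of u "a *\<^sub>R axis i 1"] limI)
    have "dir_deriv u (ev k) x = dir_deriv u (axis 1 1) x * ev k $ 1 + dir_deriv u (axis 2 1) x * ev k $ 2"
      using elim(4) sc[OF elim(2)] sc[OF elim(3)]
      by (simp add: ev_def axis_def)
    then show ?case using elim(1) by simp
  qed
  then have "AE x in lebesgue. \<forall>k. DERIV (\<lambda>t. u (x + t *\<^sub>R ev k)) 0 :>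
     dir_deriv u (axis 1 1) x * ev k $ 1 + dir_deriv u (axis 2 1) x * ev k $ 2"
    by (simp add: AE_all_countable)
  then show ?thesis
  proof eventually_elim
    case (elim x)
    define L where "L h = dir_deriv u (axis 1 1) x * h $ 1 + dir_deriv u (axis 2 1) x * h $ 2" for h :: "real ^ 2"
    have bl: "bounded_linear L"
      unfolding L_def by (intro bounded_linear_add bounded_linear_mult_right[THEN bounded_linear_compose] bounded_linear_vec_nth)
    then obtain M where M: "M > 0" "\<And>h. \<bar>L h\<bar> \<le> norm h * M"
      using bounded_linear.pos_bounded real_norm_def by metis
    have "(u has_derivative L) (at x)"
      unfolding has_derivative_at_alt
    proof (intro conjI bl allI impI)
      fix e :: real assume "0 < e"
      \<comment> \<open>Replacing a direction by one at distance \<open>r\<close> costs \<open>C * r\<close> in \<open>u\<close> and \<open>M * r\<close> in \<open>L\<close>,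
        together at most half of the admissible error \<open>e\<close>.\<close>
      define r where "r = e / (2 * (C + M))"
      have r: "r > 0" using \<open>0 < e\<close> C0 M(1) by (simp add: r_def)
      have dense: "\<exists>k. w \<in> ball (ev k) r" for w :: "real ^ 2"
      proof -
        obtain a where a: "w $ 1 - r/2 < of_rat a" "of_rat a < w $ 1 + r/2"
          using of_rat_dense[of "w $ 1 - r/2" "w $ 1 + r/2"] r by auto
        obtain b where b: "w $ 2 - r/2 < of_rat b" "of_rat b < w $ 2 + r/2"
          using of_rat_dense[of "w $ 2 - r/2" "w $ 2 + r/2"] r by auto
        have "norm (ev (a,b) - w) \<le> \<bar>(ev (a,b) - w) $ 1\<bar> + \<bar>(ev (a,b) - w) $ 2\<bar>"
          using norm_le_l1_cart[of "ev (a,b) - w"] by (simp add: sum_2)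
        also have "\<dots> < r" using a b by (auto simp: ev_def axis_def)
        finally show ?thesis by (auto simp: dist_norm)
      qed
      have "sphere 0 1 \<subseteq> (\<Union>k\<in>UNIV. ball (ev k) r)" using dense by blast
      then obtain K where K: "finite K" "sphere (0 :: real ^ 2) 1 \<subseteq> (\<Union>k\<in>K. ball (ev k) r)"
        using compactE_image[OF compact_sphere, of UNIV "\<lambda>k. ball (ev k) r" 0 1] by auto
      have "\<exists>d>0. \<forall>t. \<bar>t\<bar> < d \<longrightarrow> \<bar>u (x + t *\<^sub>R ev k) - u x - t * L (ev k)\<bar> \<le> e / 2 * \<bar>t\<bar>" for k
      proof -
        have "((\<lambda>t. u (x + t *\<^sub>R ev k)) has_derivative (\<lambda>t. t * L (ev k))) (at 0)"
          using elim[rule_format, of k] unfolding has_field_derivative_def L_def by (simp add: mult_commute_abs)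
        then have "\<exists>d>0. \<forall>t. norm (t - 0) < d \<longrightarrow>
            norm (u (x + t *\<^sub>R ev k) - u (x + 0 *\<^sub>R ev k) - (t - 0) * L (ev k)) \<le> e / 2 * norm (t - 0)"
          unfolding has_derivative_at_alt using half_gt_zero[OF \<open>0 < e\<close>] by blast
        then show ?thesis by simp
      qed
      then obtain d where d: "\<And>k. d k > 0"
        "\<And>k t. \<bar>t\<bar> < d k \<Longrightarrow> \<bar>u (x + t *\<^sub>R ev k) - u x - t * L (ev k)\<bar> \<le> e / 2 * \<bar>t\<bar>"
        by metis
      define d0 where "d0 = Min (insert 1 (d ` K))"
      have d0: "d0 > 0" "\<And>k. k \<in> K \<Longrightarrow> d0 \<le> d k" using K(1) d(1) by (auto simp: d0_def)
      have "\<bar>u y - u x - L (y - x)\<bar> \<le> e * norm (y - x)" if y: "norm (y - x) < d0" for y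
      proof (cases "y = x")
        case True
        then show ?thesis using bounded_linear.linear[OF bl] by (simp add: linear_0)
      next
        case False
        define t where "t = norm (y - x)"
        define w where "w = (1 / t) *\<^sub>R (y - x)"
        have t: "t > 0" "t < d0" and yx: "y - x = t *\<^sub>R w" and w: "norm w = 1"
          using False y by (auto simp: t_def w_def)
        obtain k where k: "k \<in> K" "norm (w - ev k) < r"
          using K(2) w by (force simp: dist_norm norm_minus_commute)
        have y': "y = x + t *\<^sub>R w" using yx by (metis add.commute diff_add_cancel)
        have Ltw: "L (t *\<^sub>R w) = t * L w" "L (w - ev k) = L w - L (ev k)"
          using bl by (simp_all add: linear_diff linear_cmul bounded_linear.linear)
        have "\<bar>u (x + t *\<^sub>R w) - u (x + t *\<^sub>R ev k)\<bar> \<le> C * norm (t *\<^sub>R (w - ev k))"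
          using lipschitz_onD[OF lip, of "x + t *\<^sub>R w" "x + t *\<^sub>R ev k"] by (simp add: dist_norm scaleR_diff_right)
        also have "\<dots> \<le> C * (t * r)"
          using k(2) t C0 by (auto intro!: mult_left_mono)
        finally have 1: "\<bar>u (x + t *\<^sub>R w) - u (x + t *\<^sub>R ev k)\<bar> \<le> C * (t * r)" .
        have 2: "\<bar>u (x + t *\<^sub>R ev k) - u x - t * L (ev k)\<bar> \<le> e / 2 * t"
          using d(2)[of t k] t d0(2)[OF k(1)] by simp
        have "\<bar>L (w - ev k)\<bar> \<le> r * M"
          using M(2)[of "w - ev k"] k(2) M(1) by (smt (verit) mult_right_mono)
        then have "\<bar>t * L (ev k) - t * L w\<bar> \<le> t * (r * M)"
          unfolding Ltw(2) using t(1) by (simp add: abs_minus_commute abs_mult flip: right_diff_distrib)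
        with 1 2 have "\<bar>u (x + t *\<^sub>R w) - u x - t * L w\<bar> \<le> C * (t * r) + e / 2 * t + t * (r * M)"
          by linarith
        also have "\<dots> = t * (r * (C + M)) + e / 2 * t" by (simp add: algebra_simps)
        also have "r * (C + M) = e / 2" using C0 M(1) by (simp add: r_def field_simps)
        finally show ?thesis unfolding y' yx Ltw using t w by (simp add: Ltw t_def[symmetric] algebra_simps)
      qed
      then show "\<exists>d>0. \<forall>y. norm (y - x) < d \<longrightarrow> norm (u y - u x - L (y - x)) \<le> e * norm (y - x)"
        using d0(1) by auto
    qed
    then show ?case by (simp add: L_def[abs_def])
  qed
qed

section \<open>Gradients\<close>

lemma GDERIV_unique: "GDERIV f x :> a \<Longrightarrow> GDERIV f x :> b \<Longrightarrow> a = b"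
proof -
  assume "GDERIV f x :> a" "GDERIV f x :> b"
  then have "(\<lambda>h. h \<bullet> a) = (\<lambda>h. h \<bullet> b)"
    unfolding gderiv_def by (rule has_derivative_unique)
  then have "(a - b) \<bullet> a = (a - b) \<bullet> b" by meson
  then have "(a - b) \<bullet> (a - b) = 0" by (simp add: inner_diff_right)
  then show "a = b" by simp
qed

lemma grad_eqI: "GDERIV f x :> a \<Longrightarrow> grad f x = a"
  unfolding grad_def using GDERIV_unique by (metis (mono_tags, lifting) the_equality)

lemma GDERIV_grad:
  fixes f :: "real ^ 'n \<Rightarrow> real"
  assumes "f differentiable (at x)" shows "GDERIV f x :> grad f x"
proof -
  obtain f' where f': "(f has_derivative f') (at x)" using assms by (auto simp: differentiable_def)
  then have lin: "linear f'" by (rule has_derivative_linear)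
  have "f' = (\<lambda>h. h \<bullet> (\<chi> i. f' (axis i 1)))"
  proof
    fix h :: "real ^ 'n"
    have "f' h = f' (\<Sum>i\<in>UNIV. (h $ i) *\<^sub>R axis i 1)"
      by (simp add: basis_expansion flip: scalar_mult_eq_scaleR)
    also have "\<dots> = h \<bullet> (\<chi> i. f' (axis i 1))"
      using lin by (simp add: linear_sum linear_cmul inner_vec_def)
    finally show "f' h = h \<bullet> (\<chi> i. f' (axis i 1))" .
  qed
  with f' have "GDERIV f x :> (\<chi> i. f' (axis i 1))" unfolding gderiv_def by simp
  then show ?thesis by (simp add: grad_eqI)
qed

lemma grad_eq_0_if_not_differentiable:
  assumes "\<not> f differentiable (at x)" shows "grad f x = 0"
  using assms by (auto simp: grad_def gderiv_def differentiable_def)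

lemma grad_cong:
  assumes "\<forall>\<^sub>F y in nhds x. f y = g y"
  shows "grad f x = grad g x"
proof -
  obtain S where S: "open S" "x \<in> S" "\<And>y. y \<in> S \<Longrightarrow> f y = g y"
    using assms by (auto simp: eventually_nhds)
  have "GDERIV f x :> D \<longleftrightarrow> GDERIV g x :> D" for D
    unfolding gderiv_def using S
    by (metis has_derivative_transform_within_open)
  then have "gderiv f x = gderiv g x" by auto
  then show ?thesis by (simp add: grad_def)
qed

lemma grad_cong_open:
  assumes "open U" "x \<in> U" "\<And>y. y \<in> U \<Longrightarrow> f y = g y"
  shows "grad f x = grad g x"
  using assms by (intro grad_cong) (auto simp: eventually_nhds)

lemma lipschitz_ae_differentiable:
  fixes u :: "real ^ 2 \<Rightarrow> real"
  assumes lip: "C-lipschitz_on UNIV u"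
  shows "AE x in lebesgue. GDERIV u x :> grad u x"
  using rademacher_plane[OF lip] by eventually_elim (rule GDERIV_grad, auto simp: differentiable_def)

lemma GDERIV_direction:
  assumes "GDERIV u x :> D"
  shows "DERIV (\<lambda>t. u (x + t *\<^sub>R e)) 0 :> e \<bullet> D"
proof -
  have "((\<lambda>t. u (x + t *\<^sub>R e)) has_derivative (\<lambda>t. (t *\<^sub>R e) \<bullet> D)) (at 0)"
    by (rule has_derivative_compose[where f="\<lambda>t. x + t *\<^sub>R e" and x=0, of "\<lambda>t. t *\<^sub>R e" UNIV u])
       (use assms in \<open>auto simp: gderiv_def intro!: derivative_eq_intros\<close>)
  then show ?thesis by (simp add: has_field_derivative_def mult_commute_abs)
qed

lemma diff_quot_tendsto_grad:
  fixes u :: "real ^ 2 \<Rightarrow> real"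
  assumes lip: "C-lipschitz_on UNIV u"
  shows "AE x in lebesgue. (\<lambda>n. diff_quot u e n x) \<longlonglongrightarrow> e \<bullet> grad u x"
  using lipschitz_ae_differentiable[OF lip]
  by eventually_elim (rule diff_quot_tendsto_derivative[OF GDERIV_direction])

text \<open>Each component agrees almost everywhere with a pointwise limit of continuous difference quotients.\<close>
lemma grad_measurable:
  fixes u :: "real ^ 2 \<Rightarrow> real"
  assumes lip: "C-lipschitz_on UNIV u"
  shows "grad u \<in> borel_measurable lebesgue"
proof -
  have "(\<lambda>x. e \<bullet> grad u x) \<in> borel_measurable lebesgue" for e
  proof (rule borel_measurable_AE)
    show "dir_deriv u e \<in> borel_measurable lebesgue"
      by (intro borel_measurable_lebesgueI dir_deriv_measurable[OF lip])
    show "AE x in lebesgue. dir_deriv u e x = e \<bullet> grad u x"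
      using diff_quot_tendsto_grad[OF lip, of e]
      by eventually_elim (simp add: dir_deriv_def limI)
  qed
  then show ?thesis
    by (subst borel_measurable_euclidean_space) (simp add: inner_commute)
qed

lemma grad_component_measurable:
  fixes u :: "real ^ 2 \<Rightarrow> real"
  assumes "C-lipschitz_on UNIV u"
  shows "(\<lambda>x. grad u x $ i) \<in> borel_measurable lebesgue"
proof -
  have "(\<lambda>x. axis i 1 \<bullet> grad u x) \<in> borel_measurable lebesgue"
    by (rule borel_measurable_inner[OF borel_measurable_const grad_measurable[OF assms]])
  then show ?thesis by (simp only: inner_axis' mult_1 real_inner_1_left)
qed

text \<open>The derivative in the direction of the gradient \<open>D\<close> is \<open>|D|\<^sup>2\<close>, and it is at most \<open>C |D|\<close>.\<close>
lemma norm_grad_le: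
  fixes u :: "real ^ 'n \<Rightarrow> real"
  assumes lip: "C-lipschitz_on U u" and U: "open U" "x \<in> U"
  shows "norm (grad u x) \<le> C"
proof (cases "u differentiable (at x)")
  case False
  then show ?thesis using lipschitz_on_nonneg[OF lip] by (simp add: grad_eq_0_if_not_differentiable)
next
  case True
  define D where "D = grad u x"
  have G: "DERIV (\<lambda>t. u (x + t *\<^sub>R D)) 0 :> D \<bullet> D"
    unfolding D_def by (rule GDERIV_direction[OF GDERIV_grad[OF True]])
  then have lim: "((\<lambda>h. (u (x + h *\<^sub>R D) - u x) / h) \<longlongrightarrow> D \<bullet> D) (at 0)"
    by (simp add: DERIV_def)
  have "((\<lambda>h. x + h *\<^sub>R D) \<longlongrightarrow> x + 0 *\<^sub>R D) (at 0)" by (intro tendsto_intros)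
  then have ev: "\<forall>\<^sub>F h in at 0. x + h *\<^sub>R D \<in> U" using U by (intro topological_tendstoD) auto
  have "\<forall>\<^sub>F h in at (0::real). h \<noteq> 0" by (simp add: eventually_at_filter)
  with ev have "\<forall>\<^sub>F h in at 0. \<bar>(u (x + h *\<^sub>R D) - u x) / h\<bar> \<le> C * norm D"
  proof eventually_elim
    case (elim h)
    have "\<bar>u (x + h *\<^sub>R D) - u x\<bar> \<le> C * norm (h *\<^sub>R D)"
      using lipschitz_onD[OF lip elim(1) U(2)] by (simp add: dist_norm)
    then show ?case using elim(2) by (simp add: field_simps)
  qed
  then have "\<bar>D \<bullet> D\<bar> \<le> C * norm D"
    by (intro tendsto_upperbound[OF tendsto_rabs[OF lim]]) auto
  then have "norm D * norm D \<le> C * norm D" by (simp add: dot_square_norm power2_eq_square)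
  then show ?thesis using lipschitz_on_nonneg[OF lip] unfolding D_def[symmetric]
    by (cases "D = 0") auto
qed

section \<open>Extension of Lipschitz functions\<close>

text \<open>McShane's extension: the infimum of the cones of slope \<open>C\<close> over the graph of \<open>w\<close>. It lets functions
on a domain be replaced by globally Lipschitz ones, whose translates are defined everywhere.\<close>
lemma lipschitz_extension:
  fixes w :: "'a::metric_space \<Rightarrow> real"
  assumes lip: "C-lipschitz_on S w"
  obtains w' where "C-lipschitz_on UNIV w'" "\<And>x. x \<in> S \<Longrightarrow> w' x = w x"
proof (cases "S = {}")
  case True
  have "C-lipschitz_on UNIV (\<lambda>x::'a. 0::real)"
    using lipschitz_on_nonneg[OF lip] by (auto intro!: lipschitz_onI)
  then show thesis using that True by blast
next
  case False
  then obtain y0 where y0: "y0 \<in> S" by blast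
  have C0: "C \<ge> 0" using lip by (rule lipschitz_on_nonneg)
  define w' where "w' x = (INF y\<in>S. w y + C * dist x y)" for x
  \<comment> \<open>All cones lie above the downward cone at \<open>y0\<close>, so the infimum is finite.\<close>
  have low: "w y0 - C * dist x y0 \<le> w y + C * dist x y" if "y \<in> S" for x y
  proof -
    have "\<bar>w y0 - w y\<bar> \<le> C * dist y0 y" using lipschitz_onD[OF lip y0 that] by (simp add: dist_real_def)
    moreover have "C * dist y0 y \<le> C * (dist x y0 + dist x y)"
      using C0 dist_triangle3[of y0 y x] by (intro mult_left_mono) auto
    ultimately show ?thesis by (simp add: algebra_simps)
  qed
  have bdd: "bdd_below ((\<lambda>y. w y + C * dist x y) ` S)" for x
    using low by (intro bdd_belowI2) auto
  have "w' x - w' z \<le> C * dist x z" for x z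
  proof -
    have "w' x - C * dist x z \<le> w y + C * dist z y" if "y \<in> S" for y
    proof -
      have "w' x \<le> w y + C * dist x y" unfolding w'_def by (rule cINF_lower[OF bdd that])
      also have "\<dots> \<le> w y + C * (dist x z + dist z y)" using C0 dist_triangle[of x y z] by (intro add_left_mono mult_left_mono) auto
      finally show ?thesis by (simp add: algebra_simps)
    qed
    then have "w' x - C * dist x z \<le> w' z" unfolding w'_def[of z] using False by (intro cINF_greatest) auto
    then show ?thesis by simp
  qed
  then have "\<bar>w' x - w' z\<bar> \<le> C * dist x z" for x z
    by (metis abs_le_iff dist_commute minus_diff_eq)
  then have "C-lipschitz_on UNIV w'"
    by (intro lipschitz_onI C0) (auto simp: dist_real_def)
  moreover have "w' x = w x" if "x \<in> S" for x
  proof (rule antisym)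
    show "w' x \<le> w x" unfolding w'_def using cINF_lower[OF bdd that, of x] by simp
    show "w x \<le> w' x" unfolding w'_def
    proof (rule cINF_greatest[OF False])
      fix y assume "y \<in> S"
      from lipschitz_onD[OF lip that this] show "w x \<le> w y + C * dist x y" by (simp add: dist_real_def)
    qed
  qed
  ultimately show thesis by (rule that)
qed

text \<open>A segment from a point of \<open>U\<close> to a point outside meets the frontier, where \<open>w\<close> vanishes.\<close>
lemma lipschitz_extend_by_zero:
  fixes w :: "'a::euclidean_space \<Rightarrow> real"
  assumes lip: "C-lipschitz_on (closure U) w" and fr: "\<And>x. x \<in> frontier U \<Longrightarrow> w x = 0"
  shows "C-lipschitz_on UNIV (\<lambda>x. if x \<in> U then w x else 0)"
proof -
  have C0: "C \<ge> 0" using lip by (rule lipschitz_on_nonneg)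
  have cl: "U \<subseteq> closure U" by (rule closure_subset)
  have frcl: "frontier U \<subseteq> closure U" by (auto simp: frontier_def)
  have key: "\<bar>w x\<bar> \<le> C * dist x y" if "x \<in> U" "y \<notin> U" for x y
  proof -
    have "closed_segment x y \<inter> frontier U \<noteq> {}"
      by (rule connected_Int_frontier) (use that in auto)
    then obtain z where z: "z \<in> closed_segment x y" "z \<in> frontier U" by blast
    have "\<bar>w x - w z\<bar> \<le> C * dist x z"
      using lipschitz_onD[OF lip, of x z] that z cl frcl by (auto simp: dist_real_def)
    also have "\<dots> \<le> C * dist x y"
      using C0 z(1) by (intro mult_left_mono) (auto simp: dist_norm norm_minus_commute dest: segment_bound1)
    finally show ?thesis using fr[OF z(2)] by simp
  qed
  show ?thesis
  proof (rule lipschitz_onI[OF _ C0])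
    fix x y :: 'a
    show "dist (if x \<in> U then w x else 0) (if y \<in> U then w y else 0) \<le> C * dist x y"
      using key[of x y] key[of y x] lipschitz_onD[OF lip, of x y] cl C0
      by (auto simp: dist_real_def dist_commute)
  qed
qed

section \<open>Integration by parts for Lipschitz functions\<close>

lemma continuous_bounded_support_integrable:
  fixes g :: "'a::euclidean_space \<Rightarrow> real"
  assumes "continuous_on UNIV g" "bounded {x. g x \<noteq> 0}"
  shows "integrable lebesgue g"
proof -
  obtain R where R: "\<And>x. g x \<noteq> 0 \<Longrightarrow> norm x \<le> R" using assms(2) by (auto simp: bounded_iff)
  have "compact (g ` cball 0 R)"
    using assms(1) by (intro compact_continuous_image) (auto intro: continuous_on_subset)
  then obtain K where K: "\<And>x. x \<in> cball 0 R \<Longrightarrow> \<bar>g x\<bar> \<le> K"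
    using compact_imp_bounded[of "g ` cball 0 R"] unfolding bounded_iff by (metis image_eqI real_norm_def)
  show ?thesis
  proof (rule integrable_bounded_support[where B="cball 0 R" and K=K])
    show "AE x in lebesgue. \<bar>g x\<bar> \<le> K * indicator (cball 0 R) x"
      using K R by (intro AE_I2) (force simp: indicator_def)
  qed (auto intro!: borel_measurable_lebesgueI borel_measurable_continuous_onI assms(1))
qed

lemma lipschitz_bounded_on_bounded:
  fixes w :: "'a::euclidean_space \<Rightarrow> real"
  assumes lip: "C-lipschitz_on S w" and "bounded S"
  obtains K where "K \<ge> 0" "\<And>x. x \<in> S \<Longrightarrow> \<bar>w x\<bar> \<le> K"
proof -
  have "bounded (w ` S)"
    by (rule bounded_uniformly_continuous_image[OF lipschitz_on_uniformly_continuous[OF lip] assms(2)])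
  then show thesis using that unfolding bounded_iff by (metis image_eqI real_norm_def abs_ge_zero order_trans empty_iff ex_in_conv le_cases)
qed

lemma lipschitz_indicator_integrable:
  fixes w :: "'a::euclidean_space \<Rightarrow> real"
  assumes \<Omega>: "open \<Omega>" "bounded \<Omega>" and w: "C-lipschitz_on UNIV w"
  shows "integrable lebesgue (\<lambda>x. indicator \<Omega> x * w x)"
proof -
  obtain L where L: "\<And>x. x \<in> \<Omega> \<Longrightarrow> \<bar>w x\<bar> \<le> L"
    using lipschitz_bounded_on_bounded[OF lipschitz_on_subset[OF w subset_UNIV] \<Omega>(2)] by metis
  show ?thesis
  proof (rule integrable_bounded_support[where B=\<Omega> and K=L])
    show "(\<lambda>x. indicator \<Omega> x * w x) \<in> borel_measurable lebesgue"
      by (intro borel_measurable_times open_indicator_measurable \<Omega> borel_measurable_lebesgueI[OF lipschitz_borel_measurable[OF w]])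
    show "AE x in lebesgue. \<bar>indicator \<Omega> x * w x\<bar> \<le> L * indicator \<Omega> x"
      using L by (intro AE_I2) (auto simp: indicator_def)
  qed (use \<Omega> in \<open>auto simp: borel_open\<close>)
qed

lemma bounded_support_translate:
  fixes g :: "'a::real_normed_vector \<Rightarrow> real"
  assumes "bounded {x. g x \<noteq> 0}" shows "bounded {x. g (x + c) \<noteq> 0}"
proof -
  have "{x. g (x + c) \<noteq> 0} \<subseteq> (+) (- c) ` {x. g x \<noteq> 0}"
  proof
    fix x assume "x \<in> {x. g (x + c) \<noteq> 0}"
    then show "x \<in> (+) (- c) ` {x. g x \<noteq> 0}" by (intro image_eqI[of _ _ "x + c"]) auto
  qed
  then show ?thesis using bounded_translation[OF assms] bounded_subset by blast
qed

lemma lipschitz_translate_continuous: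
  fixes w :: "'a::euclidean_space \<Rightarrow> real"
  assumes "C-lipschitz_on UNIV w" shows "continuous_on UNIV (\<lambda>x. w (x + c))"
  by (rule continuous_on_compose2[OF lipschitz_on_continuous_on[OF assms]]) (auto intro!: continuous_intros)

lemma shifted_product_integrable:
  fixes w \<eta> :: "'a::euclidean_space \<Rightarrow> real"
  assumes "C-lipschitz_on UNIV w" "D-lipschitz_on UNIV \<eta>" "bounded {x. \<eta> x \<noteq> 0}"
  shows "integrable lebesgue (\<lambda>x. w (x + c) * \<eta> (x + d))"
proof (rule continuous_bounded_support_integrable)
  show "continuous_on UNIV (\<lambda>x. w (x + c) * \<eta> (x + d))"
    by (intro continuous_on_mult lipschitz_translate_continuous[OF assms(1)] lipschitz_translate_continuous[OF assms(2)])
  show "bounded {x. w (x + c) * \<eta> (x + d) \<noteq> 0}"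
    by (rule bounded_subset[OF bounded_support_translate[OF assms(3), of d]]) auto
qed

lemma shifted_product_integral:
  fixes w \<eta> :: "'a::euclidean_space \<Rightarrow> real"
  assumes "C-lipschitz_on UNIV w" "D-lipschitz_on UNIV \<eta>"
  shows "(LINT x|lebesgue. w (x + c) * \<eta> (x + d)) = (LINT x|lebesgue. w (x + (c - d)) * \<eta> x)"
proof -
  have "(\<lambda>x. w (x + (c - d)) * \<eta> x) \<in> borel_measurable lebesgue"
    by (intro borel_measurable_lebesgueI borel_measurable_continuous_onI continuous_on_mult
          lipschitz_translate_continuous[OF assms(1)] lipschitz_on_continuous_on[OF assms(2)])
  from lebesgue_integral_translate[OF this, of d] show ?thesis by (simp add: algebra_simps)
qed

lemma grad_eq_0_outside:
  fixes \<eta> :: "real ^ 'n \<Rightarrow> real"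
  assumes "x \<notin> closure {x. \<eta> x \<noteq> 0}"
  shows "grad \<eta> x = 0"
proof -
  have "grad \<eta> x = grad (\<lambda>_. 0) x"
    using assms closure_subset[of "{x. \<eta> x \<noteq> 0}"] by (intro grad_cong_open[of "- closure {x. \<eta> x \<noteq> 0}"]) auto
  also have "\<dots> = 0" by (rule grad_eqI) (simp add: gderiv_def)
  finally show ?thesis .
qed

lemma diff_quot_outside:
  assumes "bounded {x. \<eta> x \<noteq> 0}"
  obtains R where "R \<ge> 0" "\<And>n x. norm x > R \<Longrightarrow> diff_quot \<eta> e n x = 0" "\<And>x. norm x > R \<Longrightarrow> \<eta> x = 0"
proof -
  obtain R where R: "\<And>x. \<eta> x \<noteq> 0 \<Longrightarrow> norm x \<le> R" using assms by (auto simp: bounded_iff)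
  show thesis
  proof (rule that[of "\<bar>R\<bar> + norm e"])
    fix x :: "real ^ 2" and n assume x: "norm x > \<bar>R\<bar> + norm e"
    have "norm ((1 / real (Suc n)) *\<^sub>R e) \<le> norm e" by (simp add: divide_le_eq mult_le_cancel_left1)
    then have "norm (x + (1 / real (Suc n)) *\<^sub>R e) > R"
      using x norm_diff_ineq[of x "(1 / real (Suc n)) *\<^sub>R e"] by linarith
    then have "\<eta> (x + (1 / real (Suc n)) *\<^sub>R e) = 0" using R by (meson not_le)
    moreover have "norm x > R" using x norm_ge_zero[of e] by linarith
    then have "\<eta> x = 0" using R by (meson not_le)
    ultimately show "diff_quot \<eta> e n x = 0" by (simp add: diff_quot_def)
  next
    fix x :: "real ^ 2" assume "norm x > \<bar>R\<bar> + norm e" then show "\<eta> x = 0" using R[of x] by (smt (verit) norm_ge_zero)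
  qed simp
qed

text \<open>Summation by parts: an instance of translation invariance, with no error term.\<close>
lemma integral_diff_quot_mult:
  fixes w \<eta> :: "real ^ 2 \<Rightarrow> real"
  assumes w: "C-lipschitz_on UNIV w" and \<eta>: "D-lipschitz_on UNIV \<eta>" "bounded {x. \<eta> x \<noteq> 0}"
  shows "(LINT x|lebesgue. w x * diff_quot \<eta> e n x) = (LINT x|lebesgue. diff_quot w (- e) n x * \<eta> x)"
proof -
  define c where "c = (1 / real (Suc n)) *\<^sub>R e"
  note I = shifted_product_integrable[OF w \<eta>] and J = shifted_product_integral[OF w \<eta>(1)]
  have "(LINT x|lebesgue. w x * diff_quot \<eta> e n x) = (LINT x|lebesgue. (w (x+0) * \<eta> (x + c) - w (x+0) * \<eta> (x+0)) * real (Suc n))"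
    by (simp add: diff_quot_def c_def algebra_simps del: of_nat_Suc)
  also have "\<dots> = ((LINT x|lebesgue. w (x+0) * \<eta> (x + c)) - (LINT x|lebesgue. w (x+0) * \<eta> (x+0))) * real (Suc n)"
    by (subst integral_mult_left_zero, subst Bochner_Integration.integral_diff[OF I I]) simp
  also have "(LINT x|lebesgue. w (x+0) * \<eta> (x + c)) = (LINT x|lebesgue. w (x+(-c)) * \<eta> (x+0))"
    using J[of 0 c] by simp
  also have "((LINT x|lebesgue. w (x+(-c)) * \<eta> (x+0)) - (LINT x|lebesgue. w (x+0) * \<eta> (x+0))) * real (Suc n)
    = (LINT x|lebesgue. (w (x+(-c)) * \<eta> (x+0) - w (x+0) * \<eta> (x+0)) * real (Suc n))"
    by (subst integral_mult_left_zero, subst Bochner_Integration.integral_diff[OF I I]) simp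
  also have "\<dots> = (LINT x|lebesgue. diff_quot w (- e) n x * \<eta> x)"
    by (simp add: diff_quot_def c_def algebra_simps del: of_nat_Suc)
  finally show ?thesis .
qed

text \<open>The limit of the discrete formula. Difference quotients of Lipschitz functions are bounded and converge
almost everywhere, so dominated convergence applies on both sides.\<close>
lemma integration_by_parts_direction:
  fixes w \<eta> :: "real ^ 2 \<Rightarrow> real"
  assumes w: "C-lipschitz_on UNIV w" and \<eta>: "D-lipschitz_on UNIV \<eta>" "bounded {x. \<eta> x \<noteq> 0}"
  shows "(LINT x|lebesgue. w x * (e \<bullet> grad \<eta> x)) = - (LINT x|lebesgue. (e \<bullet> grad w x) * \<eta> x)"
proof -
  obtain R where R: "R \<ge> 0" "\<And>n x. norm x > R \<Longrightarrow> diff_quot \<eta> e n x = 0" "\<And>x. norm x > R \<Longrightarrow> \<eta> x = 0"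
    using diff_quot_outside[OF \<eta>(2)] by metis
  define B where "B = cball (0 :: real ^ 2) R"
  have B: "bounded B" "B \<in> sets lebesgue" by (auto simp: B_def)
  obtain K where K: "K \<ge> 0" "\<And>x. x \<in> B \<Longrightarrow> \<bar>w x\<bar> \<le> K"
    using lipschitz_bounded_on_bounded[OF lipschitz_on_subset[OF w subset_UNIV] B(1)] by metis
  obtain K' where K': "K' \<ge> 0" "\<And>x. x \<in> B \<Longrightarrow> \<bar>\<eta> x\<bar> \<le> K'"
    using lipschitz_bounded_on_bounded[OF lipschitz_on_subset[OF \<eta>(1) subset_UNIV] B(1)] by metis
  note meas = borel_measurable_lebesgueI[OF lipschitz_borel_measurable] borel_measurable_lebesgueI[OF diff_quot_measurable]
     grad_measurable
  have C0: "C \<ge> 0" "D \<ge> 0" using lipschitz_on_nonneg[OF w] lipschitz_on_nonneg[OF \<eta>(1)] by auto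
  have 1: "(\<lambda>n. LINT x|lebesgue. w x * diff_quot \<eta> e n x) \<longlonglongrightarrow> (LINT x|lebesgue. w x * (e \<bullet> grad \<eta> x))"
  proof (rule dominated_convergence_bounded_support[where B=B and K="K * (D * norm e)"])
    show "AE x in lebesgue. (\<lambda>n. w x * diff_quot \<eta> e n x) \<longlonglongrightarrow> w x * (e \<bullet> grad \<eta> x)"
      using diff_quot_tendsto_grad[OF \<eta>(1)] by eventually_elim (intro tendsto_intros)
    show "AE x in lebesgue. \<bar>w x * diff_quot \<eta> e n x\<bar> \<le> K * (D * norm e) * indicator B x" for n
    proof (intro AE_I2)
      fix x show "\<bar>w x * diff_quot \<eta> e n x\<bar> \<le> K * (D * norm e) * indicator B x"
      proof (cases "x \<in> B")
        case True
        then show ?thesis using K diff_quot_bound[OF \<eta>(1), of e n x] by (auto simp: abs_mult intro!: mult_mono)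
      qed (use R(2) in \<open>auto simp: B_def not_le\<close>)
    qed
    show "(\<lambda>x. w x * diff_quot \<eta> e n x) \<in> borel_measurable lebesgue" for n
      by (intro borel_measurable_times meas(1)[OF w] meas(2)[OF \<eta>(1)])
    show "(\<lambda>x. w x * (e \<bullet> grad \<eta> x)) \<in> borel_measurable lebesgue"
      by (intro borel_measurable_times borel_measurable_inner borel_measurable_const meas(1)[OF w] meas(3)[OF \<eta>(1)])
  qed (rule B)+
  have 2: "(\<lambda>n. LINT x|lebesgue. diff_quot w (- e) n x * \<eta> x) \<longlonglongrightarrow> (LINT x|lebesgue. (- e \<bullet> grad w x) * \<eta> x)"
  proof (rule dominated_convergence_bounded_support[where B=B and K="(C * norm e) * K'"])
    show "AE x in lebesgue. (\<lambda>n. diff_quot w (- e) n x * \<eta> x) \<longlonglongrightarrow> (- e \<bullet> grad w x) * \<eta> x"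
      using diff_quot_tendsto_grad[OF w] by eventually_elim (intro tendsto_intros)
    show "AE x in lebesgue. \<bar>diff_quot w (- e) n x * \<eta> x\<bar> \<le> (C * norm e) * K' * indicator B x" for n
    proof (intro AE_I2)
      fix x show "\<bar>diff_quot w (- e) n x * \<eta> x\<bar> \<le> (C * norm e) * K' * indicator B x"
      proof (cases "x \<in> B")
        case True
        then show ?thesis using K' C0 diff_quot_bound[OF w, of "- e" n x] by (auto simp: abs_mult intro!: mult_mono)
      qed (use R(3) in \<open>auto simp: B_def not_le\<close>)
    qed
    show "(\<lambda>x. diff_quot w (- e) n x * \<eta> x) \<in> borel_measurable lebesgue" for n
      by (intro borel_measurable_times meas(1)[OF \<eta>(1)] meas(2)[OF w])
    show "(\<lambda>x. (- e \<bullet> grad w x) * \<eta> x) \<in> borel_measurable lebesgue"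
      by (intro borel_measurable_times borel_measurable_inner borel_measurable_const meas(1)[OF \<eta>(1)] meas(3)[OF w])
  qed (rule B)+
  show ?thesis
    using LIMSEQ_unique[OF 1 2[folded integral_diff_quot_mult[OF w \<eta>]]] by simp
qed

lemma integration_by_parts:
  fixes w \<eta> :: "real ^ 2 \<Rightarrow> real"
  assumes w: "C-lipschitz_on UNIV w" and \<eta>: "D-lipschitz_on UNIV \<eta>" "bounded {x. \<eta> x \<noteq> 0}"
  shows "(LINT x|lebesgue. w x * grad \<eta> x $ i) = - (LINT x|lebesgue. grad w x $ i * \<eta> x)"
  using integration_by_parts_direction[OF assms, of "axis i 1"] by (simp add: inner_axis')

text \<open>The Jacobian determinant of \<open>(w, \<eta>)\<close> is a null Lagrangian; equivalently, a rotated gradient is weakly divergence free. For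
smooth functions this is the symmetry of second derivatives. For Lipschitz functions it follows from the discrete
version: translating both factors turns the product of the quotients with increments \<open>e\<close>
and \<open>f\<close> into the product with increments \<open>- f\<close> and \<open>- e\<close>.\<close>
lemma integral_grad_jacobian_symmetric:
  fixes w \<eta> :: "real ^ 2 \<Rightarrow> real"
  assumes w: "C-lipschitz_on UNIV w" and \<eta>: "D-lipschitz_on UNIV \<eta>" "bounded {x. \<eta> x \<noteq> 0}"
  shows "(LINT x|lebesgue. grad w x $ i * grad \<eta> x $ j) = (LINT x|lebesgue. grad w x $ j * grad \<eta> x $ i)"
proof -
  have C0: "C \<ge> 0" "D \<ge> 0" using lipschitz_on_nonneg[OF w] lipschitz_on_nonneg[OF \<eta>(1)] by auto
  have conv: "(\<lambda>n. LINT x|lebesgue. diff_quot w e n x * diff_quot \<eta> f n x) \<longlonglongrightarrow> (LINT x|lebesgue. (e \<bullet> grad w x) * (f \<bullet> grad \<eta> x))" for e f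
  proof -
    obtain R where R: "R \<ge> 0" "\<And>n x. norm x > R \<Longrightarrow> diff_quot \<eta> f n x = 0"
      using diff_quot_outside[OF \<eta>(2)] by metis
    define B where "B = cball (0 :: real ^ 2) R"
    have B: "bounded B" "B \<in> sets lebesgue" by (auto simp: B_def)
    show ?thesis
    proof (rule dominated_convergence_bounded_support[where B=B and K="(C * norm e) * (D * norm f)"])
      show "AE x in lebesgue. (\<lambda>n. diff_quot w e n x * diff_quot \<eta> f n x) \<longlonglongrightarrow> (e \<bullet> grad w x) * (f \<bullet> grad \<eta> x)"
        using diff_quot_tendsto_grad[OF \<eta>(1)] diff_quot_tendsto_grad[OF w] by eventually_elim (intro tendsto_intros)
      show "AE x in lebesgue. \<bar>diff_quot w e n x * diff_quot \<eta> f n x\<bar> \<le> (C * norm e) * (D * norm f) * indicator B x" for n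
      proof (intro AE_I2)
        fix x show "\<bar>diff_quot w e n x * diff_quot \<eta> f n x\<bar> \<le> (C * norm e) * (D * norm f) * indicator B x"
        proof (cases "x \<in> B")
          case True
          then show ?thesis using C0 diff_quot_bound[OF w, of e n x] diff_quot_bound[OF \<eta>(1), of f n x]
            by (auto simp: abs_mult intro!: mult_mono)
        qed (use R(2) in \<open>auto simp: B_def not_le\<close>)
      qed
      show "(\<lambda>x. diff_quot w e n x * diff_quot \<eta> f n x) \<in> borel_measurable lebesgue" for n
        by (intro borel_measurable_times borel_measurable_lebesgueI diff_quot_measurable[OF w] diff_quot_measurable[OF \<eta>(1)])
      show "(\<lambda>x. (e \<bullet> grad w x) * (f \<bullet> grad \<eta> x)) \<in> borel_measurable lebesgue"
        by (intro borel_measurable_times borel_measurable_inner borel_measurable_const grad_measurable[OF w] grad_measurable[OF \<eta>(1)])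
    qed (rule B)+
  qed
  note I = shifted_product_integrable[OF w \<eta>] and J = shifted_product_integral[OF w \<eta>(1)]
  have swap: "(LINT x|lebesgue. diff_quot w e n x * diff_quot \<eta> f n x) = (LINT x|lebesgue. diff_quot w (- f) n x * diff_quot \<eta> (- e) n x)" for e f n
  proof -
    define s where "s = real (Suc n) * real (Suc n)"
    have expand: "(LINT x|lebesgue. diff_quot w a n x * diff_quot \<eta> b n x) =
       ((LINT x|lebesgue. w (x + (a' - b')) * \<eta> x) - (LINT x|lebesgue. w (x + a') * \<eta> x)
        - (LINT x|lebesgue. w (x - b') * \<eta> x) + (LINT x|lebesgue. w x * \<eta> x)) * s"
      if a': "a' = (1 / real (Suc n)) *\<^sub>R a" and b': "b' = (1 / real (Suc n)) *\<^sub>R b" for a b a' b'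
    proof -
      have "(LINT x|lebesgue. diff_quot w a n x * diff_quot \<eta> b n x) =
        (LINT x|lebesgue. (w (x+a') * \<eta> (x + b') - w (x + a') * \<eta> (x+0) - w (x+0) * \<eta> (x+b') + w (x+0) * \<eta> (x+0)) * s)"
        by (simp add: diff_quot_def a' b' s_def algebra_simps del: of_nat_Suc)
      also have "\<dots> = ((LINT x|lebesgue. w (x+a') * \<eta> (x + b')) - (LINT x|lebesgue. w (x + a') * \<eta> (x+0))
         - (LINT x|lebesgue. w (x+0) * \<eta> (x+b')) + (LINT x|lebesgue. w (x+0) * \<eta> (x+0))) * s"
        by (simp only: integral_mult_left_zero Bochner_Integration.integral_add[OF Bochner_Integration.integrable_diff[OF Bochner_Integration.integrable_diff[OF I I] I] I]
            Bochner_Integration.integral_diff[OF Bochner_Integration.integrable_diff[OF I I] I] Bochner_Integration.integral_diff[OF I I])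
      finally show ?thesis using J[of a' b'] J[of 0 b'] by simp
    qed
    show ?thesis
      by (subst expand[OF refl refl], subst expand[OF refl refl]) (simp add: algebra_simps)
  qed
  have "(LINT x|lebesgue. (axis i 1 \<bullet> grad w x) * (axis j 1 \<bullet> grad \<eta> x)) = (LINT x|lebesgue. (- axis j 1 \<bullet> grad w x) * (- axis i 1 \<bullet> grad \<eta> x))"
    using LIMSEQ_unique[OF conv[of "axis i 1" "axis j 1", unfolded swap[where e="axis i 1" and f="axis j 1"]] conv[of "- axis j 1" "- axis i 1"]] .
  then show ?thesis by (simp add: inner_axis')
qed

section \<open>Smooth test functions and the fundamental lemma\<close>

text \<open>The functions \<open>P (1 / t) exp (- 1 / t)\<close> for \<open>t > 0\<close>, continued by zero. For polynomials \<open>P\<close> this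
family is closed under differentiation, which gives smoothness without iterated derivatives.\<close>
definition flat_exp :: "real poly \<Rightarrow> real \<Rightarrow> real" where
  "flat_exp p t = (if t > 0 then poly p (1 / t) * exp (- (1 / t)) else 0)"

lemma poly_div_exp_tendsto_0: "((\<lambda>x. poly p x * exp (- x)) \<longlongrightarrow> (0::real)) at_top"
proof -
  have "((\<lambda>x. \<Sum>i\<le>degree p. coeff p i * (x ^ i / exp x)) \<longlongrightarrow> (\<Sum>i\<le>degree p. coeff p i * 0)) at_top"
    by (intro tendsto_sum tendsto_mult tendsto_const tendsto_power_div_exp_0)
  then show ?thesis
    by (simp add: poly_altdef sum_distrib_right exp_minus divide_inverse mult.assoc)
qed

lemma flat_exp_DERIV:
  "DERIV (flat_exp p) t :> flat_exp ([:0, 0, 1:] * (p - pderiv p)) t"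
proof -
  consider "t < 0" | "t = 0" | "t > 0" by linarith
  then show ?thesis
  proof cases
    case 1
    have "DERIV (\<lambda>_. 0) t :> flat_exp ([:0, 0, 1:] * (p - pderiv p)) t" using 1 by (simp add: flat_exp_def)
    then show ?thesis
      by (rule has_field_derivative_transform_within_open[where S="{..<0}"]) (use 1 in \<open>auto simp: flat_exp_def\<close>)
  next
    case 3
    have "DERIV (\<lambda>t. poly p (1 / t) * exp (- (1 / t))) t :> flat_exp ([:0, 0, 1:] * (p - pderiv p)) t"
      using 3 by (auto intro!: derivative_eq_intros DERIV_chain2[OF poly_DERIV] simp: flat_exp_def power2_eq_square field_simps)
    then show ?thesis
      by (rule has_field_derivative_transform_within_open[where S="{0<..}"]) (use 3 in \<open>auto simp: flat_exp_def\<close>)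
  next
    case 2
    have "((\<lambda>h. (flat_exp p (0 + h) - flat_exp p 0) / h) \<longlongrightarrow> 0) (at 0)"
    proof (rule filterlim_split_at)
      show "((\<lambda>h. (flat_exp p (0 + h) - flat_exp p 0) / h) \<longlongrightarrow> 0) (at_left 0)"
        by (rule Lim_transform_eventually[OF tendsto_const])
           (auto simp: eventually_at_left_field flat_exp_def intro!: exI[of _ "-1"])
      have "((\<lambda>h. poly ([:0,1:] * p) (inverse h) * exp (- inverse h)) \<longlongrightarrow> (0::real)) (at_right 0)"
        by (rule filterlim_compose[OF poly_div_exp_tendsto_0 filterlim_inverse_at_top_right])
      moreover have "\<forall>\<^sub>F h in at_right 0. poly ([:0,1:] * p) (inverse h) * exp (- inverse h) = (flat_exp p (0 + h) - flat_exp p 0) / h"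
        using eventually_at_right_less[of 0]
        by eventually_elim (auto simp: flat_exp_def field_simps)
      ultimately show "((\<lambda>h. (flat_exp p (0 + h) - flat_exp p 0) / h) \<longlongrightarrow> 0) (at_right 0)"
        by (rule Lim_transform_eventually)
    qed
    then show ?thesis using 2 by (simp add: DERIV_def flat_exp_def)
  qed
qed

text \<open>A class of functions closed under partial derivatives and consisting of differentiable functions
contains only smooth functions. This class is generated so that both properties are immediate from the
rules of differentiation.\<close>
inductive_set bump_algebra :: "(real ^ 'n \<Rightarrow> real) set" where
  gen: "(\<lambda>x. flat_exp p (c + d * x $ i)) \<in> bump_algebra"
| const: "(\<lambda>x. c) \<in> bump_algebra"
| add: "f \<in> bump_algebra \<Longrightarrow> g \<in> bump_algebra \<Longrightarrow> (\<lambda>x. f x + g x) \<in> bump_algebra"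
| mult: "f \<in> bump_algebra \<Longrightarrow> g \<in> bump_algebra \<Longrightarrow> (\<lambda>x. f x * g x) \<in> bump_algebra"

lemma bump_algebra_partial:
  assumes "f \<in> bump_algebra"
  shows "f differentiable_on UNIV \<and> (\<forall>i. (\<lambda>x. grad f x $ i) \<in> bump_algebra)"
  using assms
proof induction
  case (gen p c d j)
  define p' where "p' = [:0, 0, 1:] * (p - pderiv p)"
  have G: "GDERIV (\<lambda>x. flat_exp p (c + d * x $ j)) x :> (flat_exp p' (c + d * x $ j) * d) *\<^sub>R axis j 1" for x
  proof -
    have "((\<lambda>x. flat_exp p (c + d * x $ j)) has_derivative (\<lambda>h. flat_exp p' (c + d * x $ j) * (d * h $ j))) (at x)"
      by (rule has_derivative_compose[where g="flat_exp p" and f="\<lambda>x. c + d * x $ j"])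
         (use flat_exp_DERIV[of p "c + d * x $ j"] in \<open>auto simp: has_field_derivative_def p'_def
            intro!: derivative_eq_intros bounded_linear.has_derivative[OF bounded_linear_vec_nth]\<close>)
    then show ?thesis by (simp add: gderiv_def inner_axis algebra_simps)
  qed
  have "(\<lambda>x. grad (\<lambda>x. flat_exp p (c + d * x $ j)) x $ i) = (\<lambda>x. flat_exp p' (c + d * x $ j) * (if i = j then d else 0))" for i
    by (auto simp: grad_eqI[OF G] axis_def)
  then show ?case
    using G by (auto intro!: bump_algebra.intros simp: differentiable_on_def gderiv_def differentiable_def simp del: fun_cong)
next
  case (const c)
  have G: "GDERIV (\<lambda>x. c) x :> 0" for x :: "real ^ 'a" by (simp add: gderiv_def)
  show ?case by (auto simp: grad_eqI[OF G] intro: bump_algebra.intros)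
next
  case (add f g)
  have G: "GDERIV f x :> grad f x" "GDERIV g x :> grad g x" for x
    using add.IH by (auto simp: differentiable_on_def intro!: GDERIV_grad)
  have "grad (\<lambda>x. f x + g x) x = grad f x + grad g x" for x
    by (rule grad_eqI) (use G in \<open>auto simp: gderiv_def inner_add_right intro: has_derivative_add\<close>)
  then show ?case using add.IH by (auto intro: bump_algebra.intros differentiable_on_add)
next
  case (mult f g)
  have G: "GDERIV f x :> grad f x" "GDERIV g x :> grad g x" for x
    using mult.IH by (auto simp: differentiable_on_def intro!: GDERIV_grad)
  have "grad (\<lambda>x. f x * g x) x = f x *\<^sub>R grad g x + g x *\<^sub>R grad f x" for x
    by (rule grad_eqI) (use G in \<open>auto simp: gderiv_def inner_add_right algebra_simps intro!: derivative_eq_intros\<close>)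
  then show ?case using mult by (auto intro!: bump_algebra.intros differentiable_on_mult)
qed

lemma bump_algebra_smooth:
  assumes "f \<in> bump_algebra" shows "smooth f"
proof -
  have "foldr (\<lambda>i h x. grad h x $ i) is f \<in> bump_algebra" for "is"
    by (induction "is") (use assms bump_algebra_partial in auto)
  then show ?thesis using bump_algebra_partial by (auto simp: smooth_def)
qed

lemma bump_algebra_prod:
  "finite I \<Longrightarrow> (\<And>i. i \<in> I \<Longrightarrow> f i \<in> bump_algebra) \<Longrightarrow> (\<lambda>x. \<Prod>i\<in>I. f i x) \<in> bump_algebra"
proof (induction I rule: finite_induct)
  case empty show ?case by (simp add: bump_algebra.const)
next
  case (insert i I) then show ?case by (auto intro: bump_algebra.mult)
qed

text \<open>Smooth functions that increase to the indicator of an open box: each factor \<open>exp (- 1 / ((n + 1) s))\<close>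
tends to one for \<open>s > 0\<close>.\<close>
definition box_bump :: "real ^ 'n \<Rightarrow> real ^ 'n \<Rightarrow> nat \<Rightarrow> real ^ 'n \<Rightarrow> real" where
  "box_bump a b n x = (\<Prod>i\<in>UNIV. flat_exp 1 (real (Suc n) * (x $ i - a $ i)) * flat_exp 1 (real (Suc n) * (b $ i - x $ i)))"

lemma flat_exp_1_bounds: "0 \<le> flat_exp 1 t" "flat_exp 1 t \<le> 1" "flat_exp 1 t \<noteq> 0 \<longleftrightarrow> t > 0"
  by (auto simp: flat_exp_def)

lemma box_bump_smooth: "smooth (box_bump a b n)"
proof -
  have "(\<lambda>x. flat_exp 1 (real (Suc n) * (x $ i - a $ i)) * flat_exp 1 (real (Suc n) * (b $ i - x $ i))) \<in> bump_algebra" for i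
    using bump_algebra.mult[OF bump_algebra.gen[of 1 "- (real (Suc n) * a $ i)" "real (Suc n)" i] bump_algebra.gen[of 1 "real (Suc n) * b $ i" "- real (Suc n)" i]]
    by (simp add: algebra_simps)
  then show ?thesis unfolding box_bump_def[abs_def]
    by (intro bump_algebra_smooth bump_algebra_prod) auto
qed

lemma box_bump_support: "box_bump a b n x \<noteq> 0 \<longleftrightarrow> x \<in> box a b"
  by (auto simp: box_bump_def flat_exp_1_bounds(3) mem_box_cart zero_less_mult_iff simp del: of_nat_Suc)

lemma box_bump_bound: "\<bar>box_bump a b n x\<bar> \<le> 1"
proof -
  have "0 \<le> box_bump a b n x" unfolding box_bump_def by (intro prod_nonneg mult_nonneg_nonneg flat_exp_1_bounds) 
  moreover have "box_bump a b n x \<le> 1"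
    unfolding box_bump_def by (intro prod_le_1 conjI mult_nonneg_nonneg mult_le_one flat_exp_1_bounds)
  ultimately show ?thesis by simp
qed

lemma box_bump_tendsto: "(\<lambda>n. box_bump a b n x) \<longlonglongrightarrow> indicator (box a b) x"
proof (cases "x \<in> box a b")
  case False
  then have "box_bump a b n x = 0" for n using box_bump_support by blast
  then show ?thesis using False by simp
next
  case True
  have lim: "(\<lambda>n. flat_exp 1 (real (Suc n) * s)) \<longlonglongrightarrow> 1" if "s > 0" for s
  proof -
    have "(\<lambda>n. exp (- (1 / s * (1 / real (Suc n))))) \<longlonglongrightarrow> exp (- (1 / s * 0))"
      by (intro tendsto_intros step_tendsto_0)
    then show ?thesis using that by (simp add: flat_exp_def field_simps del: of_nat_Suc)
  qed
  have "(\<lambda>n. box_bump a b n x) \<longlonglongrightarrow> (\<Prod>i\<in>(UNIV::'a set). 1 * 1)"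
    unfolding box_bump_def by (intro tendsto_prod tendsto_mult lim) (use True in \<open>auto simp: mem_box_cart\<close>)
  then show ?thesis using True by simp
qed

lemma box_bump_test_function:
  assumes "cbox a b \<subseteq> \<Omega>"
  shows "test_function \<Omega> (box_bump a b n)"
proof -
  have eq: "{x. box_bump a b n x \<noteq> 0} = box a b" by (simp add: box_bump_support)
  have "closure (box a b) \<subseteq> cbox a b" by (rule closure_minimal[OF box_subset_cbox closed_cbox])
  then show ?thesis
    using assms unfolding test_function_def eq by (auto simp: box_bump_smooth intro: compact_closure[THEN iffD2] bounded_box)
qed

lemma lipschitz_of_GDERIV_bound:
  fixes \<phi> :: "real ^ 'n \<Rightarrow> real"
  assumes "convex S" "\<And>x. x \<in> S \<Longrightarrow> GDERIV \<phi> x :> D x" "\<And>x. x \<in> S \<Longrightarrow> norm (D x) \<le> M" "M \<ge> 0"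
  shows "M-lipschitz_on S \<phi>"
proof (rule bounded_derivative_imp_lipschitz[OF _ assms(1) _ assms(4)])
  show "x \<in> S \<Longrightarrow> (\<phi> has_derivative (\<lambda>h. h \<bullet> D x)) (at x within S)" for x
    using assms(2) by (auto simp: gderiv_def intro: has_derivative_at_withinI)
  show "x \<in> S \<Longrightarrow> onorm (\<lambda>h. h \<bullet> D x) \<le> M" for x
  proof (rule onorm_bound[OF assms(4)])
    assume "x \<in> S"
    show "norm (h \<bullet> D x) \<le> M * norm h" for h
      using Cauchy_Schwarz_ineq2[of h "D x"] assms(3)[OF \<open>x \<in> S\<close>] by (smt (verit) mult.commute mult_right_mono norm_ge_zero real_norm_def)
  qed
qed

lemma test_function_lipschitz:
  fixes \<phi> :: "real ^ 'n \<Rightarrow> real"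
  assumes "test_function \<Omega> \<phi>"
  obtains D where "D-lipschitz_on UNIV \<phi>" "bounded {x. \<phi> x \<noteq> 0}"
proof -
  let ?S = "closure {x. \<phi> x \<noteq> 0}"
  have sm: "smooth \<phi>" and comp: "compact ?S" using assms by (auto simp: test_function_def)
  have diff: "\<phi> differentiable (at x)" for x
    using sm[unfolded smooth_def, rule_format, of "[]"] by (simp add: differentiable_on_def)
  have "(\<lambda>x. grad \<phi> x $ i) differentiable_on UNIV" for i
    using sm[unfolded smooth_def, rule_format, of "[i]"] by simp
  then have "continuous_on UNIV (\<lambda>x. grad \<phi> x $ i)" for i
    by (rule differentiable_imp_continuous_on)
  then have cont: "continuous_on UNIV (grad \<phi>)"
    by (subst continuous_on_componentwise) (auto simp: Basis_vec_def inner_axis)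
  have "bounded (grad \<phi> ` ?S)"
    using comp cont by (intro compact_imp_bounded compact_continuous_image) (auto intro: continuous_on_subset)
  then obtain M where M: "\<And>x. x \<in> ?S \<Longrightarrow> norm (grad \<phi> x) \<le> M"
    unfolding bounded_iff by blast
  have bd: "norm (grad \<phi> x) \<le> \<bar>M\<bar>" for x
    using M[of x] grad_eq_0_outside[of x \<phi>] by (cases "x \<in> ?S") auto
  have "\<bar>M\<bar>-lipschitz_on UNIV \<phi>"
    by (rule lipschitz_of_GDERIV_bound[OF convex_UNIV GDERIV_grad[OF diff] bd]) simp
  moreover have "bounded {x. \<phi> x \<noteq> 0}"
    by (rule bounded_subset[OF compact_imp_bounded[OF comp] closure_subset])
  ultimately show thesis by (rule that)
qed

text \<open>Indicators of boxes are limits of test functions, so the integral of \<open>f\<close> over every small cube in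
\<open>\<Omega>\<close> vanishes.\<close>
lemma fundamental_lemma_calculus_of_variations:
  fixes f :: "real ^ 'n \<Rightarrow> real"
  assumes \<Omega>: "open \<Omega>"
    and meas: "(\<lambda>x. indicator \<Omega> x * f x) \<in> borel_measurable lebesgue"
    and bd: "AE x in lebesgue. \<bar>indicator \<Omega> x * f x\<bar> \<le> K"
    and zero: "\<And>\<phi>. test_function \<Omega> \<phi> \<Longrightarrow> (LINT x|lebesgue. indicator \<Omega> x * f x * \<phi> x) = 0"
  shows "AE x in lebesgue. x \<in> \<Omega> \<longrightarrow> f x = 0"
proof -
  let ?F = "\<lambda>x. indicator \<Omega> x * f x"
  have box0: "(LINT x|lebesgue. indicator (cbox a b) x * ?F x) = 0" if sub: "cbox a b \<subseteq> \<Omega>" for a b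
  proof -
    have "(\<lambda>n. LINT x|lebesgue. ?F x * box_bump a b n x) \<longlonglongrightarrow> (LINT x|lebesgue. indicator (cbox a b) x * ?F x)"
    proof (rule dominated_convergence_bounded_support[where B="cbox a b" and K=K])
      have neg: "negligible (frontier (cbox a b))" by (intro negligible_convex_frontier) simp
      have "AE x in lebesgue. x \<notin> frontier (cbox a b)"
        unfolding eventually_ae_filter_negligible using neg by blast
      then show "AE x in lebesgue. (\<lambda>n. ?F x * box_bump a b n x) \<longlonglongrightarrow> indicator (cbox a b) x * ?F x"
      proof eventually_elim
        case (elim x)
        have "(\<lambda>n. ?F x * box_bump a b n x) \<longlonglongrightarrow> ?F x * indicator (box a b) x"
          by (intro tendsto_mult tendsto_const box_bump_tendsto)
        moreover have "indicator (box a b) x = (indicator (cbox a b) x :: real)"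
          using elim box_subset_cbox[of a b] by (auto simp: indicator_def frontier_def interior_cbox closure_cbox split: if_splits)
        ultimately show ?case by (simp add: mult.commute)
      qed
      show "AE x in lebesgue. \<bar>?F x * box_bump a b n x\<bar> \<le> K * indicator (cbox a b) x" for n
        using bd
      proof eventually_elim
        case (elim x)
        show ?case
        proof (cases "x \<in> cbox a b")
          case True
          have "\<bar>?F x\<bar> * \<bar>box_bump a b n x\<bar> \<le> K * 1"
            using elim box_bump_bound[of a b n x] by (intro mult_mono) auto
          then show ?thesis using True by (simp add: abs_mult)
        next
          case False
          then have "box_bump a b n x = 0" using box_bump_support[of a b n x] box_subset_cbox[of a b] by blast
          then show ?thesis using False by simp
        qed
      qed
      show "(\<lambda>x. ?F x * box_bump a b n x) \<in> borel_measurable lebesgue" for n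
        by (rule test_function_lipschitz[OF box_bump_test_function[OF sub, of n]])
           (intro borel_measurable_times meas borel_measurable_lebesgueI[OF lipschitz_borel_measurable])
      show "(\<lambda>x. indicator (cbox a b) x * ?F x) \<in> borel_measurable lebesgue"
        by (intro borel_measurable_times borel_measurable_indicator meas) simp
    qed auto
    moreover have "(LINT x|lebesgue. ?F x * box_bump a b n x) = 0" for n
      by (rule zero[OF box_bump_test_function[OF sub]])
    ultimately show ?thesis by (simp add: LIMSEQ_const_iff)
  qed
  have "AE x in lebesgue. x \<in> \<Omega> \<longrightarrow> ?F x = 0"
  proof (rule AE_zero_of_cube_integrals)
    show "?F integrable_on cbox a b" for a b
      by (rule bounded_measurable_integrable_on_cbox(1)[OF meas bd])
    fix x assume "x \<in> \<Omega>"
    then obtain e where e: "e > 0" "ball x e \<subseteq> \<Omega>" using \<Omega> openE by blast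
    \<comment> \<open>The diameter of a cube of side \<open>h\<close> is at most \<open>DIM(real ^ 'n) * h\<close>.\<close>
    define d where "d = e / real (DIM(real ^ 'n) + 1)"
    have d: "d > 0" using e by (simp add: d_def)
    have "cbox x (x + h *\<^sub>R One) \<subseteq> \<Omega>" if h: "0 < h" "h < d" for h
    proof
      fix y assume y: "y \<in> cbox x (x + h *\<^sub>R One)"
      have "norm (y - x) \<le> (\<Sum>b\<in>Basis. \<bar>(y - x) \<bullet> b\<bar>)" by (rule norm_le_l1)
      also have "\<dots> \<le> (\<Sum>b\<in>(Basis :: (real ^ 'n) set). h)"
        using y by (intro sum_mono) (auto simp: mem_box inner_diff_left inner_add_left inner_sum_left_Basis abs_if)
      also have "\<dots> = real DIM(real ^ 'n) * h" by simp
      also have "\<dots> < (real DIM(real ^ 'n) + 1) * d" using h by (intro mult_strict_mono) auto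
      also have "\<dots> = e" by (simp add: d_def field_simps)
      finally show "y \<in> \<Omega>" using e(2) by (auto simp: dist_norm norm_minus_commute)
    qed
    then show "\<exists>d>0. \<forall>h. 0 < h \<and> h < d \<longrightarrow> integral (cbox x (x + h *\<^sub>R One)) ?F = 0"
      using d box0 by (auto simp: bounded_measurable_integrable_on_cbox(2)[OF meas bd] intro!: exI[of _ d])
  qed
  then show ?thesis by eventually_elim auto
qed

section \<open>Gradient bounds and Lipschitz constants\<close>

lemma abs_integral_le_measure:
  fixes f :: "'a::euclidean_space \<Rightarrow> real"
  assumes f: "f \<in> borel_measurable lebesgue" and bd: "AE x in lebesgue. \<bar>f x\<bar> \<le> K * indicator B x"
    and B: "bounded B" "B \<in> sets lebesgue"
  shows "\<bar>LINT x|lebesgue. f x\<bar> \<le> K * measure lebesgue B"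
proof -
  have lm: "B \<in> lmeasurable" using B by (simp add: bounded_set_imp_lmeasurable)
  have int: "integrable lebesgue f" by (rule integrable_bounded_support[OF f bd B])
  have "\<bar>LINT x|lebesgue. f x\<bar> \<le> (LINT x|lebesgue. \<bar>f x\<bar>)" by (rule integral_abs_bound)
  also have "\<dots> \<le> (LINT x|lebesgue. K * indicator B x)"
    using bd int lm by (intro integral_mono_AE integrable_abs integrable_mult_right) (simp_all add: lmeasurable_iff_integrable)
  also have "\<dots> = K * measure lebesgue B" by simp
  finally show ?thesis .
qed

text \<open>A null set may contain the whole segment from \<open>x\<close> to \<open>y\<close>, so the bound on the gradient says nothing along it. The
average of \<open>z\<close> over a ball moving along the segment is differentiable, its derivative is the average of
the directional derivative, and this is bounded by \<open>M |y - x|\<close>. Letting the radius tend to zero gives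
the claim.\<close>
lemma lipschitz_on_of_AE_grad_bound:
  fixes z :: "real ^ 2 \<Rightarrow> real"
  assumes lip: "C-lipschitz_on UNIV z" and U: "open U" "convex U"
    and bd: "AE x in lebesgue. x \<in> U \<longrightarrow> norm (grad z x) \<le> M" and M: "M \<ge> 0"
  shows "M-lipschitz_on U z"
proof (rule lipschitz_onI[OF _ M])
  fix x y assume xy: "x \<in> U" "y \<in> U"
  have C0: "C \<ge> 0" using lip by (rule lipschitz_on_nonneg)
  define h where "h = y - x"
  obtain e1 where e1: "e1 > 0" "ball x e1 \<subseteq> U" using U(1) xy(1) openE by blast
  obtain e2 where e2: "e2 > 0" "ball y e2 \<subseteq> U" using U(1) xy(2) openE by blast
  define \<epsilon> where "\<epsilon> = min e1 e2"
  have \<epsilon>: "\<epsilon> > 0" using e1 e2 by (simp add: \<epsilon>_def)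
  \<comment> \<open>A neighbourhood of the segment stays inside \<open>U\<close>, so small balls can move along it.\<close>
  have tube: "s + t *\<^sub>R h \<in> U" if "s \<in> ball x \<epsilon>" "0 \<le> t" "t \<le> 1" for s t
  proof -
    have "s \<in> U" "s + h \<in> U" using that(1) e1(2) e2(2) by (auto simp: \<epsilon>_def h_def dist_norm algebra_simps)
    then have "(1 - t) *\<^sub>R s + t *\<^sub>R (s + h) \<in> U" using U(2) that by (intro convexD) auto
    then show ?thesis by (simp add: algebra_simps)
  qed
  have main: "\<bar>z y - z x\<bar> \<le> M * norm h + 2 * C * r" if r: "0 < r" "r < \<epsilon>" for r
  proof -
    define A where "A = ball x r"
    define V where "V = measure lebesgue A"
    have A: "bounded A" "A \<in> sets lebesgue" "A \<in> sets borel" "A \<in> lmeasurable" by (auto simp: A_def)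
    have V: "V > 0" using r content_ball_pos[of r x] by (simp add: V_def A_def measure_completion)
    define g where "g t = (LINT s|lebesgue. indicator A s * z (s + t *\<^sub>R h))" for t :: real
    define g' where "g' t = (LINT s|lebesgue. indicator A s * (h \<bullet> grad z (s + t *\<^sub>R h)))" for t :: real
    have zm: "(\<lambda>s. z (s + c)) \<in> borel_measurable borel" for c
      by (rule borel_measurable_continuous_onI[OF lipschitz_translate_continuous[OF lip]])
    have ind: "indicator A \<in> borel_measurable lebesgue" using A by (intro borel_measurable_indicator)
    have gm: "(\<lambda>s. grad z (s + c)) \<in> borel_measurable lebesgue" for c
      using measurable_compose[OF measurable_lebesgue_translate[of c] grad_measurable[OF lip]] by (simp add: add.commute)
    have int: "integrable lebesgue (\<lambda>s. indicator A s * z (s + c))" for c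
    proof -
      obtain K where K: "\<And>s. s \<in> (+) c ` A \<Longrightarrow> \<bar>z s\<bar> \<le> K"
        using lipschitz_bounded_on_bounded[OF lipschitz_on_subset[OF lip subset_UNIV] bounded_translation[OF A(1)]] by metis
      show ?thesis
      proof (rule integrable_bounded_support[where B=A and K=K])
        show "AE s in lebesgue. \<bar>indicator A s * z (s + c)\<bar> \<le> K * indicator A s"
          using K by (intro AE_I2) (auto simp: indicator_def add.commute)
      qed (use A ind in \<open>auto intro!: borel_measurable_times borel_measurable_lebesgueI zm\<close>)
    qed
    have gder: "DERIV g t :> g' t" for t
    proof -
      have "((\<lambda>d. (g (t + d) - g t) / d) \<longlongrightarrow> g' t) (at 0)"
        unfolding tendsto_at_iff_sequentially
      proof (intro allI impI)
        fix X :: "nat \<Rightarrow> real" assume X: "\<forall>i. X i \<in> UNIV - {0}" "X \<longlonglongrightarrow> 0"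
        have X0: "X n \<noteq> 0" for n using X(1) by auto
        have "(\<lambda>n. LINT s|lebesgue. indicator A s * ((z (s + (t + X n) *\<^sub>R h) - z (s + t *\<^sub>R h)) / X n)) \<longlonglongrightarrow> g' t"
          unfolding g'_def
        proof (rule dominated_convergence_bounded_support[where B=A and K="C * norm h"])
          have filt: "filterlim X (at 0) sequentially"
            unfolding filterlim_at using X by auto
          show "AE s in lebesgue. (\<lambda>n. indicator A s * ((z (s + (t + X n) *\<^sub>R h) - z (s + t *\<^sub>R h)) / X n)) \<longlonglongrightarrow> indicator A s * (h \<bullet> grad z (s + t *\<^sub>R h))"
            using AE_lebesgue_translate[OF lipschitz_ae_differentiable[OF lip], of "t *\<^sub>R h"]
          proof eventually_elim
            case (elim s)
            have "((\<lambda>d. (z (s + t *\<^sub>R h + d *\<^sub>R h) - z (s + t *\<^sub>R h)) / d) \<longlongrightarrow> h \<bullet> grad z (s + t *\<^sub>R h)) (at 0)"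
              using GDERIV_direction[OF elim, of h] by (simp add: DERIV_def)
            from filterlim_compose[OF this filt] show ?case
              by (intro tendsto_intros) (simp add: algebra_simps)
          qed
          show "AE s in lebesgue. \<bar>indicator A s * ((z (s + (t + X n) *\<^sub>R h) - z (s + t *\<^sub>R h)) / X n)\<bar> \<le> C * norm h * indicator A s" for n
          proof (intro AE_I2)
            fix s
            have "\<bar>z (s + (t + X n) *\<^sub>R h) - z (s + t *\<^sub>R h)\<bar> \<le> C * norm (X n *\<^sub>R h)"
              using lipschitz_onD[OF lip, of "s + (t + X n) *\<^sub>R h" "s + t *\<^sub>R h"] by (simp add: dist_norm algebra_simps)
            then show "\<bar>indicator A s * ((z (s + (t + X n) *\<^sub>R h) - z (s + t *\<^sub>R h)) / X n)\<bar> \<le> C * norm h * indicator A s"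
              using X0[of n] by (auto simp: indicator_def field_simps)
          qed
          show "(\<lambda>s. indicator A s * ((z (s + (t + X n) *\<^sub>R h) - z (s + t *\<^sub>R h)) / X n)) \<in> borel_measurable lebesgue" for n
            by (intro borel_measurable_times ind borel_measurable_divide borel_measurable_diff borel_measurable_const borel_measurable_lebesgueI zm)
          show "(\<lambda>s. indicator A s * (h \<bullet> grad z (s + t *\<^sub>R h))) \<in> borel_measurable lebesgue"
            by (intro borel_measurable_times ind borel_measurable_inner borel_measurable_const gm)
        qed (rule A)+
        moreover have "(LINT s|lebesgue. indicator A s * ((z (s + (t + X n) *\<^sub>R h) - z (s + t *\<^sub>R h)) / X n)) = (g (t + X n) - g t) / X n" for n
        proof -
          have "(LINT s|lebesgue. indicator A s * ((z (s + (t + X n) *\<^sub>R h) - z (s + t *\<^sub>R h)) / X n))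
            = (LINT s|lebesgue. (indicator A s * z (s + (t + X n) *\<^sub>R h) - indicator A s * z (s + t *\<^sub>R h)) / X n)"
            by (simp add: diff_divide_distrib right_diff_distrib)
          also have "\<dots> = (g (t + X n) - g t) / X n"
            unfolding g_def by (simp add: Bochner_Integration.integral_diff[OF int int])
          finally show ?thesis .
        qed
        ultimately show "((\<lambda>d. (g (t + d) - g t) / d) \<circ> X) \<longlonglongrightarrow> g' t" by (simp only: o_def)
      qed
      then show ?thesis by (simp add: DERIV_def)
    qed
    have g'b: "\<bar>g' t\<bar> \<le> M * norm h * V" if t: "0 \<le> t" "t \<le> 1" for t
    proof -
      have AEb: "AE s in lebesgue. \<bar>indicator A s * (h \<bullet> grad z (s + t *\<^sub>R h))\<bar> \<le> M * norm h * indicator A s"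
        using AE_lebesgue_translate[OF bd, of "t *\<^sub>R h"]
      proof eventually_elim
        case (elim s)
        show ?case
        proof (cases "s \<in> A")
          case True
          then have "s + t *\<^sub>R h \<in> U" using r t by (intro tube) (auto simp: A_def)
          then have "norm (grad z (s + t *\<^sub>R h)) \<le> M" using elim by blast
          then have "\<bar>h \<bullet> grad z (s + t *\<^sub>R h)\<bar> \<le> norm h * M"
            using Cauchy_Schwarz_ineq2[of h "grad z (s + t *\<^sub>R h)"] by (smt (verit) mult_left_mono norm_ge_zero)
          then show ?thesis using True by (simp add: mult.commute)
        qed simp
      qed
      show ?thesis
        unfolding g'_def V_def
        by (rule abs_integral_le_measure[OF _ AEb A(1,2)])
           (intro borel_measurable_times ind borel_measurable_inner borel_measurable_const gm)
    qed
    have "\<exists>t. 0 < t \<and> t < 1 \<and> g 1 - g 0 = (1 - 0) * g' t"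
      using gder by (intro MVT2) auto
    then have 1: "\<bar>g 1 - g 0\<bar> \<le> M * norm h * V" using g'b by auto
    \<comment> \<open>The averages over balls of radius \<open>r\<close> differ from the values at the centres by at most \<open>C * r\<close>.\<close>
    have near: "\<bar>(LINT s|lebesgue. indicator A s * z (s + c)) - z (x + c) * V\<bar> \<le> C * r * V" for c
    proof -
      have i2: "integrable lebesgue (\<lambda>s. indicator A s * z (x + c) :: real)"
        using A(4) by (intro integrable_mult_left) (simp add: lmeasurable_iff_integrable)
      have "(LINT s|lebesgue. indicator A s * z (s + c)) - z (x + c) * V = (LINT s|lebesgue. indicator A s * z (s + c) - indicator A s * z (x + c))"
        by (simp add: Bochner_Integration.integral_diff[OF int i2] V_def)
      also have "\<bar>\<dots>\<bar> \<le> C * r * V"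
        unfolding V_def
      proof (rule abs_integral_le_measure[OF _ _ A(1,2)])
        show "(\<lambda>s. indicator A s * z (s + c) - indicator A s * z (x + c)) \<in> borel_measurable lebesgue"
          by (rule borel_measurable_integrable[OF Bochner_Integration.integrable_diff[OF int i2]])
        have "\<bar>indicator A s * z (s + c) - indicator A s * z (x + c)\<bar> \<le> C * r * indicator A s" for s
        proof (cases "s \<in> A")
          case True
          have "\<bar>z (s + c) - z (x + c)\<bar> \<le> C * dist s x"
            using lipschitz_onD[OF lip, of "s + c" "x + c"] by (simp add: dist_norm)
          also have "\<dots> \<le> C * r" using True C0 by (intro mult_left_mono) (auto simp: A_def dist_commute)
          finally show ?thesis using True by simp
        qed simp
        then show "AE s in lebesgue. \<bar>indicator A s * z (s + c) - indicator A s * z (x + c)\<bar> \<le> C * r * indicator A s" by simp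
      qed
      finally show ?thesis .
    qed
    have "\<bar>g 1 - z y * V\<bar> \<le> C * r * V" "\<bar>g 0 - z x * V\<bar> \<le> C * r * V"
      using near[of h] near[of 0] by (simp_all add: g_def h_def)
    with 1 have "\<bar>z y * V - z x * V\<bar> \<le> M * norm h * V + 2 * (C * r * V)" by linarith
    moreover have "\<bar>z y * V - z x * V\<bar> = \<bar>z y - z x\<bar> * V"
      using V by (simp add: abs_mult flip: left_diff_distrib)
    ultimately have "\<bar>z y - z x\<bar> * V \<le> (M * norm h + 2 * C * r) * V"
      by (simp add: algebra_simps)
    then show ?thesis using V by simp
  qed
  have "((\<lambda>r. M * norm h + 2 * C * r) \<longlongrightarrow> M * norm h + 2 * C * 0) (at_right 0)"
    by (intro tendsto_intros)
  moreover have "\<forall>\<^sub>F r in at_right 0. \<bar>z y - z x\<bar> \<le> M * norm h + 2 * C * r"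
    using main \<epsilon> by (auto simp: eventually_at_right_field)
  ultimately have "\<bar>z y - z x\<bar> \<le> M * norm h"
    using tendsto_lowerbound[of _ _ "at_right (0::real)"] by fastforce
  then show "dist (z x) (z y) \<le> M * dist x y"
    by (simp add: dist_real_def dist_norm h_def abs_minus_commute norm_minus_commute)
qed

section \<open>Distributional partial derivatives of Lipschitz functions\<close>

lemma test_function_vanishes:
  assumes "test_function \<Omega> \<phi>" "x \<notin> \<Omega>"
  shows "\<phi> x = 0" "grad \<phi> x = 0"
proof -
  have x: "x \<notin> closure {x. \<phi> x \<noteq> 0}" using assms by (auto simp: test_function_def)
  show "grad \<phi> x = 0" using x by (rule grad_eq_0_outside)
  show "\<phi> x = 0" using x closure_subset[of "{x. \<phi> x \<noteq> 0}"] by auto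
qed

text \<open>Integration by parts shows that the difference of the two candidates vanishes against all test functions.\<close>
lemma distributional_partial_eq_grad:
  fixes v F :: "real ^ 2 \<Rightarrow> real"
  assumes \<Omega>: "open \<Omega>" and v: "C-lipschitz_on UNIV v"
    and F: "(\<lambda>x. indicator \<Omega> x * F x) \<in> borel_measurable lebesgue" "\<And>x. x \<in> \<Omega> \<Longrightarrow> \<bar>F x\<bar> \<le> K"
    and d: "has_distributional_partial \<Omega> i v F"
  shows "AE x in lebesgue. x \<in> \<Omega> \<longrightarrow> grad v x $ i = F x"
proof -
  note \<Omega>m = open_indicator_measurable[OF \<Omega>]
  note gm = grad_component_measurable[OF v, of i]
  have gb: "\<bar>grad v x $ i\<bar> \<le> C" for x
    using norm_grad_le[OF v open_UNIV UNIV_I, of x] component_le_norm_cart[of "grad v x" i] by linarith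
  have "AE x in lebesgue. x \<in> \<Omega> \<longrightarrow> grad v x $ i - F x = 0"
  proof (rule fundamental_lemma_calculus_of_variations[OF \<Omega>, where K="C + \<bar>K\<bar>"])
    have "(\<lambda>x. indicator \<Omega> x * grad v x $ i - indicator \<Omega> x * F x) \<in> borel_measurable lebesgue"
      by (intro borel_measurable_diff borel_measurable_times \<Omega>m gm F)
    then show "(\<lambda>x. indicator \<Omega> x * (grad v x $ i - F x)) \<in> borel_measurable lebesgue"
      by (simp add: right_diff_distrib)
    have "\<bar>indicator \<Omega> x * (grad v x $ i - F x)\<bar> \<le> C + \<bar>K\<bar>" for x
    proof (cases "x \<in> \<Omega>")
      case True then show ?thesis using gb[of x] F(2)[of x] by simp
    next
      case False then show ?thesis using lipschitz_on_nonneg[OF v] by simp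
    qed
    then show "AE x in lebesgue. \<bar>indicator \<Omega> x * (grad v x $ i - F x)\<bar> \<le> C + \<bar>K\<bar>" by simp
    fix \<phi> assume \<phi>: "test_function \<Omega> \<phi>"
    obtain D where D: "D-lipschitz_on UNIV \<phi>" "bounded {x. \<phi> x \<noteq> 0}"
      using test_function_lipschitz[OF \<phi>] by metis
    obtain R where R: "\<And>x. \<phi> x \<noteq> 0 \<Longrightarrow> norm x \<le> R" using D(2) by (auto simp: bounded_iff)
    obtain L where L: "L \<ge> 0" "\<And>x. x \<in> cball 0 R \<Longrightarrow> \<bar>\<phi> x\<bar> \<le> L"
      using lipschitz_bounded_on_bounded[OF lipschitz_on_subset[OF D(1) subset_UNIV] bounded_cball] by metis
    have \<phi>m: "\<phi> \<in> borel_measurable lebesgue" by (rule borel_measurable_lebesgueI[OF lipschitz_borel_measurable[OF D(1)]])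
    have \<phi>b: "\<bar>\<phi> x\<bar> \<le> L * indicator (cball 0 R) x" for x using R[of x] L by (cases "\<phi> x = 0") auto
    have i1: "integrable lebesgue (\<lambda>x. grad v x $ i * \<phi> x)"
    proof (rule integrable_bounded_support[where B="cball 0 R" and K="C * L"])
      show "AE x in lebesgue. \<bar>grad v x $ i * \<phi> x\<bar> \<le> C * L * indicator (cball 0 R) x"
        unfolding abs_mult mult.assoc using gb \<phi>b lipschitz_on_nonneg[OF v] by (intro AE_I2 mult_mono) auto
    qed (use gm \<phi>m in \<open>auto intro!: borel_measurable_times\<close>)
    have i2: "integrable lebesgue (\<lambda>x. indicator \<Omega> x * F x * \<phi> x)"
    proof (rule integrable_bounded_support[where B="cball 0 R" and K="\<bar>K\<bar> * L"])
      have "\<bar>indicator \<Omega> x * F x\<bar> \<le> \<bar>K\<bar>" for x using F(2)[of x] by (auto simp: indicator_def)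
      then show "AE x in lebesgue. \<bar>indicator \<Omega> x * F x * \<phi> x\<bar> \<le> \<bar>K\<bar> * L * indicator (cball 0 R) x"
        unfolding abs_mult[of _ "\<phi> _"] mult.assoc[of "\<bar>K\<bar>"] using \<phi>b by (intro AE_I2 mult_mono) auto
    qed (use F \<phi>m in \<open>auto intro!: borel_measurable_times\<close>)
    have "(LINT x:\<Omega>|lebesgue. v x * grad \<phi> x $ i) = (LINT x|lebesgue. v x * grad \<phi> x $ i)"
      unfolding set_lebesgue_integral_def
      by (intro Bochner_Integration.integral_cong) (auto simp: indicator_def test_function_vanishes[OF \<phi>])
    also have "\<dots> = - (LINT x|lebesgue. grad v x $ i * \<phi> x)"
      by (rule integration_by_parts[OF v D])
    finally have "(LINT x|lebesgue. grad v x $ i * \<phi> x) = (LINT x|lebesgue. indicator \<Omega> x * F x * \<phi> x)"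
      using d \<phi> by (simp add: has_distributional_partial_def set_lebesgue_integral_def mult.assoc)
    then have "(LINT x|lebesgue. grad v x $ i * \<phi> x - indicator \<Omega> x * F x * \<phi> x) = 0"
      by (simp add: Bochner_Integration.integral_diff[OF i1 i2])
    moreover have "indicator \<Omega> x * (grad v x $ i - F x) * \<phi> x = grad v x $ i * \<phi> x - indicator \<Omega> x * F x * \<phi> x" for x
      using test_function_vanishes(1)[OF \<phi>, of x] by (cases "x \<in> \<Omega>") (auto simp: algebra_simps)
    ultimately show "(LINT x|lebesgue. indicator \<Omega> x * (grad v x $ i - F x) * \<phi> x) = 0" by simp
  qed
  then show ?thesis by eventually_elim auto
qed

lemma locally_integrable_bounded:
  fixes F :: "real ^ 'n \<Rightarrow> real"
  assumes F: "(\<lambda>x. indicator \<Omega> x * F x) \<in> borel_measurable lebesgue" "\<And>x. x \<in> \<Omega> \<Longrightarrow> \<bar>F x\<bar> \<le> K"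
  shows "locally_integrable \<Omega> F"
  unfolding locally_integrable_def set_integrable_def
proof (intro allI impI)
  fix S :: "(real ^ 'n) set" assume S: "compact S \<and> S \<subseteq> \<Omega>"
  then have Sm: "S \<in> sets lebesgue" by (simp add: compact_imp_closed borel_closed)
  have eq: "indicator S x *\<^sub>R F x = indicator S x * (indicator \<Omega> x * F x)" for x
    using S by (auto simp: indicator_def)
  show "integrable lebesgue (\<lambda>x. indicator S x *\<^sub>R F x)"
    unfolding eq
  proof (rule integrable_bounded_support[where B=S and K=K])
    show "AE x in lebesgue. \<bar>indicator S x * (indicator \<Omega> x * F x)\<bar> \<le> K * indicator S x"
      using S F(2) by (intro AE_I2) (auto simp: indicator_def)
  qed (use S Sm F in \<open>auto intro!: borel_measurable_times borel_measurable_indicator compact_imp_bounded\<close>)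
qed

lemma grad_eq_distributional_partial:
  fixes v F :: "real ^ 2 \<Rightarrow> real"
  assumes \<Omega>: "open \<Omega>" "bounded \<Omega>" and v: "C-lipschitz_on UNIV v"
    and F: "(\<lambda>x. indicator \<Omega> x * F x) \<in> borel_measurable lebesgue" "\<And>x. x \<in> \<Omega> \<Longrightarrow> \<bar>F x\<bar> \<le> K"
    and ae: "AE x in lebesgue. x \<in> \<Omega> \<longrightarrow> grad v x $ i = F x"
  shows "has_distributional_partial \<Omega> i v F"
  unfolding has_distributional_partial_def
proof (intro conjI allI impI)
  obtain L where L: "\<And>x. x \<in> \<Omega> \<Longrightarrow> \<bar>v x\<bar> \<le> L"
    using lipschitz_bounded_on_bounded[OF lipschitz_on_subset[OF v subset_UNIV] \<Omega>(2)] by metis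
  show "locally_integrable \<Omega> v"
    by (intro locally_integrable_bounded[where K=L] borel_measurable_times open_indicator_measurable \<Omega>(1) borel_measurable_lebesgueI[OF lipschitz_borel_measurable[OF v]] L)
  show "locally_integrable \<Omega> F" by (rule locally_integrable_bounded[OF F])
  fix \<phi> assume \<phi>: "test_function \<Omega> \<phi>"
  obtain D where D: "D-lipschitz_on UNIV \<phi>" "bounded {x. \<phi> x \<noteq> 0}"
    using test_function_lipschitz[OF \<phi>] by metis
  have "(LINT x:\<Omega>|lebesgue. v x * grad \<phi> x $ i) = (LINT x|lebesgue. v x * grad \<phi> x $ i)"
    unfolding set_lebesgue_integral_def
    by (intro Bochner_Integration.integral_cong) (auto simp: indicator_def test_function_vanishes[OF \<phi>])
  also have "\<dots> = - (LINT x|lebesgue. grad v x $ i * \<phi> x)"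
    by (rule integration_by_parts[OF v D])
  also have "(LINT x|lebesgue. grad v x $ i * \<phi> x) = (LINT x:\<Omega>|lebesgue. F x * \<phi> x)"
    unfolding set_lebesgue_integral_def
  proof (rule integral_cong_AE)
    note gm = grad_component_measurable[OF v, of i]
    have \<phi>m: "\<phi> \<in> borel_measurable lebesgue" by (rule borel_measurable_lebesgueI[OF lipschitz_borel_measurable[OF D(1)]])
    show "(\<lambda>x. grad v x $ i * \<phi> x) \<in> borel_measurable lebesgue" by (intro borel_measurable_times gm \<phi>m)
    show "(\<lambda>x. indicator \<Omega> x *\<^sub>R (F x * \<phi> x)) \<in> borel_measurable lebesgue"
      using borel_measurable_times[OF F(1) \<phi>m] by (simp add: mult.assoc)
    show "AE x in lebesgue. grad v x $ i * \<phi> x = indicator \<Omega> x *\<^sub>R (F x * \<phi> x)"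
      using ae by eventually_elim (auto simp: indicator_def test_function_vanishes[OF \<phi>])
  qed
  finally show "(LINT x:\<Omega>|lebesgue. v x * grad \<phi> x $ i) = - (LINT x:\<Omega>|lebesgue. F x * \<phi> x)" .
qed

text \<open>On balls the gradient bound makes \<open>0\<close> a Lipschitz constant, and a locally constant function on a connected set is constant.\<close>
lemma constant_of_AE_grad_zero:
  fixes z :: "real ^ 2 \<Rightarrow> real"
  assumes lip: "C-lipschitz_on UNIV z" and U: "open U" "connected U"
    and bd: "AE x in lebesgue. x \<in> U \<longrightarrow> grad z x = 0" and xy: "x \<in> U" "y \<in> U"
  shows "z x = z y"
proof (rule connected_local_const[OF U(2) xy])
  show "\<forall>a\<in>U. \<forall>\<^sub>F b in at a within U. z a = z b"
  proof
    fix a assume "a \<in> U"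
    then obtain e where e: "e > 0" "ball a e \<subseteq> U" using U(1) openE by blast
    have "0-lipschitz_on (ball a e) z"
      by (rule lipschitz_on_of_AE_grad_bound[OF lip]) (use bd e in \<open>auto elim!: eventually_mono\<close>)
    then have "z a = z b" if "b \<in> ball a e" for b
      using lipschitz_onD[of 0 "ball a e" z a b] that e(1) by simp
    then show "\<forall>\<^sub>F b in at a within U. z a = z b"
      using e(1) by (auto simp: eventually_at dist_commute intro!: exI[of _ e])
  qed
qed

section \<open>Radial Lagrangeans\<close>

locale radial_lagrangean =
  fixes f :: "real \<Rightarrow> real"
  assumes sconv: "strictly_convex_on {0..} f" and C1: "C1_halfline f" and d0: "hderiv f 0 = 0"
begin

abbreviation g :: "real \<Rightarrow> real" where "g \<equiv> hderiv f"

lemma g_cont: "continuous_on {0..} g" using C1 by (simp add: C1_halfline_def)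

lemma f_deriv: "\<rho> \<ge> 0 \<Longrightarrow> (f has_real_derivative g \<rho>) (at \<rho> within {0..})"
  using C1 unfolding C1_halfline_def differentiable_on_def hderiv_def has_real_derivative_iff_has_vector_derivative
  by (simp add: vector_derivative_works)

text \<open>Convexity bounds the difference quotients along \<open>x + t (y - x)\<close> by the quotient at \<open>t = 1\<close>. The point
\<open>x = 0\<close>, where only a one-sided derivative exists, is included.\<close>
lemma tangent_below:
  assumes x: "x \<ge> 0" and y: "y \<ge> 0"
  shows "g x * (y - x) \<le> f y - f x"
proof -
  define t where "t n = 1 / real (Suc (Suc n))" for n
  have t: "0 < t n" "t n < 1" for n by (auto simp: t_def)
  have t0: "t \<longlonglongrightarrow> 0" unfolding t_def[abs_def] by (rule LIMSEQ_Suc[OF step_tendsto_0])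
  show ?thesis
  proof (cases "x = y")
    case False
    have conv: "f (x + t n * (y - x)) \<le> (1 - t n) * f x + t n * f y" for n
    proof -
      have "f ((1 - t n) * x + t n * y) < (1 - t n) * f x + t n * f y"
        using sconv x y False t[of n] unfolding strictly_convex_on_def by auto
      moreover have "(1 - t n) * x + t n * y = x + t n * (y - x)" by (simp add: algebra_simps)
      ultimately show ?thesis by simp
    qed
    have lim: "((\<lambda>z. (f z - f x) / (z - x)) \<longlongrightarrow> g x) (at x within {0..})"
      using f_deriv[OF x] by (simp add: has_field_derivative_iff)
    have pos: "0 \<le> x + t n * (y - x)" for n
    proof -
      have "0 \<le> (1 - t n) * x + t n * y" using x y t[of n] by (intro add_nonneg_nonneg mult_nonneg_nonneg) auto
      then show ?thesis by (simp add: algebra_simps)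
    qed
    have "(\<lambda>n. x + t n * (y - x)) \<longlonglongrightarrow> x + 0 * (y - x)" by (intro tendsto_intros t0)
    then have "filterlim (\<lambda>n. x + t n * (y - x)) (at x within {0..}) sequentially"
      unfolding filterlim_at using pos t False by (auto intro!: always_eventually simp: less_imp_neq[symmetric])
    from filterlim_compose[OF lim this]
    have "(\<lambda>n. (f (x + t n * (y - x)) - f x) / (t n * (y - x))) \<longlonglongrightarrow> g x" by simp
    then have "(\<lambda>n. (f (x + t n * (y - x)) - f x) / (t n * (y - x)) * (y - x)) \<longlonglongrightarrow> g x * (y - x)"
      by (intro tendsto_intros)
    moreover have "(f (x + t n * (y - x)) - f x) / (t n * (y - x)) * (y - x) \<le> f y - f x" for n
    proof -
      have "(f (x + t n * (y - x)) - f x) / (t n * (y - x)) * (y - x) = (f (x + t n * (y - x)) - f x) / t n"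
        using False by simp
      also have "\<dots> \<le> f y - f x" using conv[of n] t[of n] by (simp add: field_simps)
      finally show ?thesis .
    qed
    ultimately show ?thesis by (intro LIMSEQ_le_const2) auto
  qed simp
qed

lemma g_strict_mono: assumes "0 \<le> x" "x < y" shows "g x < g y"
proof -
  define m where "m = (x + y) / 2"
  have m: "x < m" "m < y" "m - x = (y - x) / 2" "y - m = (y - x) / 2" by (use assms in \<open>auto simp: m_def field_simps\<close>)
  have "f ((1 - 1/2) *\<^sub>R x + (1/2) *\<^sub>R y) < (1 - 1/2) * f x + 1/2 * f y"
    using sconv[unfolded strictly_convex_on_def, THEN conjunct2, rule_format, of x y "1/2"] assms by auto
  then have "f m < (f x + f y) / 2" by (simp add: m_def field_simps)
  moreover have "g x * (m - x) \<le> f m - f x" using assms m by (intro tangent_below) auto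
  moreover have "g y * (m - y) \<le> f m - f y" using assms m by (intro tangent_below) auto
  moreover have "m - y = - ((y - x) / 2)" using m(4) by linarith
  ultimately have "g x * ((y - x) / 2) < g y * ((y - x) / 2)"
    unfolding m(3) by simp
  then show ?thesis using assms by simp
qed

lemma g_mono: "0 \<le> x \<Longrightarrow> x \<le> y \<Longrightarrow> g x \<le> g y"
  using g_strict_mono by (metis order_le_less)

lemma g_pos: "0 < x \<Longrightarrow> 0 < g x" using g_strict_mono[of 0 x] d0 by simp

lemma g_nonneg: "0 \<le> x \<Longrightarrow> 0 \<le> g x" using g_mono[of 0 x] d0 by simp

text \<open>The gradient of \<open>q \<mapsto> f (|q|)\<close>. The value at zero makes it continuous because \<open>f'\<close> vanishes there; this
is why the flux can be set to zero where \<open>\<nabla>u\<close> vanishes.\<close>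
definition B :: "real ^ 'n \<Rightarrow> real ^ 'n" where
  "B q = (if q = 0 then 0 else (g (norm q) / norm q) *\<^sub>R q)"

lemma flux_eq: "flux f u i x = B (grad u x) $ i"
  by (simp add: flux_def B_def)

lemma norm_B: "norm (B q) = g (norm q)"
  using g_nonneg[of "norm q"] d0 by (simp add: B_def)

lemma B_cont: "continuous_on UNIV (B :: real ^ 'n \<Rightarrow> real ^ 'n)"
proof -
  have gn: "continuous_on UNIV (\<lambda>q :: real ^ 'n. g (norm q))"
    by (rule continuous_on_compose2[OF g_cont]) (auto intro!: continuous_intros)
  have "isCont B q" for q :: "real ^ 'n"
  proof (cases "q = 0")
    case True
    have "((\<lambda>q :: real ^ 'n. g (norm q)) \<longlongrightarrow> g (norm (0 :: real ^ 'n))) (at 0)"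
      using gn unfolding continuous_on_eq_continuous_at[OF open_UNIV] isCont_def by blast
    then have "((\<lambda>q :: real ^ 'n. norm (B q)) \<longlongrightarrow> 0) (at 0)" by (simp add: norm_B d0)
    then have "(B \<longlongrightarrow> (0 :: real ^ 'n)) (at 0)" by (rule tendsto_norm_zero_cancel)
    then show ?thesis using True by (simp add: isCont_def B_def)
  next
    case False
    have "isCont (\<lambda>q. (g (norm q) / norm q) *\<^sub>R q) q"
      using gn False by (intro continuous_intros) (auto simp: continuous_on_eq_continuous_at)
    moreover have "\<forall>\<^sub>F x in nhds q. (g (norm x) / norm x) *\<^sub>R x = B x"
      using t1_space_nhds[OF False] by eventually_elim (simp add: B_def)
    then have "isCont (\<lambda>q. (g (norm q) / norm q) *\<^sub>R q) q \<longleftrightarrow> isCont B q" by (rule isCont_cong)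
    ultimately show ?thesis by simp
  qed
  then show ?thesis by (simp add: continuous_on_eq_continuous_at)
qed

text \<open>By Cauchy--Schwarz the product is at least \<open>(|p| - |q|) (f' |p| - f' |q|)\<close>, which is positive unless
the norms agree. If they agree, Cauchy--Schwarz is strict for \<open>p \<noteq> q\<close>.\<close>
lemma B_strict_mono:
  fixes p q :: "real ^ 'n"
  assumes "p \<noteq> q" shows "(p - q) \<bullet> (B p - B q) > 0"
proof -
  define a b where "a = norm p" and "b = norm q"
  have ab: "a \<ge> 0" "b \<ge> 0" by (auto simp: a_def b_def)
  have pp: "p \<bullet> B p = a * g a" and qq: "q \<bullet> B q = b * g b"
    by (auto simp: B_def a_def b_def dot_square_norm power2_eq_square)
  have pq: "p \<bullet> B q \<le> a * g b"
    using norm_cauchy_schwarz[of p "B q"] by (simp add: norm_B a_def b_def)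
  have qp: "q \<bullet> B p \<le> b * g a"
    using norm_cauchy_schwarz[of q "B p"] by (simp add: norm_B a_def b_def)
  have expand: "(p - q) \<bullet> (B p - B q) = a * g a + b * g b - p \<bullet> B q - q \<bullet> B p"
    by (simp add: inner_diff_left inner_diff_right pp qq)
  show ?thesis
  proof (cases "a = b")
    case False
    then have "(a - b) * (g a - g b) > 0"
      using g_strict_mono[of a b] g_strict_mono[of b a] ab by (auto simp: zero_less_mult_iff neq_iff)
    then show ?thesis unfolding expand using pq qp by (simp add: algebra_simps)
  next
    case True
    have a0: "a > 0" using assms ab True by (cases "a = 0") (auto simp: a_def b_def)
    have b0: "b > 0" using a0 unfolding True .
    have q0: "q \<noteq> 0" using b0 by (auto simp: b_def)
    have "(p - q) \<bullet> (p - q) > 0" using assms by simp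
    moreover have "(p - q) \<bullet> (p - q) = a * a + b * b - 2 * (p \<bullet> q)"
      unfolding a_def b_def inner_diff_left inner_diff_right power2_eq_square[symmetric] power2_norm_eq_inner
      by (simp add: inner_commute)
    ultimately have "p \<bullet> q < b * b" unfolding True by linarith
    then have "g b / b * (p \<bullet> q) < g b / b * (b * b)"
      by (rule mult_strict_left_mono) (use b0 g_pos[of b] in simp)
    moreover have "p \<bullet> B q = g b / b * (p \<bullet> q)" using q0 by (simp add: B_def b_def)
    moreover have "g b / b * (b * b) = b * g b" using b0 by simp
    ultimately have "p \<bullet> B q < b * g b" by linarith
    then show ?thesis unfolding expand using qp unfolding True by simp
  qed
qed

lemma B_mono: "(p - q) \<bullet> (B p - B q) \<ge> 0"
  using B_strict_mono[of p q] by (cases "p = q") auto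

lemma B_grad_measurable:
  fixes u :: "real ^ 2 \<Rightarrow> real"
  assumes "C-lipschitz_on UNIV u"
  shows "(\<lambda>x. B (grad u x)) \<in> borel_measurable lebesgue"
proof (rule measurable_compose[OF grad_measurable[OF assms]])
  show "B \<in> borel_measurable borel" by (rule borel_measurable_continuous_onI[OF B_cont])
qed

lemma B_component_measurable:
  fixes u :: "real ^ 2 \<Rightarrow> real"
  assumes "C-lipschitz_on UNIV u"
  shows "(\<lambda>x. B (grad u x) $ i) \<in> borel_measurable lebesgue"
proof -
  have "(\<lambda>x. axis i 1 \<bullet> B (grad u x)) \<in> borel_measurable lebesgue"
    by (rule borel_measurable_inner[OF borel_measurable_const B_grad_measurable[OF assms]])
  then show ?thesis by (simp only: inner_axis' mult_1 real_inner_1_left)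
qed

lemma B_grad_bound:
  assumes "C-lipschitz_on S u" "open S" "x \<in> S" shows "norm (B (grad u x)) \<le> g C"
proof -
  have "norm (grad u x) \<le> C" by (rule norm_grad_le[OF assms])
  then have "g (norm (grad u x)) \<le> g C" by (rule g_mono[OF norm_ge_zero])
  then show ?thesis by (simp only: norm_B)
qed

end

section \<open>Gradients on level sets\<close>

lemma grad_zero_at_min:
  fixes \<eta> :: "real ^ 'n \<Rightarrow> real"
  assumes "\<eta> x = 0" "\<And>y. \<eta> y \<ge> 0"
  shows "grad \<eta> x = 0"
proof (cases "\<eta> differentiable (at x)")
  case True
  define D where "D = grad \<eta> x"
  have "DERIV (\<lambda>t. \<eta> (x + t *\<^sub>R D)) 0 :> D \<bullet> D"
    unfolding D_def by (rule GDERIV_direction[OF GDERIV_grad[OF True]])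
  then have "D \<bullet> D = 0"
    by (rule DERIV_local_min[where d=1]) (use assms in auto)
  then show ?thesis by (simp add: D_def)
qed (rule grad_eq_0_if_not_differentiable)

lemma lipschitz_pos_part:
  fixes w :: "'a::metric_space \<Rightarrow> real"
  assumes "C-lipschitz_on S w" shows "C-lipschitz_on S (\<lambda>x. max 0 (w x))"
  using assms unfolding lipschitz_on_def dist_real_def by (smt (verit, best))

lemma GDERIV_cmult: "GDERIV f x :> a \<Longrightarrow> GDERIV (\<lambda>x. c * f x) x :> c *\<^sub>R a"
  by (auto simp: gderiv_def intro!: derivative_eq_intros)

text \<open>At a zero of \<open>\<eta>\<close> the positive and the negative part both attain their minimum, and almost everywhere both are
differentiable.\<close>
lemma AE_grad_zero_on_zero_set:
  fixes \<eta> :: "real ^ 2 \<Rightarrow> real"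
  assumes lip: "C-lipschitz_on UNIV \<eta>"
  shows "AE x in lebesgue. \<eta> x = 0 \<longrightarrow> grad \<eta> x = 0"
proof -
  have m: "C-lipschitz_on UNIV (\<lambda>x. - \<eta> x)" using lip by simp
  show ?thesis
    using lipschitz_ae_differentiable[OF lipschitz_pos_part[OF lip]] lipschitz_ae_differentiable[OF lipschitz_pos_part[OF m]]
  proof eventually_elim
    case (elim x)
    show ?case
    proof
      assume z: "\<eta> x = 0"
      have "grad (\<lambda>x. max 0 (\<eta> x)) x = 0" "grad (\<lambda>x. max 0 (- \<eta> x)) x = 0"
        using z by (auto intro!: grad_zero_at_min)
      with GDERIV_diff[OF elim] have "GDERIV (\<lambda>x. max 0 (\<eta> x) - max 0 (- \<eta> x)) x :> 0" by simp
      moreover have "(\<lambda>x. max 0 (\<eta> x) - max 0 (- \<eta> x)) = \<eta>" by auto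
      ultimately show "grad \<eta> x = 0" by (simp add: grad_eqI)
    qed
  qed
qed

lemma integral_grad_eq_0:
  fixes \<eta> :: "real ^ 2 \<Rightarrow> real"
  assumes \<eta>: "D-lipschitz_on UNIV \<eta>" "bounded {x. \<eta> x \<noteq> 0}"
  shows "(LINT x|lebesgue. grad \<eta> x $ i) = 0"
proof -
  have c: "0-lipschitz_on UNIV (\<lambda>x::real^2. 1::real)" by (rule lipschitz_on_constant)
  have "grad (\<lambda>x::real^2. 1::real) x = 0" for x by (rule grad_eqI) (simp add: gderiv_def)
  with integration_by_parts[OF c \<eta>, of i] show ?thesis by simp
qed

section \<open>Rotation and the bounded slope condition\<close>

definition rot :: "real ^ 2 \<Rightarrow> real ^ 2" where
  "rot q = vector [- (q $ 2), q $ 1]"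

lemma rot_nth [simp]: "rot q $ 1 = - (q $ 2)" "rot q $ 2 = q $ 1"
  by (simp_all add: rot_def)

lemma norm_rot [simp]: "norm (rot q) = norm q"
  by (simp add: norm_vec_def L2_set_def sum_2)

text \<open>An open set that is not convex has a frontier point \<open>x0\<close> on a segment with both ends in the set. If
\<open>L\<^sup>+\<close> and \<open>L\<^sup>-\<close> have different slopes there, \<open>x0\<close> minimises the linear function with slope \<open>m\<close>, the difference of
the slopes, over the frontier. Rays in direction \<open>- m\<close> leave the bounded set through the frontier, so this linear
function is strictly larger inside the set than at \<open>x0\<close>, hence also along the segment: a contradiction.\<close>
lemma bounded_slope_affine_or_convex:
  fixes \<Omega> :: "(real ^ 'n) set"
  assumes \<Omega>: "open \<Omega>" "bounded \<Omega>" and bsc: "bounded_slope_condition \<Omega> \<psi> Q"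
  shows "(\<exists>p c. \<forall>x\<in>frontier \<Omega>. \<psi> x = p \<bullet> x + c) \<or> convex \<Omega>"
proof (rule disjCI)
  assume nc: "\<not> convex \<Omega>"
  then obtain a b where ab: "a \<in> \<Omega>" "b \<in> \<Omega>" "\<not> closed_segment a b \<subseteq> \<Omega>"
    by (auto simp: convex_contains_segment)
  then obtain z where z: "z \<in> closed_segment a b" "z \<notin> \<Omega>" by blast
  have "closed_segment a z \<inter> frontier \<Omega> \<noteq> {}"
    by (rule connected_Int_frontier) (use ab z in auto)
  then obtain x0 where x0: "x0 \<in> closed_segment a z" "x0 \<in> frontier \<Omega>" by blast
  have "closed_segment a z \<subseteq> closed_segment a b" using z(1) by (simp add: subset_closed_segment)
  then have x0ab: "x0 \<in> closed_segment a b" using x0 by blast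
  obtain Lp Lm where L: "affine_function Lp" "affine_function Lm"
     "\<And>x. x\<in>frontier \<Omega> \<Longrightarrow> Lm x \<le> \<psi> x \<and> \<psi> x \<le> Lp x" "Lm x0 = \<psi> x0" "Lp x0 = \<psi> x0"
    using bsc x0(2) unfolding bounded_slope_condition_def by metis
  obtain p c where p: "\<And>x. Lp x = p \<bullet> x + c" using L(1) by (auto simp: affine_function_def)
  obtain q d where q: "\<And>x. Lm x = q \<bullet> x + d" using L(2) by (auto simp: affine_function_def)
  show "\<exists>p c. \<forall>x\<in>frontier \<Omega>. \<psi> x = p \<bullet> x + c"
  proof (cases "p = q")
    case True
    then have "c = d" using L(4,5) p q by simp
    then show ?thesis using L(3) p q True by (metis order_antisym)
  next
    case False
    define m where "m = p - q"
    have m0: "m \<noteq> 0" using False by (simp add: m_def)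
    have fr: "m \<bullet> x0 \<le> m \<bullet> x" if "x \<in> frontier \<Omega>" for x
      using L(3)[OF that] L(4,5) p q by (simp add: m_def inner_diff_left)
    have inner: "m \<bullet> x0 < m \<bullet> x" if x: "x \<in> \<Omega>" for x
    proof -
      obtain R where R: "\<And>y. y \<in> \<Omega> \<Longrightarrow> norm y \<le> R" using \<Omega>(2) by (auto simp: bounded_iff)
      \<comment> \<open>So large that \<open>x - t *\<^sub>R m\<close> lies outside the ball of radius \<open>R\<close>, hence outside \<open>\<Omega>\<close>.\<close>
      define t where "t = (\<bar>R\<bar> + norm x + 1) / norm m"
      have t: "t > 0" using m0 by (simp add: t_def add_nonneg_pos)
      have "norm (x - t *\<^sub>R m) \<ge> norm (t *\<^sub>R m) - norm x" by (metis norm_minus_commute norm_triangle_ineq2)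
      also have "norm (t *\<^sub>R m) = \<bar>R\<bar> + norm x + 1" using t m0 by (simp add: t_def)
      finally have "norm (x - t *\<^sub>R m) > R" by simp
      then have out: "x - t *\<^sub>R m \<notin> \<Omega>" using R by (meson not_le)
      have "closed_segment x (x - t *\<^sub>R m) \<inter> frontier \<Omega> \<noteq> {}"
        by (rule connected_Int_frontier) (use x out in auto)
      then obtain y where y: "y \<in> closed_segment x (x - t *\<^sub>R m)" "y \<in> frontier \<Omega>" by blast
      obtain s where s: "0 \<le> s" "y = (1 - s) *\<^sub>R x + s *\<^sub>R (x - t *\<^sub>R m)" using y(1) by (auto simp: closed_segment_def)
      have yx: "y = x - (s * t) *\<^sub>R m" using s(2) by (simp add: algebra_simps)
      have "y \<noteq> x" using y(2) x \<Omega>(1) by (auto simp: frontier_def interior_open)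
      then have "s * t \<noteq> 0" using yx by auto
      then have "s * t > 0" using s(1) t by (metis less_eq_real_def mult_nonneg_nonneg)
      then have "m \<bullet> y < m \<bullet> x" using m0 unfolding yx by (simp add: inner_diff_right)
      then show ?thesis using fr[OF y(2)] by simp
    qed
    obtain s where s: "0 \<le> s" "s \<le> 1" "x0 = (1 - s) *\<^sub>R a + s *\<^sub>R b" using x0ab by (auto simp: closed_segment_def)
    have "m \<bullet> x0 = (1 - s) * (m \<bullet> a) + s * (m \<bullet> b)" using s(3) by (simp add: inner_add_right)
    moreover have "(1 - s) * (m \<bullet> a) + s * (m \<bullet> b) > (1 - s) * (m \<bullet> x0) + s * (m \<bullet> x0)"
    proof (cases "s = 0")
      case True then show ?thesis using inner[OF ab(1)] by simp
    next
      case False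
      then show ?thesis using s inner[OF ab(1)] inner[OF ab(2)]
        by (intro add_le_less_mono mult_left_mono mult_strict_left_mono) auto
    qed
    ultimately show ?thesis by (simp add: algebra_simps)
  qed
qed

section \<open>The Euler--Lagrange equation\<close>

context radial_lagrangean
begin

text \<open>The one-dimensional tangent inequality at \<open>norm b\<close>, combined with Cauchy--Schwarz: \<open>B b\<close> is the slope
of the tangent plane at \<open>b\<close>.\<close>
lemma energy_tangent: "B b \<bullet> (a - b) \<le> f (norm a) - f (norm b)"
proof -
  have "B b \<bullet> a \<le> g (norm b) * norm a" using norm_cauchy_schwarz[of "B b" a] by (simp add: norm_B)
  moreover have "B b \<bullet> b = g (norm b) * norm b" by (auto simp: B_def dot_square_norm power2_eq_square)
  moreover have "g (norm b) * (norm a - norm b) \<le> f (norm a) - f (norm b)" by (rule tangent_below) auto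
  ultimately show ?thesis by (simp add: inner_diff_right right_diff_distrib)
qed

lemma f_continuous: "continuous_on {0..} f"
  using C1 by (simp add: C1_halfline_def differentiable_imp_continuous_on)

lemma energy_density_integrable:
  fixes w :: "real ^ 2 \<Rightarrow> real"
  assumes \<Omega>: "open \<Omega>" "bounded \<Omega>" and w: "C-lipschitz_on UNIV w"
  shows "integrable lebesgue (\<lambda>x. indicator \<Omega> x * f (norm (grad w x)))"
proof -
  have fn: "continuous_on UNIV (\<lambda>q :: real ^ 2. f (norm q))"
    by (rule continuous_on_compose2[OF f_continuous]) (auto intro!: continuous_intros)
  have meas: "(\<lambda>x. f (norm (grad w x))) \<in> borel_measurable lebesgue"
    by (rule measurable_compose[OF grad_measurable[OF w] borel_measurable_continuous_onI[OF fn]])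
  have "compact (f ` {0..C})" using f_continuous by (intro compact_continuous_image) (auto intro: continuous_on_subset)
  then obtain K where K: "\<And>t. t \<in> {0..C} \<Longrightarrow> \<bar>f t\<bar> \<le> K"
    using compact_imp_bounded[of "f ` {0..C}"] unfolding bounded_iff by (metis image_eqI real_norm_def)
  show ?thesis
  proof (rule integrable_bounded_support[where B=\<Omega> and K=K])
    show "AE x in lebesgue. \<bar>indicator \<Omega> x * f (norm (grad w x))\<bar> \<le> K * indicator \<Omega> x"
      using K norm_grad_le[OF w open_UNIV UNIV_I] by (intro AE_I2) (auto simp: indicator_def)
    show "(\<lambda>x. indicator \<Omega> x * f (norm (grad w x))) \<in> borel_measurable lebesgue"
      by (intro borel_measurable_times open_indicator_measurable \<Omega> meas)
  qed (use \<Omega> in \<open>auto simp: borel_open\<close>)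
qed

text \<open>For \<open>w = u + t \<eta>\<close> minimality and the tangent plane of the energy density at the gradient of \<open>w\<close>
give \<open>0 \<le> E w - E u \<le> t \<integral> B (\<nabla>w) \<bullet> \<nabla>\<eta>\<close>. After division by \<open>t\<close> the limit uses
only the continuity of \<open>B\<close>, and the energy is never differentiated.\<close>
lemma euler_lagrange_ineq:
  fixes u U \<eta> :: "real ^ 2 \<Rightarrow> real"
  assumes \<Omega>: "open \<Omega>" "bounded \<Omega>" and min: "is_minimizer \<Omega> \<psi> f u"
    and U: "C-lipschitz_on UNIV U" "\<And>x. x \<in> closure \<Omega> \<Longrightarrow> U x = u x"
    and \<eta>: "D-lipschitz_on UNIV \<eta>" "\<And>x. x \<in> frontier \<Omega> \<Longrightarrow> \<eta> x = 0"
  shows "0 \<le> (LINT x|lebesgue. indicator \<Omega> x * (B (grad U x) \<bullet> grad \<eta> x))"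
proof -
  define t where "t n = 1 / real (Suc n)" for n
  have t: "0 < t n" "t n \<le> 1" for n by (auto simp: t_def)
  define W where "W n x = U x + t n * \<eta> x" for n x
  have C0: "C \<ge> 0" "D \<ge> 0" using lipschitz_on_nonneg[OF U(1)] lipschitz_on_nonneg[OF \<eta>(1)] by auto
  have lipW: "(C + t n * D)-lipschitz_on UNIV (W n)" for n
    unfolding W_def using t[of n] by (intro lipschitz_on_add U lipschitz_on_cmult_real_nonneg \<eta>) auto
  have gradW: "AE x in lebesgue. grad (W n) x = grad U x + t n *\<^sub>R grad \<eta> x" for n
    using lipschitz_ae_differentiable[OF U(1)] lipschitz_ae_differentiable[OF \<eta>(1)]
    by eventually_elim (auto simp: W_def[abs_def] intro!: grad_eqI GDERIV_add GDERIV_cmult)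
  have ueq: "energy \<Omega> f u = (LINT x|lebesgue. indicator \<Omega> x * f (norm (grad U x)))"
  proof -
    have "grad u x = grad U x" if "x \<in> \<Omega>" for x
      using U(2) closure_subset[of \<Omega>] by (intro grad_cong_open[OF \<Omega>(1) that]) auto
    then show ?thesis unfolding energy_def set_lebesgue_integral_def
      by (intro Bochner_Integration.integral_cong) (auto simp: indicator_def)
  qed
  have Weq: "energy \<Omega> f (W n) = (LINT x|lebesgue. indicator \<Omega> x * f (norm (grad (W n) x)))" for n
    unfolding energy_def set_lebesgue_integral_def by simp
  have frcl: "frontier \<Omega> \<subseteq> closure \<Omega>" by (auto simp: frontier_def)
  have le: "energy \<Omega> f u \<le> energy \<Omega> f (W n)" for n
  proof -
    have "Lip (closure \<Omega>) (W n)" unfolding Lip_def using lipschitz_on_subset[OF lipW subset_UNIV] by blast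
    moreover have "\<forall>x\<in>frontier \<Omega>. W n x = \<psi> x"
      using min U(2) \<eta>(2) frcl by (auto simp: W_def is_minimizer_def is_arg_min_def)
    ultimately show ?thesis using min by (auto simp: is_minimizer_def is_arg_min_def not_less)
  qed
  have Bm: "(\<lambda>x. B (grad (W n) x)) \<in> borel_measurable lebesgue" for n by (rule B_grad_measurable[OF lipW])
  have ind: "(indicator \<Omega> :: _ \<Rightarrow> real) \<in> borel_measurable lebesgue" by (rule open_indicator_measurable[OF \<Omega>(1)])
  have \<Omega>s: "\<Omega> \<in> sets lebesgue" using \<Omega> by (simp add: borel_open)
  have meas: "(\<lambda>x. indicator \<Omega> x * (B (grad (W n) x) \<bullet> grad \<eta> x)) \<in> borel_measurable lebesgue" for n
    by (intro borel_measurable_times ind borel_measurable_inner Bm grad_measurable[OF \<eta>(1)])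
  have bd: "AE x in lebesgue. \<bar>indicator \<Omega> x * (B (grad (W n) x) \<bullet> grad \<eta> x)\<bar> \<le> (g (C + D) * D) * indicator \<Omega> x" for n
  proof (intro AE_I2)
    fix x
    have "norm (B (grad (W n) x)) \<le> g (C + t n * D)" by (rule B_grad_bound[OF lipW]) auto
    also have "\<dots> \<le> g (C + D)" using t[of n] C0 by (intro g_mono) (auto intro!: add_nonneg_nonneg mult_left_le_one_le)
    finally have "\<bar>B (grad (W n) x) \<bullet> grad \<eta> x\<bar> \<le> g (C + D) * D"
      using Cauchy_Schwarz_ineq2[of "B (grad (W n) x)" "grad \<eta> x"] norm_grad_le[OF \<eta>(1) open_UNIV UNIV_I, of x]
      by (smt (verit) mult_mono norm_ge_zero)
    then show "\<bar>indicator \<Omega> x * (B (grad (W n) x) \<bullet> grad \<eta> x)\<bar> \<le> (g (C + D) * D) * indicator \<Omega> x"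
      by (auto simp: indicator_def)
  qed
  have nonneg: "0 \<le> (LINT x|lebesgue. indicator \<Omega> x * (B (grad (W n) x) \<bullet> grad \<eta> x))" for n
  proof -
    note i1 = energy_density_integrable[OF \<Omega> lipW, of n] and i2 = energy_density_integrable[OF \<Omega> U(1)]
    have i3: "integrable lebesgue (\<lambda>x. indicator \<Omega> x * (B (grad (W n) x) \<bullet> grad \<eta> x))"
      by (rule integrable_bounded_support[OF meas bd \<Omega>(2) \<Omega>s])
    have "0 \<le> (LINT x|lebesgue. indicator \<Omega> x * f (norm (grad (W n) x)) - indicator \<Omega> x * f (norm (grad U x)))"
      using le[of n] unfolding ueq Weq by (simp add: Bochner_Integration.integral_diff[OF i1 i2])
    also have "\<dots> \<le> (LINT x|lebesgue. t n * (indicator \<Omega> x * (B (grad (W n) x) \<bullet> grad \<eta> x)))"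
    proof (rule integral_mono_AE)
      show "AE x in lebesgue. indicator \<Omega> x * f (norm (grad (W n) x)) - indicator \<Omega> x * f (norm (grad U x))
          \<le> t n * (indicator \<Omega> x * (B (grad (W n) x) \<bullet> grad \<eta> x))"
        using gradW[of n]
      proof eventually_elim
        case (elim x)
        have "grad U x - grad (W n) x = - t n *\<^sub>R grad \<eta> x" using elim by simp
        then have "f (norm (grad (W n) x)) - f (norm (grad U x)) \<le> t n * (B (grad (W n) x) \<bullet> grad \<eta> x)"
          using energy_tangent[of "grad (W n) x" "grad U x"] by simp
        then show ?case by (auto simp: indicator_def)
      qed
    qed (intro Bochner_Integration.integrable_diff integrable_mult_right i1 i2 i3)+
    also have "\<dots> = t n * (LINT x|lebesgue. indicator \<Omega> x * (B (grad (W n) x) \<bullet> grad \<eta> x))" by simp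
    finally show ?thesis using t[of n] by (simp add: zero_le_mult_iff)
  qed
  have "(\<lambda>n. LINT x|lebesgue. indicator \<Omega> x * (B (grad (W n) x) \<bullet> grad \<eta> x)) \<longlonglongrightarrow> (LINT x|lebesgue. indicator \<Omega> x * (B (grad U x) \<bullet> grad \<eta> x))"
  proof (rule dominated_convergence_bounded_support[OF meas _ _ bd \<Omega>(2) \<Omega>s])
    show "(\<lambda>x. indicator \<Omega> x * (B (grad U x) \<bullet> grad \<eta> x)) \<in> borel_measurable lebesgue"
      by (intro borel_measurable_times ind borel_measurable_inner B_grad_measurable[OF U(1)] grad_measurable[OF \<eta>(1)])
    have "AE x in lebesgue. \<forall>n. grad (W n) x = grad U x + t n *\<^sub>R grad \<eta> x"
      using gradW by (simp add: AE_all_countable)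
    then show "AE x in lebesgue. (\<lambda>n. indicator \<Omega> x * (B (grad (W n) x) \<bullet> grad \<eta> x)) \<longlonglongrightarrow> indicator \<Omega> x * (B (grad U x) \<bullet> grad \<eta> x)"
    proof eventually_elim
      case (elim x)
      have "(\<lambda>n. grad U x + t n *\<^sub>R grad \<eta> x) \<longlonglongrightarrow> grad U x + 0 *\<^sub>R grad \<eta> x"
        unfolding t_def by (intro tendsto_intros step_tendsto_0)
      then have "(\<lambda>n. grad (W n) x) \<longlonglongrightarrow> grad U x" by (simp add: elim)
      moreover have "isCont B (grad U x)" using B_cont continuous_on_eq_continuous_at[OF open_UNIV] by blast
      ultimately have "(\<lambda>n. B (grad (W n) x)) \<longlonglongrightarrow> B (grad U x)" by (rule isCont_tendsto_compose[rotated])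
      then show ?case by (intro tendsto_intros)
    qed
  qed
  then show ?thesis by (rule LIMSEQ_le_const) (use nonneg in auto)
qed

lemma euler_lagrange:
  fixes u U \<eta> :: "real ^ 2 \<Rightarrow> real"
  assumes \<Omega>: "open \<Omega>" "bounded \<Omega>" and min: "is_minimizer \<Omega> \<psi> f u"
    and U: "C-lipschitz_on UNIV U" "\<And>x. x \<in> closure \<Omega> \<Longrightarrow> U x = u x"
    and \<eta>: "D-lipschitz_on UNIV \<eta>" "\<And>x. x \<in> frontier \<Omega> \<Longrightarrow> \<eta> x = 0"
  shows "(LINT x|lebesgue. indicator \<Omega> x * (B (grad U x) \<bullet> grad \<eta> x)) = 0"
proof (rule antisym)
  have m: "D-lipschitz_on UNIV (\<lambda>x. - \<eta> x)" using \<eta>(1) by simp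
  have gm: "grad (\<lambda>x. - \<eta> x) x = - grad \<eta> x" if "GDERIV \<eta> x :> grad \<eta> x" for x
    using GDERIV_cmult[OF that, of "-1"] by (intro grad_eqI) simp
  have "0 \<le> (LINT x|lebesgue. indicator \<Omega> x * (B (grad U x) \<bullet> grad (\<lambda>x. - \<eta> x) x))"
    by (rule euler_lagrange_ineq[OF \<Omega> min U m]) (use \<eta>(2) in auto)
  also have "\<dots> = (LINT x|lebesgue. - (indicator \<Omega> x * (B (grad U x) \<bullet> grad \<eta> x)))"
  proof (rule integral_cong_AE)
    show "AE x in lebesgue. indicator \<Omega> x * (B (grad U x) \<bullet> grad (\<lambda>x. - \<eta> x) x) = - (indicator \<Omega> x * (B (grad U x) \<bullet> grad \<eta> x))"
      using lipschitz_ae_differentiable[OF \<eta>(1)] by eventually_elim (simp add: gm)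
  qed (intro borel_measurable_uminus borel_measurable_times open_indicator_measurable[OF \<Omega>(1)] borel_measurable_inner
       B_grad_measurable[OF U(1)] grad_measurable[OF \<eta>(1)] grad_measurable[OF m])+
  finally show "(LINT x|lebesgue. indicator \<Omega> x * (B (grad U x) \<bullet> grad \<eta> x)) \<le> 0" by simp
  show "0 \<le> (LINT x|lebesgue. indicator \<Omega> x * (B (grad U x) \<bullet> grad \<eta> x))"
    by (rule euler_lagrange_ineq[OF \<Omega> min U \<eta>])
qed

text \<open>The difference \<open>\<eta>\<close> of \<open>u\<close> and the affine function vanishes on the frontier, so it is an admissible test
function. The constant field \<open>B p\<close> is also orthogonal to \<open>\<nabla>\<eta>\<close> in the mean. Hence
\<open>\<integral> (B (\<nabla>u) - B p) \<bullet> (\<nabla>u - p) = 0\<close>, and strict monotonicity gives \<open>\<nabla>u = p\<close>.\<close>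
lemma affine_boundary_grad_constant:
  fixes u U :: "real ^ 2 \<Rightarrow> real"
  assumes \<Omega>: "open \<Omega>" "bounded \<Omega>" and min: "is_minimizer \<Omega> \<psi> f u"
    and U: "C-lipschitz_on UNIV U" "\<And>x. x \<in> closure \<Omega> \<Longrightarrow> U x = u x"
    and aff: "\<And>x. x \<in> frontier \<Omega> \<Longrightarrow> \<psi> x = p \<bullet> x + c"
  shows "AE x in lebesgue. x \<in> \<Omega> \<longrightarrow> grad U x = p"
proof -
  have GL: "GDERIV (\<lambda>x. p \<bullet> x + c) x :> p" for x :: "real ^ 2"
    by (auto simp: gderiv_def inner_commute intro!: derivative_eq_intros)
  have lipL: "(norm p)-lipschitz_on UNIV (\<lambda>x. p \<bullet> x + c)"
    by (intro lipschitz_onI) (auto simp: dist_real_def dist_norm Cauchy_Schwarz_ineq2 simp flip: inner_diff_right)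
  define w where "w x = U x - (p \<bullet> x + c)" for x
  have lipw: "(C + norm p)-lipschitz_on UNIV w"
    unfolding w_def by (intro lipschitz_on_diff U lipL)
  have frcl: "frontier \<Omega> \<subseteq> closure \<Omega>" by (auto simp: frontier_def)
  have wfr: "w x = 0" if "x \<in> frontier \<Omega>" for x
    using min that aff[OF that] U(2) frcl by (auto simp: w_def is_minimizer_def is_arg_min_def)
  define \<eta> where "\<eta> x = (if x \<in> \<Omega> then w x else 0)" for x
  have lip\<eta>: "(C + norm p)-lipschitz_on UNIV \<eta>"
    unfolding \<eta>_def[abs_def] by (rule lipschitz_extend_by_zero[OF lipschitz_on_subset[OF lipw subset_UNIV] wfr])
  have bnd\<eta>: "bounded {x. \<eta> x \<noteq> 0}" by (rule bounded_subset[OF \<Omega>(2)]) (auto simp: \<eta>_def)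
  have \<eta>fr: "\<eta> x = 0" if "x \<in> frontier \<Omega>" for x using that \<Omega>(1) by (auto simp: \<eta>_def frontier_def interior_open)
  have g\<eta>: "AE x in lebesgue. x \<in> \<Omega> \<longrightarrow> grad \<eta> x = grad U x - p"
    using lipschitz_ae_differentiable[OF U(1)]
  proof eventually_elim
    case (elim x)
    show ?case
    proof
      assume x: "x \<in> \<Omega>"
      have "grad \<eta> x = grad w x" by (rule grad_cong_open[OF \<Omega>(1) x]) (auto simp: \<eta>_def)
      also have "grad w x = grad U x - p" unfolding w_def[abs_def] by (rule grad_eqI[OF GDERIV_diff[OF elim GL]])
      finally show "grad \<eta> x = grad U x - p" .
    qed
  qed
  have ind: "(indicator \<Omega> :: _ \<Rightarrow> real) \<in> borel_measurable lebesgue" by (rule open_indicator_measurable[OF \<Omega>(1)])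
  have \<Omega>s: "\<Omega> \<in> sets lebesgue" using \<Omega> by (simp add: borel_open)
  have gc: "(LINT x|lebesgue. indicator \<Omega> x * (grad \<eta> x $ i)) = 0" for i
  proof -
    have "(LINT x|lebesgue. indicator \<Omega> x * (grad \<eta> x $ i)) = (LINT x|lebesgue. grad \<eta> x $ i)"
    proof (rule integral_cong_AE)
      show "AE x in lebesgue. indicator \<Omega> x * grad \<eta> x $ i = grad \<eta> x $ i"
        using AE_grad_zero_on_zero_set[OF lip\<eta>] by eventually_elim (auto simp: indicator_def \<eta>_def)
    qed (intro borel_measurable_times ind grad_component_measurable[OF lip\<eta>])+
    then show ?thesis by (simp add: integral_grad_eq_0[OF lip\<eta> bnd\<eta>])
  qed
  have K: "norm (grad \<eta> x) \<le> C + norm p" for x by (rule norm_grad_le[OF lip\<eta>]) auto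
  have bB: "norm (B (grad U x)) \<le> g C" for x by (rule B_grad_bound[OF U(1)]) auto
  have igc: "integrable lebesgue (\<lambda>x. indicator \<Omega> x * (grad \<eta> x $ i))" for i
  proof (rule integrable_bounded_support[where B=\<Omega> and K="C + norm p"])
    show "AE x in lebesgue. \<bar>indicator \<Omega> x * grad \<eta> x $ i\<bar> \<le> (C + norm p) * indicator \<Omega> x"
    proof (intro AE_I2)
      fix x show "\<bar>indicator \<Omega> x * grad \<eta> x $ i\<bar> \<le> (C + norm p) * indicator \<Omega> x"
        using K[of x] component_le_norm_cart[of "grad \<eta> x" i] by (auto simp: indicator_def)
    qed
  qed (use \<Omega> \<Omega>s in \<open>auto intro!: borel_measurable_times ind grad_component_measurable[OF lip\<eta>]\<close>)
  have zeroB: "(LINT x|lebesgue. indicator \<Omega> x * (B p \<bullet> grad \<eta> x)) = 0"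
  proof -
    have "(\<lambda>x. indicator \<Omega> x * (B p \<bullet> grad \<eta> x)) = (\<lambda>x. B p $ 1 * (indicator \<Omega> x * (grad \<eta> x $ 1)) + B p $ 2 * (indicator \<Omega> x * (grad \<eta> x $ 2)))"
      by (simp add: inner_vec_def sum_2 algebra_simps)
    then show ?thesis using igc[of 1] igc[of 2] by (simp add: gc)
  qed
  define h where "h x = indicator \<Omega> x * ((B (grad U x) - B p) \<bullet> grad \<eta> x)" for x
  have ib: "integrable lebesgue (\<lambda>x. indicator \<Omega> x * (q x \<bullet> grad \<eta> x))"
    if q: "q \<in> borel_measurable lebesgue" "\<And>x. norm (q x) \<le> L" for q :: "real ^ 2 \<Rightarrow> real ^ 2" and L
  proof (rule integrable_bounded_support[where B=\<Omega> and K="L * (C + norm p)"])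
    show "AE x in lebesgue. \<bar>indicator \<Omega> x * (q x \<bullet> grad \<eta> x)\<bar> \<le> L * (C + norm p) * indicator \<Omega> x"
    proof (intro AE_I2)
      fix x
      have "\<bar>q x \<bullet> grad \<eta> x\<bar> \<le> norm (q x) * norm (grad \<eta> x)" by (rule Cauchy_Schwarz_ineq2)
      also have "\<dots> \<le> L * (C + norm p)" by (intro mult_mono q(2) K norm_ge_zero order_trans[OF norm_ge_zero q(2)[of x]])
      finally show "\<bar>indicator \<Omega> x * (q x \<bullet> grad \<eta> x)\<bar> \<le> L * (C + norm p) * indicator \<Omega> x" by (auto simp: indicator_def)
    qed
  qed (use \<Omega> \<Omega>s in \<open>auto intro!: borel_measurable_times ind borel_measurable_inner q grad_measurable[OF lip\<eta>]\<close>)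
  have i1: "integrable lebesgue (\<lambda>x. indicator \<Omega> x * (B (grad U x) \<bullet> grad \<eta> x))"
    by (rule ib[OF B_grad_measurable[OF U(1)] bB])
  have i2: "integrable lebesgue (\<lambda>x. indicator \<Omega> x * (B p \<bullet> grad \<eta> x))"
    by (rule ib[of _ "norm (B p)"]) auto
  have "(\<lambda>x. h x) = (\<lambda>x. indicator \<Omega> x * (B (grad U x) \<bullet> grad \<eta> x) - indicator \<Omega> x * (B p \<bullet> grad \<eta> x))"
    by (simp add: h_def inner_diff_left algebra_simps)
  then have hint: "integrable lebesgue h" and h0: "(LINT x|lebesgue. h x) = 0"
    using i1 i2 zeroB euler_lagrange[OF \<Omega> min U lip\<eta> \<eta>fr] by simp_all
  have hnn: "AE x in lebesgue. 0 \<le> h x"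
    using g\<eta> by eventually_elim (auto simp: h_def indicator_def B_mono inner_commute)
  have "AE x in lebesgue. h x = 0"
    using integral_nonneg_eq_0_iff_AE[OF hint hnn] h0 by simp
  then show ?thesis using g\<eta>
  proof eventually_elim
    case (elim x)
    show ?case
    proof (intro impI, rule ccontr)
      assume x: "x \<in> \<Omega>" "grad U x \<noteq> p"
      then have "(grad U x - p) \<bullet> (B (grad U x) - B p) > 0" by (intro B_strict_mono)
      then show False using elim x by (simp add: h_def inner_commute)
    qed
  qed
qed

end

section \<open>Potentials of smooth curl-free fields\<close>

lemma GDERIV_chain_curve:
  assumes "(\<gamma> has_vector_derivative \<gamma>') (at s within T)" "GDERIV F (\<gamma> s) :> D"
  shows "((\<lambda>s. F (\<gamma> s)) has_real_derivative \<gamma>' \<bullet> D) (at s within T)"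
proof -
  have "((\<lambda>s. F (\<gamma> s)) has_derivative (\<lambda>h. (h *\<^sub>R \<gamma>') \<bullet> D)) (at s within T)"
    using assms unfolding has_vector_derivative_def gderiv_def by (rule has_derivative_compose)
  then show ?thesis by (simp add: has_field_derivative_def mult_commute_abs)
qed

lemma inner_2: "p \<bullet> q = p $ 1 * q $ 1 + p $ 2 * q $ 2" for p q :: "real ^ 2"
  by (simp add: inner_vec_def sum_2)

text \<open>The potential is the integral of \<open>F\<close> along the segment from \<open>a\<close>. Differentiation under the integral
along a second segment and the symmetry of the Jacobian turn the integrand into the \<open>t\<close>-derivative of
\<open>t (F (a + t (z - a)) \<bullet> d)\<close>. The conclusion is stated in mean value form, from which both the Lipschitz bound
and the gradient at interior points follow.\<close>
lemma poincare_convex: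
  fixes F :: "real ^ 2 \<Rightarrow> real ^ 2" and H :: "2 \<Rightarrow> real ^ 2 \<Rightarrow> real ^ 2"
  assumes S: "convex S" "a \<in> S"
    and GD: "\<And>i x. GDERIV (\<lambda>x. F x $ i) x :> H i x"
    and contH: "\<And>i. continuous_on UNIV (H i)"
    and sym: "\<And>x. x \<in> S \<Longrightarrow> H 1 x $ 2 = H 2 x $ 1"
  obtains w where "\<And>x y. x \<in> S \<Longrightarrow> y \<in> S \<Longrightarrow> \<exists>\<theta>\<in>{0..1}. w y - w x = F (x + \<theta> *\<^sub>R (y - x)) \<bullet> (y - x)"
proof
  define w where "w x = integral {0..1} (\<lambda>t. F (a + t *\<^sub>R (x - a)) \<bullet> (x - a))" for x
  have contFi: "continuous_on UNIV (\<lambda>x. F x $ i)" for i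
    using GD unfolding gderiv_def by (meson has_derivative_continuous continuous_at_imp_continuous_on)
  fix x y assume xy: "x \<in> S" "y \<in> S"
  define d where "d = y - x"
  define z where "z s = x + s *\<^sub>R d" for s
  define p where "p s t = a + t *\<^sub>R (z s - a)" for s t
  have zS: "z s \<in> S" if "s \<in> {0..1}" for s
  proof -
    have "(1 - s) *\<^sub>R x + s *\<^sub>R y \<in> S" using S(1) xy that by (intro convexD) auto
    then show ?thesis by (simp add: z_def d_def algebra_simps)
  qed
  have pS: "p s t \<in> S" if "s \<in> {0..1}" "t \<in> {0..1}" for s t
  proof -
    have "(1 - t) *\<^sub>R a + t *\<^sub>R z s \<in> S" using S zS[OF that(1)] that(2) by (intro convexD) auto
    then show ?thesis by (simp add: p_def algebra_simps)
  qed
  define fs where "fs s t = t * ((d \<bullet> H 1 (p s t)) * (z s - a) $ 1 + (d \<bullet> H 2 (p s t)) * (z s - a) $ 2) + F (p s t) \<bullet> d" for s t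
  have der: "((\<lambda>s. w (z s)) has_real_derivative integral {0..1} (fs s)) (at s within {0..1})" if s: "s \<in> {0..1}" for s
    unfolding w_def box_real(2)[symmetric]
  proof (rule leibniz_rule_field_derivative)
    fix s t :: real
    have zd: "((\<lambda>s. (z s - a) $ i) has_real_derivative d $ i) (at s within cbox 0 1)" for i
      unfolding z_def by (auto intro!: derivative_eq_intros)
    have "((\<lambda>s. p s t) has_vector_derivative t *\<^sub>R d) (at s within cbox 0 1)"
      unfolding p_def z_def by (auto intro!: derivative_eq_intros)
    from GDERIV_chain_curve[OF this GD]
    have Fd: "((\<lambda>s. F (p s t) $ i) has_real_derivative (t *\<^sub>R d) \<bullet> H i (p s t)) (at s within cbox 0 1)" for i .
    have "((\<lambda>s. F (p s t) $ 1 * (z s - a) $ 1 + F (p s t) $ 2 * (z s - a) $ 2) has_real_derivative fs s t) (at s within cbox 0 1)"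
      by (rule DERIV_cong[OF DERIV_add[OF DERIV_mult[OF Fd zd] DERIV_mult[OF Fd zd]]]) (simp add: fs_def inner_2 algebra_simps)
    then show "((\<lambda>s. F (a + t *\<^sub>R (z s - a)) \<bullet> (z s - a)) has_real_derivative fs s t) (at s within cbox 0 1)"
      by (simp add: inner_2 p_def)
  next
    fix s :: real
    show "(\<lambda>t. F (a + t *\<^sub>R (z s - a)) \<bullet> (z s - a)) integrable_on cbox 0 1"
      unfolding inner_2
      by (intro integrable_continuous continuous_intros continuous_on_compose2[OF contFi]) auto
  next
    have cz: "continuous_on UNIV (\<lambda>q :: real \<times> real. z (fst q))" unfolding z_def by (intro continuous_intros)
    have cp: "continuous_on UNIV (\<lambda>q :: real \<times> real. p (fst q) (snd q))"
      unfolding p_def by (intro continuous_intros cz)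
    have cH: "continuous_on UNIV (\<lambda>q :: real \<times> real. d \<bullet> H i (p (fst q) (snd q)))" for i
      by (intro continuous_on_inner continuous_on_const continuous_on_compose2[OF contH cp]) simp
    have cF: "continuous_on UNIV (\<lambda>q :: real \<times> real. F (p (fst q) (snd q)) $ i)" for i
      by (rule continuous_on_compose2[OF contFi cp]) simp
    have "continuous_on UNIV (\<lambda>q :: real \<times> real. fs (fst q) (snd q))"
      unfolding fs_def inner_2[of "F _"]
      by (intro continuous_on_add continuous_on_mult continuous_on_snd continuous_on_id continuous_on_const cH cF
           continuous_on_component continuous_on_diff cz)
    then show "continuous_on (cbox 0 1 \<times> cbox 0 1) (\<lambda>(s, t). fs s t)"
      unfolding split_beta by (rule continuous_on_subset) simp
  qed (use s in auto)
  have eq: "integral {0..1} (fs s) = F (z s) \<bullet> d" if s: "s \<in> {0..1}" for s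
  proof -
    have "(fs s has_integral (1 * (F (p s 1) \<bullet> d) - 0 * (F (p s 0) \<bullet> d))) {0..1}"
    proof (rule fundamental_theorem_of_calculus[where f="\<lambda>t. t * (F (p s t) \<bullet> d)"])
      fix t :: real assume t: "t \<in> {0..1}"
      have "((\<lambda>t. p s t) has_vector_derivative (z s - a)) (at t within {0..1})"
        unfolding p_def by (auto intro!: derivative_eq_intros)
      from GDERIV_chain_curve[OF this GD]
      have Fd: "((\<lambda>t. F (p s t) $ i) has_real_derivative (z s - a) \<bullet> H i (p s t)) (at t within {0..1})" for i .
      have "((\<lambda>t. t * (F (p s t) \<bullet> d)) has_real_derivative
          1 * (F (p s t) \<bullet> d) + (((z s - a) \<bullet> H 1 (p s t)) * d $ 1 + ((z s - a) \<bullet> H 2 (p s t)) * d $ 2) * t) (at t within {0..1})"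
        unfolding inner_2[of "F _"]
        by (rule DERIV_mult[OF DERIV_ident DERIV_add[OF DERIV_cmult_right[OF Fd] DERIV_cmult_right[OF Fd]]])
      moreover have "1 * (F (p s t) \<bullet> d) + (((z s - a) \<bullet> H 1 (p s t)) * d $ 1 + ((z s - a) \<bullet> H 2 (p s t)) * d $ 2) * t = fs s t"
        unfolding fs_def inner_2[of "z s - a"] inner_2[of d] using sym[OF pS[OF s t]] by (simp add: algebra_simps)
      ultimately show "((\<lambda>t. t * (F (p s t) \<bullet> d)) has_vector_derivative fs s t) (at t within {0..1})"
        by (simp add: has_real_derivative_iff_has_vector_derivative)
    qed simp
    then show ?thesis by (simp add: integral_unique p_def)
  qed
  have "\<exists>s\<in>{0<..<1}. w (z 1) - w (z 0) = (1 - 0) * (F (z s) \<bullet> d)"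
  proof -
    have "\<exists>s\<in>{0<..<1}. w (z 1) - w (z 0) = (\<lambda>h. h * (F (z s) \<bullet> d)) (1 - 0)"
      by (rule mvt_simple) (use der eq in \<open>auto simp: has_field_derivative_def mult_commute_abs\<close>)
    then show ?thesis by simp
  qed
  then show "\<exists>\<theta>\<in>{0..1}. w y - w x = F (x + \<theta> *\<^sub>R (y - x)) \<bullet> (y - x)"
    by (force simp: z_def d_def)
qed

section \<open>Mollification\<close>

text \<open>A kernel of class \<open>C\<^sup>1\<close> with Lipschitz gradient and explicit formulas is enough here; it is not
normalised, and its mass is divided out below.\<close>
definition bump_kernel :: "real \<Rightarrow> real ^ 2 \<Rightarrow> real" where
  "bump_kernel \<epsilon> x = (max 0 (\<epsilon>\<^sup>2 - (norm x)\<^sup>2))\<^sup>2"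

definition bump_kernel_grad :: "real \<Rightarrow> real ^ 2 \<Rightarrow> real ^ 2" where
  "bump_kernel_grad \<epsilon> x = (- 4 * max 0 (\<epsilon>\<^sup>2 - (norm x)\<^sup>2)) *\<^sub>R x"

lemma bump_kernel_outside:
  assumes "\<epsilon> > 0" "norm x \<ge> \<epsilon>" shows "bump_kernel \<epsilon> x = 0" "bump_kernel_grad \<epsilon> x = 0"
proof -
  have "\<epsilon>\<^sup>2 \<le> (norm x)\<^sup>2" using assms by (intro power_mono) auto
  then show "bump_kernel \<epsilon> x = 0" "bump_kernel_grad \<epsilon> x = 0" by (auto simp: bump_kernel_def bump_kernel_grad_def)
qed

lemma bump_kernel_bounds:
  assumes "\<epsilon> > 0" shows "0 \<le> bump_kernel \<epsilon> x" "bump_kernel \<epsilon> x \<le> \<epsilon> ^ 4" "norm (bump_kernel_grad \<epsilon> x) \<le> 4 * \<epsilon> ^ 3"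
proof -
  let ?m = "max 0 (\<epsilon>\<^sup>2 - (norm x)\<^sup>2)"
  have m: "0 \<le> ?m" "?m \<le> \<epsilon>\<^sup>2" by auto
  show "0 \<le> bump_kernel \<epsilon> x" by (simp add: bump_kernel_def)
  have "?m\<^sup>2 \<le> (\<epsilon>\<^sup>2)\<^sup>2" using m by (intro power_mono) auto
  then show "bump_kernel \<epsilon> x \<le> \<epsilon> ^ 4" by (simp add: bump_kernel_def)
  show "norm (bump_kernel_grad \<epsilon> x) \<le> 4 * \<epsilon> ^ 3"
  proof (cases "norm x \<ge> \<epsilon>")
    case True then show ?thesis using assms bump_kernel_outside(2) by simp
  next
    case False
    have "norm (bump_kernel_grad \<epsilon> x) = 4 * (?m * norm x)" using m(1) by (simp add: bump_kernel_grad_def)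
    also have "\<dots> \<le> 4 * (\<epsilon>\<^sup>2 * \<epsilon>)" using m False assms by (intro mult_left_mono mult_mono) auto
    finally show ?thesis by (simp add: power2_eq_square power3_eq_cube)
  qed
qed

lemma bump_kernel_continuous: "continuous_on UNIV (bump_kernel \<epsilon>)" "continuous_on UNIV (bump_kernel_grad \<epsilon>)"
  unfolding bump_kernel_def[abs_def] bump_kernel_grad_def[abs_def] by (intro continuous_intros)+

text \<open>The kernel is \<open>s \<mapsto> (max 0 s)\<^sup>2\<close>, which has a quadratic Taylor bound, composed with a quadratic polynomial. The bound is uniform in \<open>x\<close>,
so that it survives convolution and replaces differentiation under the integral.\<close>
lemma bump_kernel_taylor:
  assumes e: "\<epsilon> > 0"
  obtains A where "A \<ge> 0" "\<And>x h. norm h \<le> 1 \<Longrightarrow>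
    \<bar>bump_kernel \<epsilon> (x + h) - bump_kernel \<epsilon> x - bump_kernel_grad \<epsilon> x \<bullet> h\<bar> \<le> A * (norm h)\<^sup>2"
proof
  \<comment> \<open>Per unit of \<open>(norm h)\<^sup>2\<close>, the first summand bounds \<open>\<delta>\<^sup>2\<close> for
    \<open>norm x \<le> \<epsilon> + 1\<close>, and the second the part of \<open>2 * max 0 s * \<delta>\<close> that is quadratic in \<open>h\<close>.\<close>
  define A where "A = (2 * (\<epsilon> + 1) + 1)\<^sup>2 + 2 * \<epsilon>\<^sup>2"
  show "A \<ge> 0" by (simp add: A_def)
  fix x h :: "real ^ 2" assume h: "norm h \<le> 1"
  show "\<bar>bump_kernel \<epsilon> (x + h) - bump_kernel \<epsilon> x - bump_kernel_grad \<epsilon> x \<bullet> h\<bar> \<le> A * (norm h)\<^sup>2"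
  proof (cases "norm x \<ge> \<epsilon> + 1")
    case True
    then have "norm (x + h) \<ge> \<epsilon>" "norm x \<ge> \<epsilon>" using h norm_diff_ineq[of x h] by linarith+
    then show ?thesis using e by (simp add: bump_kernel_outside A_def)
  next
    case False
    define s \<delta> where "s = \<epsilon>\<^sup>2 - (norm x)\<^sup>2" and "\<delta> = - 2 * (x \<bullet> h) - (norm h)\<^sup>2"
    have sd: "\<epsilon>\<^sup>2 - (norm (x + h))\<^sup>2 = s + \<delta>"
      by (simp add: s_def \<delta>_def power2_norm_eq_inner inner_add_left inner_add_right inner_commute)
    have key: "\<bar>(max 0 (s + \<delta>))\<^sup>2 - (max 0 s)\<^sup>2 - 2 * max 0 s * \<delta>\<bar> \<le> \<delta>\<^sup>2"
    proof -
      consider "s \<ge> 0" "s + \<delta> \<ge> 0" | "s < 0" "s + \<delta> \<ge> 0" | "s \<ge> 0" "s + \<delta> < 0" | "s < 0" "s + \<delta> < 0" by linarith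
      then show ?thesis
      proof cases
        case 1 then show ?thesis by (simp add: power2_eq_square algebra_simps)
      next
        case 2
        then have "(s + \<delta>)\<^sup>2 \<le> \<delta>\<^sup>2" by (intro power_mono) auto
        then show ?thesis using 2 by simp
      next
        case 3
        have "- s\<^sup>2 - 2 * s * \<delta> = \<delta>\<^sup>2 - (s + \<delta>)\<^sup>2" by (simp add: power2_eq_square algebra_simps)
        moreover have "- s\<^sup>2 - 2 * s * \<delta> \<ge> 0"
        proof -
          have "0 \<le> s * (- s - 2 * \<delta>)" using 3 by (intro mult_nonneg_nonneg) auto
          then show ?thesis by (simp add: power2_eq_square algebra_simps)
        qed
        ultimately show ?thesis using 3 by simp
      next
        case 4 then show ?thesis by simp
      qed
    qed
    have "\<bar>\<delta>\<bar> \<le> 2 * \<bar>x \<bullet> h\<bar> + (norm h)\<^sup>2" unfolding \<delta>_def using zero_le_power2[of "norm h"] by linarith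
    also have "\<dots> \<le> 2 * (norm x * norm h) + norm h * 1"
      using Cauchy_Schwarz_ineq2[of x h] mult_left_mono[OF h norm_ge_zero[of h]] by (simp add: power2_eq_square)
    also have "\<dots> = (2 * norm x + 1) * norm h" by (simp add: algebra_simps)
    also have "\<dots> \<le> (2 * (\<epsilon> + 1) + 1) * norm h" using False by (intro mult_right_mono) auto
    finally have "\<bar>\<delta>\<bar>\<^sup>2 \<le> ((2 * (\<epsilon> + 1) + 1) * norm h)\<^sup>2" by (intro power_mono) auto
    then have d2: "\<delta>\<^sup>2 \<le> (2 * (\<epsilon> + 1) + 1)\<^sup>2 * (norm h)\<^sup>2" by (simp add: power_mult_distrib)
    have "bump_kernel_grad \<epsilon> x \<bullet> h = 2 * max 0 s * \<delta> + 2 * max 0 s * (norm h)\<^sup>2"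
      by (simp add: bump_kernel_grad_def s_def \<delta>_def algebra_simps)
    then have "bump_kernel \<epsilon> (x + h) - bump_kernel \<epsilon> x - bump_kernel_grad \<epsilon> x \<bullet> h
       = ((max 0 (s + \<delta>))\<^sup>2 - (max 0 s)\<^sup>2 - 2 * max 0 s * \<delta>) - 2 * max 0 s * (norm h)\<^sup>2"
      unfolding bump_kernel_def sd s_def[symmetric] by simp
    moreover have "0 \<le> 2 * max 0 s * (norm h)\<^sup>2" "2 * max 0 s * (norm h)\<^sup>2 \<le> 2 * \<epsilon>\<^sup>2 * (norm h)\<^sup>2"
      by (auto intro!: mult_right_mono simp: s_def)
    ultimately have "\<bar>bump_kernel \<epsilon> (x + h) - bump_kernel \<epsilon> x - bump_kernel_grad \<epsilon> x \<bullet> h\<bar> \<le> \<delta>\<^sup>2 + 2 * \<epsilon>\<^sup>2 * (norm h)\<^sup>2"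
      using key by linarith
    also have "\<dots> \<le> A * (norm h)\<^sup>2" using d2 by (simp add: A_def algebra_simps)
    finally show ?thesis .
  qed
qed

lemma GDERIV_of_quadratic_bound:
  fixes \<phi> :: "real ^ 'n \<Rightarrow> real"
  assumes "\<And>h. norm h \<le> 1 \<Longrightarrow> \<bar>\<phi> (x + h) - \<phi> x - D \<bullet> h\<bar> \<le> A * (norm h)\<^sup>2"
  shows "GDERIV \<phi> x :> D"
  unfolding gderiv_def has_derivative_at_alt
proof (intro conjI allI impI)
  show "bounded_linear (\<lambda>h. h \<bullet> D)" by (rule bounded_linear_inner_left)
  fix e :: real assume e: "0 < e"
  define d where "d = min 1 (e / (\<bar>A\<bar> + 1))"
  have d: "d > 0" using e by (simp add: d_def)
  have "norm (\<phi> y - \<phi> x - (y - x) \<bullet> D) \<le> e * norm (y - x)" if "norm (y - x) < d" for y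
  proof -
    have "\<bar>\<phi> y - \<phi> x - (y - x) \<bullet> D\<bar> \<le> A * (norm (y - x))\<^sup>2"
      using assms[of "y - x"] that by (simp add: d_def inner_commute)
    also have "\<dots> \<le> (\<bar>A\<bar> + 1) * norm (y - x) * norm (y - x)"
      by (simp add: power2_eq_square mult.assoc mult_right_mono)
    also have "\<dots> \<le> e * norm (y - x)"
    proof (rule mult_right_mono)
      have "(\<bar>A\<bar> + 1) * norm (y - x) \<le> (\<bar>A\<bar> + 1) * (e / (\<bar>A\<bar> + 1))"
        using that by (intro mult_left_mono) (auto simp: d_def)
      then show "(\<bar>A\<bar> + 1) * norm (y - x) \<le> e" by simp
    qed simp
    finally show ?thesis by simp
  qed
  then show "\<exists>d>0. \<forall>y. norm (y - x) < d \<longrightarrow> norm (\<phi> y - \<phi> x - (y - x) \<bullet> D) \<le> e * norm (y - x)"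
    using d by blast
qed

lemma GDERIV_bump_kernel: "\<epsilon> > 0 \<Longrightarrow> GDERIV (bump_kernel \<epsilon>) x :> bump_kernel_grad \<epsilon> x"
  using bump_kernel_taylor[of \<epsilon>] GDERIV_of_quadratic_bound[of "bump_kernel \<epsilon>" x "bump_kernel_grad \<epsilon> x"] by metis

lemma sigma_finite_lebesgue: "sigma_finite_measure (lebesgue :: 'a::euclidean_space measure)"
proof
  show "\<exists>A::'a set set. countable A \<and> A \<subseteq> sets lebesgue \<and> \<Union> A = space lebesgue \<and> (\<forall>a\<in>A. emeasure lebesgue a \<noteq> \<infinity>)"
  proof (intro exI conjI ballI)
    show "countable (range (\<lambda>n::nat. cball (0::'a) (real n)))" by simp
    show "\<Union> (range (\<lambda>n::nat. cball (0::'a) (real n))) = space lebesgue"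
      using real_arch_simple by (auto simp: mem_cball_0)
    fix a assume "a \<in> range (\<lambda>n::nat. cball (0::'a) (real n))"
    then have "a \<in> lmeasurable" by auto
    then show "emeasure lebesgue a \<noteq> \<infinity>" using fmeasurableD2[of a lebesgue] unfolding infinity_ennreal_def by blast
  qed auto
qed

interpretation lebesgue_pair: pair_sigma_finite "lebesgue :: 'a::euclidean_space measure" "lebesgue :: 'b::euclidean_space measure"
  by (intro pair_sigma_finite.intro sigma_finite_lebesgue)

definition kernel_mass :: "real \<Rightarrow> real" where
  "kernel_mass \<epsilon> = (LINT x|lebesgue. bump_kernel \<epsilon> x)"

lemma bump_kernel_integrable: "\<epsilon> > 0 \<Longrightarrow> integrable lebesgue (bump_kernel \<epsilon>)"
  by (rule continuous_bounded_support_integrable[OF bump_kernel_continuous(1)], rule bounded_subset[OF bounded_ball[of 0 \<epsilon>]])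
     (auto simp: not_less[symmetric] dest: bump_kernel_outside(1))

lemma bump_kernel_minus: "bump_kernel \<epsilon> (x - y) = bump_kernel \<epsilon> (y - x)"
  by (simp add: bump_kernel_def norm_minus_commute)

lemma integral_bump_kernel_shift: "(LINT y|lebesgue. bump_kernel \<epsilon> (y - x)) = kernel_mass \<epsilon>"
  using lebesgue_integral_translate[OF borel_measurable_lebesgueI[OF borel_measurable_continuous_onI[OF bump_kernel_continuous(1)]], of \<epsilon> "- x"]
  by (simp add: kernel_mass_def)

lemma bump_kernel_shift_integrable:
  assumes "\<epsilon> > 0" shows "integrable lebesgue (\<lambda>y. bump_kernel \<epsilon> (y - x))"
proof (rule continuous_bounded_support_integrable)
  show "continuous_on UNIV (\<lambda>y. bump_kernel \<epsilon> (y - x))"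
    by (rule continuous_on_compose2[OF bump_kernel_continuous(1)]) (auto intro!: continuous_intros)
  show "bounded {y. bump_kernel \<epsilon> (y - x) \<noteq> 0}"
  proof (rule bounded_subset[OF bounded_cball[of x \<epsilon>]])
    show "{y. bump_kernel \<epsilon> (y - x) \<noteq> 0} \<subseteq> cball x \<epsilon>"
      using bump_kernel_outside(1)[OF assms] by (auto simp: dist_norm norm_minus_commute intro: ccontr)
  qed
qed

lemma kernel_mass_pos: assumes "\<epsilon> > 0" shows "kernel_mass \<epsilon> > 0"
proof -
  have nn: "kernel_mass \<epsilon> \<ge> 0" unfolding kernel_mass_def using bump_kernel_bounds(1)[OF assms] by (intro Bochner_Integration.integral_nonneg) auto
  have "kernel_mass \<epsilon> \<noteq> 0"
  proof
    assume "kernel_mass \<epsilon> = 0"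
    then have "AE x in lebesgue. bump_kernel \<epsilon> x = 0"
      unfolding kernel_mass_def
      using integral_nonneg_eq_0_iff_AE[OF bump_kernel_integrable[OF assms]] bump_kernel_bounds(1)[OF assms] by simp
    then obtain N where N: "negligible N" "{x. bump_kernel \<epsilon> x \<noteq> 0} \<subseteq> N"
      by (auto simp: eventually_ae_filter_negligible)
    have "ball 0 \<epsilon> \<subseteq> {x. bump_kernel \<epsilon> x \<noteq> 0}"
    proof
      fix x :: "real ^ 2" assume "x \<in> ball 0 \<epsilon>"
      then have "(norm x)\<^sup>2 < \<epsilon>\<^sup>2" by (intro power_strict_mono) auto
      then show "x \<in> {x. bump_kernel \<epsilon> x \<noteq> 0}" by (simp add: bump_kernel_def)
    qed
    then have "negligible (ball (0 :: real ^ 2) \<epsilon>)" using N by (meson negligible_subset)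
    then show False using assms open_not_negligible[of "ball (0 :: real ^ 2) \<epsilon>"] by simp
  qed
  with nn show ?thesis by simp
qed

text \<open>A bounded field is set to zero outside the domain, so that its convolution with a kernel is defined on the whole
plane.\<close>
locale bounded_field =
  fixes \<Omega> :: "(real ^ 2) set" and G :: "real ^ 2 \<Rightarrow> real ^ 2" and M :: real
  assumes \<Omega>_open: "open \<Omega>" and \<Omega>_bounded: "bounded \<Omega>"
    and G_meas: "G \<in> borel_measurable lebesgue"
    and G_bound: "\<And>x. norm (G x) \<le> M" and G_zero: "\<And>x. x \<notin> \<Omega> \<Longrightarrow> G x = 0"
begin

lemma \<Omega>_sets: "\<Omega> \<in> sets lebesgue" using \<Omega>_open by (simp add: borel_open)

lemma M_nonneg: "M \<ge> 0" using G_bound[of 0] norm_ge_zero[of "G 0"] by linarith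

lemma Gc_meas: "(\<lambda>y. c \<bullet> G y) \<in> borel_measurable lebesgue"
  by (intro borel_measurable_inner borel_measurable_const G_meas)

lemma Gi_meas: "(\<lambda>y. G y $ i) \<in> borel_measurable lebesgue"
  using Gc_meas[of "axis i 1"] by (simp add: inner_axis')

lemma Gi_bound: "\<bar>G y $ i\<bar> \<le> M * indicator \<Omega> y"
  using component_le_norm_cart[of "G y" i] G_bound[of y] G_zero[of y] by (cases "y \<in> \<Omega>") auto

lemma conv_integrable:
  fixes \<zeta> :: "real ^ 2 \<Rightarrow> real"
  assumes "\<zeta> \<in> borel_measurable lebesgue" "\<And>y. \<bar>\<zeta> y\<bar> \<le> L"
  shows "integrable lebesgue (\<lambda>y. G y $ i * \<zeta> y)"
proof (rule integrable_bounded_support[OF _ _ \<Omega>_bounded \<Omega>_sets])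
  show "(\<lambda>y. G y $ i * \<zeta> y) \<in> borel_measurable lebesgue" by (intro borel_measurable_times Gi_meas assms)
  have "\<bar>G y $ i * \<zeta> y\<bar> \<le> (M * indicator \<Omega> y) * L" for y
    unfolding abs_mult using Gi_bound assms(2) M_nonneg by (intro mult_mono) auto
  then show "AE y in lebesgue. \<bar>G y $ i * \<zeta> y\<bar> \<le> (M * L) * indicator \<Omega> y" by (simp add: mult_ac)
qed

lemma shift_measurable:
  fixes \<zeta> :: "real ^ 2 \<Rightarrow> real"
  assumes "continuous_on UNIV \<zeta>" shows "(\<lambda>y. \<zeta> (x - y)) \<in> borel_measurable lebesgue"
  by (intro borel_measurable_lebesgueI borel_measurable_continuous_onI continuous_on_compose2[OF assms])
     (auto intro!: continuous_intros)

lemma conv_continuous: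
  fixes \<zeta> :: "real ^ 2 \<Rightarrow> real"
  assumes \<zeta>: "continuous_on UNIV \<zeta>" "\<And>y. \<bar>\<zeta> y\<bar> \<le> L"
  shows "continuous_on UNIV (\<lambda>x. LINT y|lebesgue. G y $ i * \<zeta> (x - y))"
  unfolding continuous_on_sequentially
proof (intro allI impI ballI, elim conjE)
  fix X and x :: "real ^ 2" assume X: "X \<longlonglongrightarrow> x"
  have "(\<lambda>n. LINT y|lebesgue. G y $ i * \<zeta> (X n - y)) \<longlonglongrightarrow> (LINT y|lebesgue. G y $ i * \<zeta> (x - y))"
  proof (rule dominated_convergence_bounded_support[OF _ _ _ _ \<Omega>_bounded \<Omega>_sets])
    show "AE y in lebesgue. (\<lambda>n. G y $ i * \<zeta> (X n - y)) \<longlonglongrightarrow> G y $ i * \<zeta> (x - y)"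
    proof (intro AE_I2 tendsto_mult tendsto_const)
      fix y have "isCont \<zeta> (x - y)" using \<zeta>(1) by (simp add: continuous_on_eq_continuous_at)
      then show "(\<lambda>n. \<zeta> (X n - y)) \<longlonglongrightarrow> \<zeta> (x - y)" by (rule isCont_tendsto_compose) (intro tendsto_intros X)
    qed
    have "\<bar>G y $ i * \<zeta> z\<bar> \<le> (M * indicator \<Omega> y) * L" for y z
      unfolding abs_mult using Gi_bound \<zeta>(2) M_nonneg by (intro mult_mono) auto
    then have "\<bar>G y $ i * \<zeta> z\<bar> \<le> (M * L) * indicator \<Omega> y" for y z by (simp add: mult_ac)
    then show "AE y in lebesgue. \<bar>G y $ i * \<zeta> (X n - y)\<bar> \<le> (M * L) * indicator \<Omega> y" for n by (intro AE_I2)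
  qed (intro borel_measurable_times Gi_meas shift_measurable \<zeta>)+
  then show "(((\<lambda>x. LINT y|lebesgue. G y $ i * \<zeta> (x - y)) \<circ> X) \<longlonglongrightarrow> (LINT y|lebesgue. G y $ i * \<zeta> (x - y)))"
    by (simp add: o_def)
qed

definition mollified :: "real \<Rightarrow> real ^ 2 \<Rightarrow> real ^ 2" where
  "mollified \<epsilon> x = (\<chi> i. (LINT y|lebesgue. G y $ i * bump_kernel \<epsilon> (x - y)) / kernel_mass \<epsilon>)"

definition mollified_grad :: "real \<Rightarrow> 2 \<Rightarrow> real ^ 2 \<Rightarrow> real ^ 2" where
  "mollified_grad \<epsilon> i x = (\<chi> j. (LINT y|lebesgue. G y $ i * bump_kernel_grad \<epsilon> (x - y) $ j) / kernel_mass \<epsilon>)"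

lemma bump_kernel_grad_component:
  assumes "\<epsilon> > 0"
  shows "continuous_on UNIV (\<lambda>y. bump_kernel_grad \<epsilon> y $ j)" "\<bar>bump_kernel_grad \<epsilon> y $ j\<bar> \<le> 4 * \<epsilon> ^ 3"
  using bump_kernel_bounds(3)[OF assms, of y] component_le_norm_cart[of "bump_kernel_grad \<epsilon> y" j]
  by (auto intro!: continuous_intros bump_kernel_continuous(2))

lemma bump_kernel_abs: "\<epsilon> > 0 \<Longrightarrow> \<bar>bump_kernel \<epsilon> y\<bar> \<le> \<epsilon> ^ 4"
  using bump_kernel_bounds(1,2)[of \<epsilon> y] by simp

lemma mollified_grad_continuous: "\<epsilon> > 0 \<Longrightarrow> continuous_on UNIV (mollified_grad \<epsilon> i)"
  unfolding mollified_grad_def[abs_def]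
  by (intro continuous_on_vec_lambda continuous_on_divide continuous_on_const conv_continuous[OF bump_kernel_grad_component])
     (auto simp: less_imp_neq[OF kernel_mass_pos, symmetric])

lemma GDERIV_mollified:
  assumes e: "\<epsilon> > 0"
  shows "GDERIV (\<lambda>x. mollified \<epsilon> x $ i) x :> mollified_grad \<epsilon> i x"
proof (rule bump_kernel_taylor[OF e])
  fix A assume A: "A \<ge> 0" "\<And>x h. norm h \<le> 1 \<Longrightarrow>
    \<bar>bump_kernel \<epsilon> (x + h) - bump_kernel \<epsilon> x - bump_kernel_grad \<epsilon> x \<bullet> h\<bar> \<le> A * (norm h)\<^sup>2"
  have K: "kernel_mass \<epsilon> > 0" by (rule kernel_mass_pos[OF e])
  show ?thesis
  proof (rule GDERIV_of_quadratic_bound)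
    fix h :: "real ^ 2" assume h: "norm h \<le> 1"
    define T where "T y = bump_kernel \<epsilon> (x - y + h) - bump_kernel \<epsilon> (x - y) - bump_kernel_grad \<epsilon> (x - y) \<bullet> h" for y
    have i1: "integrable lebesgue (\<lambda>y. G y $ i * bump_kernel \<epsilon> (z - y))" for z
      by (rule conv_integrable[OF shift_measurable[OF bump_kernel_continuous(1)] bump_kernel_abs[OF e]])
    have i2: "integrable lebesgue (\<lambda>y. G y $ i * bump_kernel_grad \<epsilon> (x - y) $ j)" for j
      by (rule conv_integrable[OF shift_measurable[OF bump_kernel_grad_component(1)[OF e]] bump_kernel_grad_component(2)[OF e]])
    have Teq: "G y $ i * T y = G y $ i * bump_kernel \<epsilon> (x + h - y) - G y $ i * bump_kernel \<epsilon> (x - y)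
        - (G y $ i * bump_kernel_grad \<epsilon> (x - y) $ 1 * h $ 1 + G y $ i * bump_kernel_grad \<epsilon> (x - y) $ 2 * h $ 2)" for y
      by (simp add: T_def inner_2 algebra_simps)
    have Ieq: "mollified \<epsilon> (x + h) $ i - mollified \<epsilon> x $ i - mollified_grad \<epsilon> i x \<bullet> h = (LINT y|lebesgue. G y $ i * T y) / kernel_mass \<epsilon>" (is "?l = _")
      unfolding Teq using i1 i2 by (simp add: mollified_def mollified_grad_def inner_2 diff_divide_distrib add_divide_distrib)
    have "\<bar>LINT y|lebesgue. G y $ i * T y\<bar> \<le> (M * (A * (norm h)\<^sup>2)) * measure lebesgue \<Omega>"
    proof (rule abs_integral_le_measure[OF _ _ \<Omega>_bounded \<Omega>_sets])
      show "(\<lambda>y. G y $ i * T y) \<in> borel_measurable lebesgue"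
        unfolding Teq by (intro borel_measurable_diff borel_measurable_add borel_measurable_times borel_measurable_const
            borel_measurable_integrable[OF i1] borel_measurable_integrable[OF i2])
      have "\<bar>G y $ i * T y\<bar> \<le> (M * indicator \<Omega> y) * (A * (norm h)\<^sup>2)" for y
        unfolding abs_mult T_def using Gi_bound A h M_nonneg by (intro mult_mono) auto
      then show "AE y in lebesgue. \<bar>G y $ i * T y\<bar> \<le> (M * (A * (norm h)\<^sup>2)) * indicator \<Omega> y" by (simp add: mult_ac)
    qed
    then have "\<bar>?l\<bar> \<le> (M * (A * (norm h)\<^sup>2)) * measure lebesgue \<Omega> / kernel_mass \<epsilon>"
      unfolding Ieq using K by (simp add: abs_divide divide_right_mono)
    also have "\<dots> = (M * A * measure lebesgue \<Omega> / kernel_mass \<epsilon>) * (norm h)\<^sup>2" by simp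
    finally show "\<bar>?l\<bar> \<le> (M * A * measure lebesgue \<Omega> / kernel_mass \<epsilon>) * (norm h)\<^sup>2" .
  qed
qed

lemma norm_mollified_le:
  assumes e: "\<epsilon> > 0" shows "norm (mollified \<epsilon> x) \<le> M"
proof -
  have K: "kernel_mass \<epsilon> > 0" by (rule kernel_mass_pos[OF e])
  define c where "c = mollified \<epsilon> x"
  have i1: "integrable lebesgue (\<lambda>y. G y $ i * bump_kernel \<epsilon> (x - y))" for i
    by (rule conv_integrable[OF shift_measurable[OF bump_kernel_continuous(1)] bump_kernel_abs[OF e]])
  have ceq: "(c \<bullet> G y) * bump_kernel \<epsilon> (x - y) = c $ 1 * (G y $ 1 * bump_kernel \<epsilon> (x - y)) + c $ 2 * (G y $ 2 * bump_kernel \<epsilon> (x - y))" for y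
    by (simp add: inner_2 algebra_simps)
  have ic: "integrable lebesgue (\<lambda>y. (c \<bullet> G y) * bump_kernel \<epsilon> (x - y))"
    unfolding ceq by (intro Bochner_Integration.integrable_add integrable_mult_right i1)
  have "c \<bullet> c * kernel_mass \<epsilon> = (LINT y|lebesgue. (c \<bullet> G y) * bump_kernel \<epsilon> (x - y))"
    unfolding ceq using i1 K by (simp add: c_def mollified_def inner_2 add_divide_distrib ring_distribs)
  also have "\<dots> \<le> (LINT y|lebesgue. norm c * M * bump_kernel \<epsilon> (y - x))"
  proof (rule integral_mono_AE[OF ic])
    show "integrable lebesgue (\<lambda>y. norm c * M * bump_kernel \<epsilon> (y - x))"
      by (intro integrable_mult_right bump_kernel_shift_integrable e)
    have "c \<bullet> G y \<le> norm c * M" for y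
      using norm_cauchy_schwarz[of c "G y"] G_bound[of y] by (smt (verit) mult_left_mono norm_ge_zero)
    then have "(c \<bullet> G y) * bump_kernel \<epsilon> (x - y) \<le> norm c * M * bump_kernel \<epsilon> (y - x)" for y
      unfolding bump_kernel_minus[of \<epsilon> x y] by (intro mult_right_mono bump_kernel_bounds(1)[OF e])
    then show "AE y in lebesgue. (c \<bullet> G y) * bump_kernel \<epsilon> (x - y) \<le> norm c * M * bump_kernel \<epsilon> (y - x)" by simp
  qed
  also have "\<dots> = norm c * M * kernel_mass \<epsilon>" by (simp add: integral_bump_kernel_shift)
  finally have "norm c * norm c * kernel_mass \<epsilon> \<le> norm c * M * kernel_mass \<epsilon>" by (simp add: dot_square_norm power2_eq_square)
  then have "norm c * norm c \<le> norm c * M" using K by (rule mult_right_le_imp_le)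
  then show ?thesis unfolding c_def[symmetric] using M_nonneg by (cases "c = 0") auto
qed

text \<open>The kernel translated to \<open>x\<close> and reflected is itself an admissible test function if its support lies in \<open>\<Omega>\<close>.\<close>
lemma mollified_curl_free:
  assumes e: "\<epsilon> > 0" and x: "cball x \<epsilon> \<subseteq> \<Omega>"
    and curl: "\<And>\<phi> D. D-lipschitz_on UNIV \<phi> \<Longrightarrow> compact (closure {x. \<phi> x \<noteq> 0}) \<Longrightarrow> closure {x. \<phi> x \<noteq> 0} \<subseteq> \<Omega>
        \<Longrightarrow> (LINT x|lebesgue. G x $ 1 * grad \<phi> x $ 2 - G x $ 2 * grad \<phi> x $ 1) = 0"
  shows "mollified_grad \<epsilon> 1 x $ 2 = mollified_grad \<epsilon> 2 x $ 1"
proof -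
  define \<phi> where "\<phi> y = bump_kernel \<epsilon> (x - y)" for y
  have G\<phi>: "GDERIV \<phi> y :> - bump_kernel_grad \<epsilon> (x - y)" for y
  proof -
    have "((\<lambda>y. bump_kernel \<epsilon> (x - y)) has_derivative (\<lambda>h. (- h) \<bullet> bump_kernel_grad \<epsilon> (x - y))) (at y)"
      by (rule has_derivative_compose[where g="bump_kernel \<epsilon>" and f="\<lambda>y. x - y"])
         (use GDERIV_bump_kernel[OF e] in \<open>auto simp: gderiv_def intro!: derivative_eq_intros\<close>)
    then show ?thesis by (simp add: gderiv_def \<phi>_def[abs_def])
  qed
  have lip: "(4 * \<epsilon> ^ 3)-lipschitz_on UNIV \<phi>"
    by (rule lipschitz_of_GDERIV_bound[OF _ G\<phi>]) (use bump_kernel_bounds(3)[OF e] e in auto)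
  have "{y. \<phi> y \<noteq> 0} \<subseteq> cball x \<epsilon>"
    using bump_kernel_outside(1)[OF e] by (auto simp: \<phi>_def dist_norm intro: ccontr)
  then have cl: "closure {y. \<phi> y \<noteq> 0} \<subseteq> cball x \<epsilon>" by (rule closure_minimal) simp
  then have "compact (closure {y. \<phi> y \<noteq> 0})"
    by (meson bounded_subset bounded_cball compact_eq_bounded_closed closed_closure)
  from curl[OF lip this] cl x
  have 0: "(LINT y|lebesgue. G y $ 1 * grad \<phi> y $ 2 - G y $ 2 * grad \<phi> y $ 1) = 0" by blast
  have i2: "integrable lebesgue (\<lambda>y. G y $ i * bump_kernel_grad \<epsilon> (x - y) $ j)" for i j
    by (rule conv_integrable[OF shift_measurable[OF bump_kernel_grad_component(1)[OF e]] bump_kernel_grad_component(2)[OF e]])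
  have "(LINT y|lebesgue. G y $ 1 * grad \<phi> y $ 2 - G y $ 2 * grad \<phi> y $ 1)
    = (LINT y|lebesgue. G y $ 2 * bump_kernel_grad \<epsilon> (x - y) $ 1 - G y $ 1 * bump_kernel_grad \<epsilon> (x - y) $ 2)"
    by (simp add: grad_eqI[OF G\<phi>])
  also have "\<dots> = (LINT y|lebesgue. G y $ 2 * bump_kernel_grad \<epsilon> (x - y) $ 1) - (LINT y|lebesgue. G y $ 1 * bump_kernel_grad \<epsilon> (x - y) $ 2)"
    by (rule Bochner_Integration.integral_diff[OF i2 i2])
  finally show ?thesis using 0 by (simp add: mollified_grad_def)
qed

text \<open>By Fubini's theorem mollification moves to \<open>\<phi>\<close>, and a Lipschitz function differs from its
mollification by at most \<open>D * \<epsilon>\<close>. Thus the mollified fields converge weakly, with a rate.\<close>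
lemma integral_mollified_times:
  fixes \<phi> :: "real ^ 2 \<Rightarrow> real"
  assumes e: "\<epsilon> > 0" and \<phi>: "D-lipschitz_on UNIV \<phi>" "bounded {x. \<phi> x \<noteq> 0}"
  shows "\<bar>(LINT x|lebesgue. mollified \<epsilon> x $ i * \<phi> x) - (LINT x|lebesgue. G x $ i * \<phi> x)\<bar> \<le> M * (D * \<epsilon>) * measure lebesgue \<Omega>"
proof -
  have K: "kernel_mass \<epsilon> > 0" by (rule kernel_mass_pos[OF e])
  have D0: "D \<ge> 0" by (rule lipschitz_on_nonneg[OF \<phi>(1)])
  obtain R where R: "\<And>x. \<phi> x \<noteq> 0 \<Longrightarrow> norm x \<le> R" using \<phi>(2) by (auto simp: bounded_iff)
  define S where "S = cball (0 :: real ^ 2) R"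
  obtain L where L: "L \<ge> 0" "\<And>x. x \<in> S \<Longrightarrow> \<bar>\<phi> x\<bar> \<le> L"
    using lipschitz_bounded_on_bounded[OF lipschitz_on_subset[OF \<phi>(1) subset_UNIV], of S] by (auto simp: S_def)
  have \<phi>S: "\<phi> x = 0" if "x \<notin> S" for x using R that by (auto simp: S_def)
  have Lall: "\<bar>\<phi> x\<bar> \<le> L" for x using L \<phi>S[of x] by (cases "x \<in> S") auto
  have \<phi>m: "\<phi> \<in> borel_measurable lebesgue" by (rule borel_measurable_lebesgueI[OF lipschitz_borel_measurable[OF \<phi>(1)]])
  define P where "P x y = \<phi> x * (G y $ i * bump_kernel \<epsilon> (x - y))" for x y
  have idm: "(\<lambda>x. x) \<in> measurable lebesgue (borel :: (real ^ 2) measure)"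
    by (rule measurable_completion) simp
  have Pm: "case_prod P \<in> borel_measurable (lebesgue \<Otimes>\<^sub>M lebesgue)"
    unfolding P_def split_beta
  proof (intro borel_measurable_times)
    show "(\<lambda>p. \<phi> (fst p)) \<in> borel_measurable (lebesgue \<Otimes>\<^sub>M (lebesgue :: (real^2) measure))"
      by (rule measurable_compose[OF measurable_fst \<phi>m])
    show "(\<lambda>p. G (snd p) $ i) \<in> borel_measurable ((lebesgue :: (real^2) measure) \<Otimes>\<^sub>M lebesgue)"
      by (rule measurable_compose[OF measurable_snd Gi_meas])
    have "(\<lambda>p. fst p - snd p) \<in> borel_measurable ((lebesgue :: (real^2) measure) \<Otimes>\<^sub>M lebesgue)"
      by (intro borel_measurable_diff measurable_compose[OF measurable_fst idm] measurable_compose[OF measurable_snd idm])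
    then show "(\<lambda>p. bump_kernel \<epsilon> (fst p - snd p)) \<in> borel_measurable ((lebesgue :: (real^2) measure) \<Otimes>\<^sub>M lebesgue)"
      by (rule measurable_compose) (rule borel_measurable_continuous_onI[OF bump_kernel_continuous(1)])
  qed
  have Pb: "\<bar>P x y\<bar> \<le> L * (M * \<epsilon> ^ 4)" for x y
  proof -
    have "\<bar>G y $ i\<bar> \<le> M" using Gi_bound[of y i] M_nonneg by (cases "y \<in> \<Omega>") auto
    then show ?thesis unfolding P_def abs_mult
      using Lall bump_kernel_abs[OF e] M_nonneg L(1) e by (intro mult_mono) auto
  qed
  have Pint: "integrable (lebesgue \<Otimes>\<^sub>M lebesgue) (case_prod P)"
  proof (rule integrableI_bounded_set[where A="S \<times> \<Omega>" and B="L * (M * \<epsilon> ^ 4)"])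
    show "S \<times> \<Omega> \<in> sets (lebesgue \<Otimes>\<^sub>M lebesgue)" using \<Omega>_sets by (intro pair_measureI) (auto simp: S_def)
    have "emeasure lebesgue S < \<infinity>" "emeasure lebesgue \<Omega> < \<infinity>"
      using bounded_set_imp_lmeasurable[OF _ \<Omega>_sets] \<Omega>_bounded fmeasurableD2[of \<Omega> lebesgue] fmeasurableD2[of S lebesgue]
      by (auto simp: S_def less_top[symmetric] top_unique)
    then show "emeasure (lebesgue \<Otimes>\<^sub>M lebesgue) (S \<times> \<Omega>) < \<infinity>"
      using \<Omega>_sets sigma_finite_measure.emeasure_pair_measure_Times[OF sigma_finite_lebesgue, of S lebesgue \<Omega>]
      by (simp add: S_def ennreal_mult_less_top)
    show "AE p in lebesgue \<Otimes>\<^sub>M lebesgue. p \<in> S \<times> \<Omega> \<longrightarrow> norm (case_prod P p) \<le> L * (M * \<epsilon> ^ 4)"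
      using Pb by auto
    have "P x y = 0" if "(x, y) \<notin> S \<times> \<Omega>" for x y
      using that \<phi>S[of x] G_zero[of y] by (cases "x \<in> S") (auto simp: P_def)
    then show "AE p in lebesgue \<Otimes>\<^sub>M lebesgue. p \<notin> S \<times> \<Omega> \<longrightarrow> case_prod P p = 0"
      by (intro AE_I2) auto
  qed (rule Pm)
  have kb: "integrable lebesgue (\<lambda>x. bump_kernel \<epsilon> (x - y) * \<phi> x)" for y
  proof (rule Bochner_Integration.integrable_bound[OF integrable_mult_left[OF bump_kernel_shift_integrable[OF e, of y], of L]])
    show "(\<lambda>x. bump_kernel \<epsilon> (x - y) * \<phi> x) \<in> borel_measurable lebesgue"
      by (intro borel_measurable_times \<phi>m borel_measurable_integrable[OF bump_kernel_shift_integrable[OF e]])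
    show "AE x in lebesgue. norm (bump_kernel \<epsilon> (x - y) * \<phi> x) \<le> norm (bump_kernel \<epsilon> (x - y) * L)"
      using Lall L(1) by (auto simp: abs_mult intro!: mult_left_mono)
  qed
  define \<phi>' where "\<phi>' y = (LINT x|lebesgue. bump_kernel \<epsilon> (x - y) * \<phi> x) / kernel_mass \<epsilon>" for y
  have close: "\<bar>\<phi>' y - \<phi> y\<bar> \<le> D * \<epsilon>" for y
  proof -
    have ik: "integrable lebesgue (\<lambda>x. bump_kernel \<epsilon> (x - y) * \<phi> y)"
      by (intro integrable_mult_left bump_kernel_shift_integrable e)
    have "(LINT x|lebesgue. bump_kernel \<epsilon> (x - y) * \<phi> x) - kernel_mass \<epsilon> * \<phi> y
        = (LINT x|lebesgue. bump_kernel \<epsilon> (x - y) * \<phi> x - bump_kernel \<epsilon> (x - y) * \<phi> y)"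
      by (simp add: Bochner_Integration.integral_diff[OF kb ik] integral_bump_kernel_shift)
    also have "\<bar>\<dots>\<bar> \<le> (LINT x|lebesgue. \<bar>bump_kernel \<epsilon> (x - y) * \<phi> x - bump_kernel \<epsilon> (x - y) * \<phi> y\<bar>)"
      by (rule integral_abs_bound)
    also have "\<dots> \<le> (LINT x|lebesgue. bump_kernel \<epsilon> (x - y) * (D * \<epsilon>))"
    proof (rule integral_mono_AE)
      have "\<bar>bump_kernel \<epsilon> (x - y) * \<phi> x - bump_kernel \<epsilon> (x - y) * \<phi> y\<bar> \<le> bump_kernel \<epsilon> (x - y) * (D * \<epsilon>)" for x
      proof (cases "norm (x - y) \<ge> \<epsilon>")
        case False
        have "\<bar>\<phi> x - \<phi> y\<bar> \<le> D * dist x y" using lipschitz_onD[OF \<phi>(1), of x y] by (simp add: dist_real_def)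
        also have "\<dots> \<le> D * \<epsilon>" using False D0 by (intro mult_left_mono) (auto simp: dist_norm)
        finally show ?thesis using bump_kernel_bounds(1)[OF e]
          by (simp add: abs_mult mult_left_mono flip: right_diff_distrib)
      qed (simp add: bump_kernel_outside(1)[OF e])
      then show "AE x in lebesgue. \<bar>bump_kernel \<epsilon> (x - y) * \<phi> x - bump_kernel \<epsilon> (x - y) * \<phi> y\<bar> \<le> bump_kernel \<epsilon> (x - y) * (D * \<epsilon>)" by simp
    qed (intro integrable_abs Bochner_Integration.integrable_diff kb ik integrable_mult_left bump_kernel_shift_integrable e)+
    also have "\<dots> = kernel_mass \<epsilon> * (D * \<epsilon>)" by (simp add: integral_bump_kernel_shift)
    finally have "\<bar>kernel_mass \<epsilon> * (\<phi>' y - \<phi> y)\<bar> \<le> kernel_mass \<epsilon> * (D * \<epsilon>)"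
      using K by (simp add: \<phi>'_def right_diff_distrib)
    then show ?thesis using K by (simp add: abs_mult)
  qed
  have "(LINT x|lebesgue. mollified \<epsilon> x $ i * \<phi> x) = (LINT x|lebesgue. LINT y|lebesgue. P x y) / kernel_mass \<epsilon>"
  proof -
    have "mollified \<epsilon> x $ i * \<phi> x = (LINT y|lebesgue. P x y) / kernel_mass \<epsilon>" for x
      by (simp add: mollified_def P_def)
    then show ?thesis by simp
  qed
  also have "(LINT x|lebesgue. LINT y|lebesgue. P x y) = (LINT y|lebesgue. LINT x|lebesgue. P x y)"
    by (rule lebesgue_pair.Fubini_integral[OF Pint, symmetric])
  also have "\<dots> = (LINT y|lebesgue. G y $ i * (kernel_mass \<epsilon> * \<phi>' y))"
  proof (intro Bochner_Integration.integral_cong refl)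
    fix y
    have "(LINT x|lebesgue. P x y) = (LINT x|lebesgue. G y $ i * (bump_kernel \<epsilon> (x - y) * \<phi> x))" by (simp add: P_def mult_ac)
    then show "(LINT x|lebesgue. P x y) = G y $ i * (kernel_mass \<epsilon> * \<phi>' y)" using K by (simp add: \<phi>'_def)
  qed
  also have "\<dots> / kernel_mass \<epsilon> = (LINT y|lebesgue. G y $ i * \<phi>' y)"
    using K by (simp add: mult_ac flip: Bochner_Integration.integral_divide_zero)
  finally have main: "(LINT x|lebesgue. mollified \<epsilon> x $ i * \<phi> x) = (LINT y|lebesgue. G y $ i * \<phi>' y)" .
  have \<phi>'m: "\<phi>' \<in> borel_measurable lebesgue"
  proof -
    have cont: "continuous_on UNIV (\<lambda>p :: (real^2) \<times> (real^2). bump_kernel \<epsilon> (snd p - fst p) * \<phi> (snd p))"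
      by (intro continuous_on_mult continuous_on_compose2[OF bump_kernel_continuous(1)] continuous_on_compose2[OF lipschitz_on_continuous_on[OF \<phi>(1)]] continuous_intros) auto
    have "(\<lambda>y. LINT x|lborel. bump_kernel \<epsilon> (x - y) * \<phi> x) \<in> borel_measurable borel"
      using borel_measurable_continuous_onI[OF cont]
      by (intro lborel.borel_measurable_lebesgue_integral)
         (simp add: split_beta borel_prod measurable_cong_sets[OF sets_pair_measure_cong[OF refl sets_lborel] refl])
    moreover have "(LINT x|lebesgue. bump_kernel \<epsilon> (x - y) * \<phi> x) = (LINT x|lborel. bump_kernel \<epsilon> (x - y) * \<phi> x)" for y
      by (intro integral_completion) (auto intro!: borel_measurable_continuous_onI continuous_on_mult continuous_on_compose2[OF bump_kernel_continuous(1)] lipschitz_on_continuous_on[OF \<phi>(1)] continuous_intros)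
    ultimately show ?thesis unfolding \<phi>'_def by (intro borel_measurable_divide borel_measurable_const borel_measurable_lebesgueI) simp
  qed
  have j1: "integrable lebesgue (\<lambda>y. G y $ i * \<phi>' y)"
  proof (rule conv_integrable[OF \<phi>'m, of "L + D * \<epsilon>"])
    fix y show "\<bar>\<phi>' y\<bar> \<le> L + D * \<epsilon>" using close[of y] Lall[of y] by linarith
  qed
  have j2: "integrable lebesgue (\<lambda>y. G y $ i * \<phi> y)" by (rule conv_integrable[OF \<phi>m Lall])
  have "(LINT x|lebesgue. mollified \<epsilon> x $ i * \<phi> x) - (LINT x|lebesgue. G x $ i * \<phi> x) = (LINT y|lebesgue. G y $ i * \<phi>' y - G y $ i * \<phi> y)"
    by (simp add: main Bochner_Integration.integral_diff[OF j1 j2])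
  also have "\<bar>\<dots>\<bar> \<le> M * (D * \<epsilon>) * measure lebesgue \<Omega>"
  proof (rule abs_integral_le_measure[OF _ _ \<Omega>_bounded \<Omega>_sets])
    show "(\<lambda>y. G y $ i * \<phi>' y - G y $ i * \<phi> y) \<in> borel_measurable lebesgue"
      by (rule borel_measurable_integrable[OF Bochner_Integration.integrable_diff[OF j1 j2]])
    have "\<bar>G y $ i * \<phi>' y - G y $ i * \<phi> y\<bar> \<le> (M * indicator \<Omega> y) * (D * \<epsilon>)" for y
      unfolding right_diff_distrib[symmetric] abs_mult using Gi_bound close M_nonneg by (intro mult_mono) auto
    then show "AE y in lebesgue. \<bar>G y $ i * \<phi>' y - G y $ i * \<phi> y\<bar> \<le> M * (D * \<epsilon>) * indicator \<Omega> y" by (simp add: mult_ac)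
  qed
  finally show ?thesis .
qed

text \<open>The points at distance more than \<open>\<epsilon>\<close> from the complement form a convex set on which the mollified field
is curl free. The potential on this set has the Lipschitz constant \<open>M\<close> and is extended with the same constant.\<close>
lemma mollified_potential:
  assumes e: "\<epsilon> > 0" and conv: "convex \<Omega>" and a: "cball a \<epsilon> \<subseteq> \<Omega>"
    and curl: "\<And>\<phi> D. D-lipschitz_on UNIV \<phi> \<Longrightarrow> compact (closure {x. \<phi> x \<noteq> 0}) \<Longrightarrow> closure {x. \<phi> x \<noteq> 0} \<subseteq> \<Omega>
        \<Longrightarrow> (LINT x|lebesgue. G x $ 1 * grad \<phi> x $ 2 - G x $ 2 * grad \<phi> x $ 1) = 0"
  obtains w where "M-lipschitz_on UNIV w" "w a = 0"
    "\<And>x r. r > \<epsilon> \<Longrightarrow> cball x r \<subseteq> \<Omega> \<Longrightarrow> grad w x = mollified \<epsilon> x"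
proof -
  define S where "S = {x. cball x \<epsilon> \<subseteq> \<Omega>}"
  have S: "convex S"
  proof (rule convexI)
    fix x y and u v :: real assume xy: "x \<in> S" "y \<in> S" and uv: "0 \<le> u" "0 \<le> v" "u + v = 1"
    show "u *\<^sub>R x + v *\<^sub>R y \<in> S"
      unfolding S_def
    proof (intro CollectI subsetI)
      fix z assume z: "z \<in> cball (u *\<^sub>R x + v *\<^sub>R y) \<epsilon>"
      define k where "k = z - (u *\<^sub>R x + v *\<^sub>R y)"
      have "norm k \<le> \<epsilon>" using z by (simp add: k_def dist_norm norm_minus_commute)
      then have "x + k \<in> \<Omega>" "y + k \<in> \<Omega>" using xy by (auto simp: S_def dist_norm)
      then have "u *\<^sub>R (x + k) + v *\<^sub>R (y + k) \<in> \<Omega>" using conv uv by (intro convexD) auto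
      moreover have "u *\<^sub>R (x + k) + v *\<^sub>R (y + k) = u *\<^sub>R x + v *\<^sub>R y + (u + v) *\<^sub>R k" by (simp add: algebra_simps)
      ultimately show "z \<in> \<Omega>" using uv by (simp add: k_def)
    qed
  qed
  obtain w0 where w0: "\<And>x y. x \<in> S \<Longrightarrow> y \<in> S \<Longrightarrow> \<exists>\<theta>\<in>{0..1}. w0 y - w0 x = mollified \<epsilon> (x + \<theta> *\<^sub>R (y - x)) \<bullet> (y - x)"
  proof (rule poincare_convex[OF S])
    show "a \<in> S" using a by (simp add: S_def)
    show "GDERIV (\<lambda>x. mollified \<epsilon> x $ i) x :> mollified_grad \<epsilon> i x" for i x by (rule GDERIV_mollified[OF e])
    show "continuous_on UNIV (mollified_grad \<epsilon> i)" for i by (rule mollified_grad_continuous[OF e])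
    show "mollified_grad \<epsilon> 1 x $ 2 = mollified_grad \<epsilon> 2 x $ 1" if "x \<in> S" for x
      by (rule mollified_curl_free[OF e _ curl]) (use that in \<open>auto simp: S_def\<close>)
  qed blast
  have "M-lipschitz_on S w0"
  proof (rule lipschitz_onI[OF _ M_nonneg])
    fix x y assume "x \<in> S" "y \<in> S"
    then obtain \<theta> where \<theta>: "w0 y - w0 x = mollified \<epsilon> (x + \<theta> *\<^sub>R (y - x)) \<bullet> (y - x)" using w0 by blast
    have "\<bar>w0 y - w0 x\<bar> \<le> norm (mollified \<epsilon> (x + \<theta> *\<^sub>R (y - x))) * norm (y - x)"
      unfolding \<theta> by (rule Cauchy_Schwarz_ineq2)
    also have "\<dots> \<le> M * norm (y - x)" by (intro mult_right_mono norm_mollified_le e) simp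
    finally show "dist (w0 x) (w0 y) \<le> M * dist x y" by (simp add: dist_real_def dist_norm abs_minus_commute norm_minus_commute)
  qed
  then obtain w1 where w1: "M-lipschitz_on UNIV w1" "\<And>x. x \<in> S \<Longrightarrow> w1 x = w0 x"
    by (rule lipschitz_extension) blast
  define w where "w x = w1 x - w1 a" for x
  show thesis
  proof (rule that[of w])
    show "M-lipschitz_on UNIV w" using w1(1) unfolding w_def lipschitz_on_def by (simp add: dist_real_def)
    show "w a = 0" by (simp add: w_def)
    fix x r assume r: "r > \<epsilon>" "cball x r \<subseteq> \<Omega>"
    have ballS: "y \<in> S" if "y \<in> ball x (r - \<epsilon>)" for y
    proof -
      have "cball y \<epsilon> \<subseteq> cball x r" using that by (auto simp: cball_subset_cball_iff dist_commute)
      then show ?thesis using r by (auto simp: S_def)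
    qed
    have xS: "x \<in> S" using ballS[of x] r by simp
    have cm: "isCont (mollified \<epsilon>) x"
    proof -
      have "isCont (\<lambda>x. mollified \<epsilon> x $ i) x" for i
        using GDERIV_mollified[OF e, of i x] unfolding gderiv_def by (rule has_derivative_continuous)
      then have "isCont (\<lambda>x. \<chi> i. mollified \<epsilon> x $ i) x" unfolding isCont_def by (intro tendsto_vec_lambda)
      then show ?thesis by simp
    qed
    have "GDERIV w x :> mollified \<epsilon> x"
      unfolding gderiv_def has_derivative_at_alt
    proof (intro conjI allI impI)
      show "bounded_linear (\<lambda>h. h \<bullet> mollified \<epsilon> x)" by (rule bounded_linear_inner_left)
      fix \<eta> :: real assume "\<eta> > 0"
      then obtain d where d: "d > 0" "\<And>z. dist z x < d \<Longrightarrow> dist (mollified \<epsilon> z) (mollified \<epsilon> x) < \<eta>"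
        using cm unfolding continuous_at_eps_delta by metis
      show "\<exists>d>0. \<forall>y. norm (y - x) < d \<longrightarrow> norm (w y - w x - (y - x) \<bullet> mollified \<epsilon> x) \<le> \<eta> * norm (y - x)"
      proof (intro exI[of _ "min d (r - \<epsilon>)"] conjI allI impI)
        fix y assume y: "norm (y - x) < min d (r - \<epsilon>)"
        have yS: "y \<in> S" by (rule ballS) (use y in \<open>simp add: dist_norm norm_minus_commute\<close>)
        obtain \<theta> where \<theta>: "\<theta> \<in> {0..1}" "w0 y - w0 x = mollified \<epsilon> (x + \<theta> *\<^sub>R (y - x)) \<bullet> (y - x)"
          using w0[OF xS yS] by blast
        have "norm (\<theta> *\<^sub>R (y - x)) \<le> norm (y - x)" using \<theta>(1) by (simp add: mult_left_le_one_le)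
        then have "dist (mollified \<epsilon> (x + \<theta> *\<^sub>R (y - x))) (mollified \<epsilon> x) < \<eta>" using y by (intro d(2)) (simp add: dist_norm)
        moreover have "w y - w x - (y - x) \<bullet> mollified \<epsilon> x = (mollified \<epsilon> (x + \<theta> *\<^sub>R (y - x)) - mollified \<epsilon> x) \<bullet> (y - x)"
          using \<theta>(2) by (simp add: w_def w1(2)[OF xS] w1(2)[OF yS] inner_diff_left inner_diff_right inner_commute)
        moreover have "\<bar>(mollified \<epsilon> (x + \<theta> *\<^sub>R (y - x)) - mollified \<epsilon> x) \<bullet> (y - x)\<bar> \<le> norm (mollified \<epsilon> (x + \<theta> *\<^sub>R (y - x)) - mollified \<epsilon> x) * norm (y - x)"
          by (rule Cauchy_Schwarz_ineq2)
        ultimately show "norm (w y - w x - (y - x) \<bullet> mollified \<epsilon> x) \<le> \<eta> * norm (y - x)"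
          by (smt (verit) dist_norm mult_right_mono norm_ge_zero real_norm_def)
      qed (use d r in auto)
    qed
    then show "grad w x = mollified \<epsilon> x" by (rule grad_eqI)
  qed
qed

text \<open>The potentials of the mollified fields are uniformly Lipschitz and agree at \<open>a\<close>, so a subsequence
converges uniformly on the closure of \<open>\<Omega>\<close>. Against test functions their gradients converge to \<open>G\<close>,
by the weak convergence of mollification, and to the gradient of the limit, by integration by parts.\<close>
lemma weak_poincare:
  assumes conv: "convex \<Omega>" and ne: "\<Omega> \<noteq> {}"
    and curl: "\<And>\<phi> D. D-lipschitz_on UNIV \<phi> \<Longrightarrow> compact (closure {x. \<phi> x \<noteq> 0}) \<Longrightarrow> closure {x. \<phi> x \<noteq> 0} \<subseteq> \<Omega>
        \<Longrightarrow> (LINT x|lebesgue. G x $ 1 * grad \<phi> x $ 2 - G x $ 2 * grad \<phi> x $ 1) = 0"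
  obtains v where "M-lipschitz_on UNIV v" "AE x in lebesgue. x \<in> \<Omega> \<longrightarrow> grad v x = G x"
proof -
  obtain a where "a \<in> \<Omega>" using ne by blast
  then obtain \<epsilon>0 where \<epsilon>0: "\<epsilon>0 > 0" "cball a \<epsilon>0 \<subseteq> \<Omega>" using \<Omega>_open open_contains_cball by blast
  define \<epsilon> where "\<epsilon> n = \<epsilon>0 * (1 / real (Suc n))" for n
  have \<epsilon>: "\<epsilon> n > 0" "\<epsilon> n \<le> \<epsilon>0" for n using \<epsilon>0(1) by (auto simp: \<epsilon>_def divide_le_eq)
  have \<epsilon>lim: "\<epsilon> \<longlonglongrightarrow> 0" unfolding \<epsilon>_def[abs_def] using tendsto_mult[OF tendsto_const step_tendsto_0, of \<epsilon>0] by simp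
  have "\<exists>w. M-lipschitz_on UNIV w \<and> w a = 0 \<and> (\<forall>x r. r > \<epsilon> n \<longrightarrow> cball x r \<subseteq> \<Omega> \<longrightarrow> grad w x = mollified (\<epsilon> n) x)" for n
  proof (rule mollified_potential[OF \<epsilon>(1)[of n] conv _ curl])
    show "cball a (\<epsilon> n) \<subseteq> \<Omega>" using \<epsilon>(2)[of n] \<epsilon>0(2) subset_cball by blast
  qed blast+
  then obtain W where W: "\<And>n. M-lipschitz_on UNIV (W n)" "\<And>n. W n a = 0"
     "\<And>n x r. r > \<epsilon> n \<Longrightarrow> cball x r \<subseteq> \<Omega> \<Longrightarrow> grad (W n) x = mollified (\<epsilon> n) x" by metis
  define S where "S = closure \<Omega>"
  have S: "compact S" using \<Omega>_bounded by (simp add: S_def)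
  obtain R where R: "\<And>x. x \<in> S \<Longrightarrow> dist a x \<le> R" using compact_imp_bounded[OF S] bounded_any_center[of S a] by auto
  obtain v0 and k :: "nat \<Rightarrow> nat" where v0: "continuous_on S v0" and k: "strict_mono k"
    and vlim: "\<And>e. 0 < e \<Longrightarrow> \<exists>N. \<forall>n x. n \<ge> N \<and> x \<in> S \<longrightarrow> norm (W (k n) x - v0 x) < e"
  proof (rule Arzela_Ascoli[OF S, of W "M * R"])
    show "norm (W n x) \<le> M * R" if "x \<in> S" for n x
    proof -
      have "\<bar>W n x - W n a\<bar> \<le> M * dist a x" using lipschitz_onD[OF W(1), of x a n] by (simp add: dist_real_def dist_commute)
      also have "\<dots> \<le> M * R" using R[OF that] M_nonneg by (intro mult_left_mono) auto
      finally show ?thesis by (simp add: W(2))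
    qed
    show "\<exists>d. 0 < d \<and> (\<forall>n y. y \<in> S \<and> norm (x - y) < d \<longrightarrow> norm (W n x - W n y) < e)" if "x \<in> S" "0 < e" for x e
    proof (intro exI[of _ "e / (M + 1)"] conjI allI impI)
      show "0 < e / (M + 1)" using that M_nonneg by simp
      fix n y assume "y \<in> S \<and> norm (x - y) < e / (M + 1)"
      then have "M * norm (x - y) \<le> M * (e / (M + 1))" using M_nonneg by (intro mult_left_mono) auto
      also have "\<dots> < e" using that M_nonneg by (simp add: field_simps)
      finally show "norm (W n x - W n y) < e"
        using lipschitz_onD[OF W(1), of x y n] by (simp add: dist_norm)
    qed
  qed blast
  have vpt: "(\<lambda>n. W (k n) x) \<longlonglongrightarrow> v0 x" if "x \<in> S" for x
    unfolding LIMSEQ_iff using vlim that by meson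
  have "M-lipschitz_on S v0"
  proof (rule lipschitz_onI[OF _ M_nonneg])
    fix x y assume xy: "x \<in> S" "y \<in> S"
    have "(\<lambda>n. dist (W (k n) x) (W (k n) y)) \<longlonglongrightarrow> dist (v0 x) (v0 y)" by (intro tendsto_dist vpt xy)
    then show "dist (v0 x) (v0 y) \<le> M * dist x y"
      by (rule LIMSEQ_le_const2) (use lipschitz_onD[OF W(1)] in auto)
  qed
  then obtain v where v: "M-lipschitz_on UNIV v" "\<And>x. x \<in> S \<Longrightarrow> v x = v0 x"
    by (rule lipschitz_extension) blast
  have kl: "(\<lambda>n. \<epsilon> (k n)) \<longlonglongrightarrow> 0" using LIMSEQ_subseq_LIMSEQ[OF \<epsilon>lim k] by (simp add: o_def)
  have comp: "AE x in lebesgue. x \<in> \<Omega> \<longrightarrow> grad v x $ i - G x $ i = 0" for i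
  proof (rule fundamental_lemma_calculus_of_variations[OF \<Omega>_open, where K="M + M"])
    have ind: "(indicator \<Omega> :: _ \<Rightarrow> real) \<in> borel_measurable lebesgue" by (rule open_indicator_measurable[OF \<Omega>_open])
    show "(\<lambda>x. indicator \<Omega> x * (grad v x $ i - G x $ i)) \<in> borel_measurable lebesgue"
      by (intro borel_measurable_times borel_measurable_diff ind grad_component_measurable[OF v(1)] Gi_meas)
    have gb: "\<bar>grad v x $ i\<bar> \<le> M" for x
      using norm_grad_le[OF v(1) open_UNIV UNIV_I, of x] component_le_norm_cart[of "grad v x" i] by linarith
    have Gb: "\<bar>G x $ i\<bar> \<le> M" for x using G_bound[of x] component_le_norm_cart[of "G x" i] by linarith
    have "\<bar>indicator \<Omega> x * (grad v x $ i - G x $ i)\<bar> \<le> M + M" for x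
      using gb[of x] Gb[of x] M_nonneg by (auto simp: indicator_def)
    then show "AE x in lebesgue. \<bar>indicator \<Omega> x * (grad v x $ i - G x $ i)\<bar> \<le> M + M" by simp
    fix \<phi> assume \<phi>: "test_function \<Omega> \<phi>"
    obtain D where D: "D-lipschitz_on UNIV \<phi>" "bounded {x. \<phi> x \<noteq> 0}"
      using test_function_lipschitz[OF \<phi>] by metis
    let ?C = "closure {x. \<phi> x \<noteq> 0}"
    have C: "compact ?C" "?C \<subseteq> \<Omega>" using \<phi> by (auto simp: test_function_def)
    have \<phi>m: "\<phi> \<in> borel_measurable lebesgue" by (rule borel_measurable_lebesgueI[OF lipschitz_borel_measurable[OF D(1)]])
    obtain L where L: "L \<ge> 0" "\<And>x. \<phi> x \<noteq> 0 \<Longrightarrow> \<bar>\<phi> x\<bar> \<le> L"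
      using lipschitz_bounded_on_bounded[OF lipschitz_on_subset[OF D(1) subset_UNIV] D(2)] by (metis (mono_tags) mem_Collect_eq)
    have Lall: "\<bar>\<phi> x\<bar> \<le> L * indicator \<Omega> x" for x
      using L test_function_vanishes(1)[OF \<phi>, of x] by (cases "\<phi> x = 0"; cases "x \<in> \<Omega>") auto
    have e1: "\<exists>d>0. \<forall>x\<in>?C. cball x d \<subseteq> \<Omega>"
    proof (cases "?C = {}")
      case True then show ?thesis by (auto intro: exI[of _ 1])
    next
      case False
      obtain d where d: "d > 0" "\<And>x y. x \<in> ?C \<Longrightarrow> y \<in> - \<Omega> \<Longrightarrow> d \<le> dist x y"
      proof -
        have "closed (- \<Omega>)" "?C \<inter> - \<Omega> = {}" using \<Omega>_open C(2) by auto
        from separate_compact_closed[OF C(1) this] show thesis using that by blast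
      qed
      have "\<forall>x\<in>?C. cball x (d/2) \<subseteq> \<Omega>"
      proof (intro ballI subsetI, rule ccontr)
        fix x y assume "x \<in> ?C" "y \<in> cball x (d/2)" "y \<notin> \<Omega>"
        then show False using d(2)[of x y] d(1) by simp
      qed
      then show ?thesis using d(1) by (intro exI[of _ "d/2"]) simp
    qed
    then obtain d where d: "d > 0" "\<And>x. x \<in> ?C \<Longrightarrow> cball x d \<subseteq> \<Omega>" by blast
    have "\<forall>\<^sub>F n in sequentially. \<epsilon> (k n) < d" using kl d(1) by (rule order_tendstoD)
    then have ev: "\<forall>\<^sub>F n in sequentially. - (LINT x|lebesgue. W (k n) x * grad \<phi> x $ i) = (LINT x|lebesgue. mollified (\<epsilon> (k n)) x $ i * \<phi> x)"
    proof eventually_elim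
      case (elim n)
      have "- (LINT x|lebesgue. W (k n) x * grad \<phi> x $ i) = (LINT x|lebesgue. grad (W (k n)) x $ i * \<phi> x)"
        by (simp add: integration_by_parts[OF W(1) D])
      also have "\<dots> = (LINT x|lebesgue. mollified (\<epsilon> (k n)) x $ i * \<phi> x)"
      proof (intro Bochner_Integration.integral_cong refl)
        fix x show "grad (W (k n)) x $ i * \<phi> x = mollified (\<epsilon> (k n)) x $ i * \<phi> x"
        proof (cases "\<phi> x = 0")
          case False
          then have "x \<in> ?C" using closure_subset[of "{x. \<phi> x \<noteq> 0}"] by auto
          then show ?thesis using W(3)[OF elim d(2)] by simp
        qed simp
      qed
      finally show ?case .
    qed
    have lim1: "(\<lambda>n. LINT x|lebesgue. mollified (\<epsilon> (k n)) x $ i * \<phi> x) \<longlonglongrightarrow> (LINT x|lebesgue. G x $ i * \<phi> x)"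
    proof (rule LIM_zero_cancel, rule Lim_null_comparison)
      show "\<forall>\<^sub>F n in sequentially. norm ((LINT x|lebesgue. mollified (\<epsilon> (k n)) x $ i * \<phi> x) - (LINT x|lebesgue. G x $ i * \<phi> x))
          \<le> M * (D * \<epsilon> (k n)) * measure lebesgue \<Omega>"
        using integral_mollified_times[OF \<epsilon>(1) D] by simp
      have "(\<lambda>n. M * (D * \<epsilon> (k n)) * measure lebesgue \<Omega>) \<longlonglongrightarrow> M * (D * 0) * measure lebesgue \<Omega>"
        by (intro tendsto_intros kl)
      then show "(\<lambda>n. M * (D * \<epsilon> (k n)) * measure lebesgue \<Omega>) \<longlonglongrightarrow> 0" by simp
    qed
    have lim2: "(\<lambda>n. LINT x|lebesgue. W (k n) x * grad \<phi> x $ i) \<longlonglongrightarrow> (LINT x|lebesgue. v x * grad \<phi> x $ i)"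
    proof (rule dominated_convergence_bounded_support[OF _ _ _ _ \<Omega>_bounded \<Omega>_sets])
      have wm: "w \<in> borel_measurable lebesgue" if "M-lipschitz_on UNIV w" for w :: "real ^ 2 \<Rightarrow> real"
        by (rule borel_measurable_lebesgueI[OF lipschitz_borel_measurable[OF that]])
      show "(\<lambda>x. W (k n) x * grad \<phi> x $ i) \<in> borel_measurable lebesgue" for n
        by (intro borel_measurable_times wm W grad_component_measurable[OF D(1)])
      show "(\<lambda>x. v x * grad \<phi> x $ i) \<in> borel_measurable lebesgue"
        by (intro borel_measurable_times wm v(1) grad_component_measurable[OF D(1)])
      have "(\<lambda>n. W (k n) x * grad \<phi> x $ i) \<longlonglongrightarrow> v x * grad \<phi> x $ i" for x
      proof (cases "x \<in> \<Omega>")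
        case True
        then have xS: "x \<in> S" using closure_subset[of \<Omega>] by (auto simp: S_def)
        show ?thesis using vpt[OF xS] v(2)[OF xS] by (intro tendsto_mult) auto
      next
        case False
        then show ?thesis using test_function_vanishes(2)[OF \<phi>] by simp
      qed
      then show "AE x in lebesgue. (\<lambda>n. W (k n) x * grad \<phi> x $ i) \<longlonglongrightarrow> v x * grad \<phi> x $ i" by simp
      have "\<bar>W (k n) x * grad \<phi> x $ i\<bar> \<le> (M * R * D) * indicator \<Omega> x" for n x
      proof (cases "x \<in> \<Omega>")
        case True
        then have xS: "x \<in> S" using closure_subset[of \<Omega>] by (auto simp: S_def)
        have "\<bar>W (k n) x - W (k n) a\<bar> \<le> M * dist a x" using lipschitz_onD[OF W(1), of x a "k n"] by (simp add: dist_real_def dist_commute)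
        also have "\<dots> \<le> M * R" using R[OF xS] M_nonneg by (intro mult_left_mono) auto
        finally have "\<bar>W (k n) x\<bar> \<le> M * R" by (simp add: W(2))
        moreover have "\<bar>grad \<phi> x $ i\<bar> \<le> D"
          using norm_grad_le[OF D(1) open_UNIV UNIV_I, of x] component_le_norm_cart[of "grad \<phi> x" i] by linarith
        ultimately have "\<bar>W (k n) x\<bar> * \<bar>grad \<phi> x $ i\<bar> \<le> (M * R) * D" by (intro mult_mono) auto
        then show ?thesis using True by (simp add: abs_mult)
      next
        case False
        then show ?thesis using test_function_vanishes(2)[OF \<phi>] by simp
      qed
      then show "AE x in lebesgue. \<bar>W (k n) x * grad \<phi> x $ i\<bar> \<le> (M * R * D) * indicator \<Omega> x" for n by simp
    qed
    have "(\<lambda>n. - (LINT x|lebesgue. W (k n) x * grad \<phi> x $ i)) \<longlonglongrightarrow> (LINT x|lebesgue. G x $ i * \<phi> x)"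
      by (rule Lim_transform_eventually[OF lim1]) (use ev in \<open>auto elim: eventually_mono\<close>)
    then have "- (LINT x|lebesgue. v x * grad \<phi> x $ i) = (LINT x|lebesgue. G x $ i * \<phi> x)"
      using LIMSEQ_unique tendsto_minus[OF lim2] by blast
    then have eq: "(LINT x|lebesgue. grad v x $ i * \<phi> x) = (LINT x|lebesgue. G x $ i * \<phi> x)"
      by (simp add: integration_by_parts[OF v(1) D])
    have i1: "integrable lebesgue (\<lambda>x. grad v x $ i * \<phi> x)"
    proof (rule integrable_bounded_support[OF _ _ \<Omega>_bounded \<Omega>_sets])
      show "(\<lambda>x. grad v x $ i * \<phi> x) \<in> borel_measurable lebesgue" by (intro borel_measurable_times grad_component_measurable[OF v(1)] \<phi>m)
      have "\<bar>grad v x $ i * \<phi> x\<bar> \<le> M * (L * indicator \<Omega> x)" for x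
        unfolding abs_mult using gb Lall M_nonneg by (intro mult_mono) auto
      then show "AE x in lebesgue. \<bar>grad v x $ i * \<phi> x\<bar> \<le> (M * L) * indicator \<Omega> x" by (simp add: mult.assoc)
    qed
    have i2: "integrable lebesgue (\<lambda>x. G x $ i * \<phi> x)"
    proof (rule conv_integrable[OF \<phi>m, of L])
      fix x show "\<bar>\<phi> x\<bar> \<le> L" using L by (cases "\<phi> x = 0") auto
    qed
    have "(LINT x|lebesgue. indicator \<Omega> x * (grad v x $ i - G x $ i) * \<phi> x) = (LINT x|lebesgue. grad v x $ i * \<phi> x - G x $ i * \<phi> x)"
      by (intro Bochner_Integration.integral_cong refl)
         (use test_function_vanishes(1)[OF \<phi>] in \<open>auto simp: indicator_def left_diff_distrib\<close>)
    then show "(LINT x|lebesgue. indicator \<Omega> x * (grad v x $ i - G x $ i) * \<phi> x) = 0"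
      by (simp add: Bochner_Integration.integral_diff[OF i1 i2] eq)
  qed
  have "AE x in lebesgue. x \<in> \<Omega> \<longrightarrow> grad v x = G x"
    using comp[of 1] comp[of 2] by eventually_elim (auto simp: vec_eq_iff forall_2)
  with v(1) show thesis by (rule that)
qed

end

section \<open>The conjugate function\<close>

lemma has_distributional_partial_cong:
  assumes "\<And>x. x \<in> \<Omega> \<Longrightarrow> v x = w x"
  shows "has_distributional_partial \<Omega> i v F \<longleftrightarrow> has_distributional_partial \<Omega> i w F"
proof -
  have "set_integrable lebesgue K v \<longleftrightarrow> set_integrable lebesgue K w" if "K \<subseteq> \<Omega>" for K
    using that assms by (intro set_integrable_cong) auto
  then have "locally_integrable \<Omega> v \<longleftrightarrow> locally_integrable \<Omega> w" by (auto simp: locally_integrable_def)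
  moreover have "(LINT x:\<Omega>|lebesgue. v x * grad \<phi> x $ i) = (LINT x:\<Omega>|lebesgue. w x * grad \<phi> x $ i)" for \<phi>
    unfolding set_lebesgue_integral_def using assms by (intro Bochner_Integration.integral_cong) (auto simp: indicator_def)
  ultimately show ?thesis by (simp add: has_distributional_partial_def)
qed

context radial_lagrangean
begin

lemma flux_on_domain:
  assumes "open \<Omega>" "\<And>x. x \<in> \<Omega> \<Longrightarrow> U x = u x" "x \<in> \<Omega>"
  shows "flux f u i x = B (grad U x) $ i"
  using grad_cong_open[OF assms(1,3), of u U] assms(2) by (simp add: flux_eq)

lemma flux_component:
  fixes u U :: "real ^ 2 \<Rightarrow> real"
  assumes "open \<Omega>" "C-lipschitz_on UNIV U" "\<And>x. x \<in> \<Omega> \<Longrightarrow> U x = u x"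
  shows "(\<lambda>x. indicator \<Omega> x * (s * flux f u i x)) \<in> borel_measurable lebesgue"
    and "x \<in> \<Omega> \<Longrightarrow> \<bar>flux f u i x\<bar> \<le> g C"
proof -
  have "(\<lambda>x. indicator \<Omega> x * (s * B (grad U x) $ i)) \<in> borel_measurable lebesgue"
    by (intro borel_measurable_times borel_measurable_const open_indicator_measurable assms(1) B_component_measurable[OF assms(2)])
  moreover have "(\<lambda>x. indicator \<Omega> x * (s * flux f u i x)) = (\<lambda>x. indicator \<Omega> x * (s * B (grad U x) $ i))"
    using flux_on_domain[OF assms(1,3)] by (auto simp: indicator_def)
  ultimately show "(\<lambda>x. indicator \<Omega> x * (s * flux f u i x)) \<in> borel_measurable lebesgue" by simp
  show "\<bar>flux f u i x\<bar> \<le> g C" if "x \<in> \<Omega>"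
    using flux_on_domain[OF assms(1,3) that, where i=i] B_grad_bound[OF assms(2) open_UNIV UNIV_I, of x]
      component_le_norm_cart[of "B (grad U x)" i] by simp
qed

text \<open>For Lipschitz functions the distributional system is a pointwise equation for the gradient almost
everywhere. \<open>U\<close> and \<open>V\<close> are global Lipschitz extensions; inside the open set \<open>\<Omega>\<close> they have the
gradients of \<open>u\<close> and \<open>v\<close>.\<close>
lemma conjugate_solution_grad:
  fixes u U v :: "real ^ 2 \<Rightarrow> real"
  assumes \<Omega>: "open \<Omega>" and U: "C-lipschitz_on UNIV U" "\<And>x. x \<in> \<Omega> \<Longrightarrow> U x = u x"
    and v: "conjugate_solution \<Omega> f u v"
  obtains D V where "D-lipschitz_on UNIV V" "\<And>x. x \<in> \<Omega> \<Longrightarrow> V x = v x"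
    "AE x in lebesgue. x \<in> \<Omega> \<longrightarrow> grad V x = rot (B (grad U x))"
proof -
  obtain D where "D-lipschitz_on \<Omega> v" using v by (auto simp: conjugate_solution_def Lip_def)
  then obtain V where V: "D-lipschitz_on UNIV V" "\<And>x. x \<in> \<Omega> \<Longrightarrow> V x = v x"
    by (rule lipschitz_extension) blast
  have cong: "has_distributional_partial \<Omega> i V F \<longleftrightarrow> has_distributional_partial \<Omega> i v F" for i F
    by (rule has_distributional_partial_cong) (rule V(2))
  have p: "has_distributional_partial \<Omega> 1 V (\<lambda>x. - flux f u 2 x)" "has_distributional_partial \<Omega> 2 V (flux f u 1)"
    using v unfolding cong by (auto simp: conjugate_solution_def)
  note fc = flux_component[OF \<Omega> U]
  have "AE x in lebesgue. x \<in> \<Omega> \<longrightarrow> grad V x $ 1 = - flux f u 2 x"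
    by (rule distributional_partial_eq_grad[OF \<Omega> V(1) _ _ p(1), of "g C"]) (use fc(1)[of "-1"] fc(2) in auto)
  moreover have "AE x in lebesgue. x \<in> \<Omega> \<longrightarrow> grad V x $ 2 = flux f u 1 x"
    by (rule distributional_partial_eq_grad[OF \<Omega> V(1) _ _ p(2), of "g C"]) (use fc(1)[of 1] fc(2) in auto)
  ultimately have "AE x in lebesgue. x \<in> \<Omega> \<longrightarrow> grad V x = rot (B (grad U x))"
    by eventually_elim (auto simp: vec_eq_iff forall_2 flux_on_domain[OF \<Omega> U(2)])
  with V show thesis by (rule that)
qed

text \<open>The constant \<open>c\<close> is the mean of the potential, which is subtracted to meet the normalisation.\<close>
lemma conjugate_solution_of_grad:
  fixes u U V :: "real ^ 2 \<Rightarrow> real"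
  assumes \<Omega>: "open \<Omega>" "bounded \<Omega>" "\<Omega> \<noteq> {}" and U: "C-lipschitz_on UNIV U" "\<And>x. x \<in> \<Omega> \<Longrightarrow> U x = u x"
    and V: "D-lipschitz_on UNIV V" "AE x in lebesgue. x \<in> \<Omega> \<longrightarrow> grad V x = rot (B (grad U x))"
  obtains c where "conjugate_solution \<Omega> f u (\<lambda>x. V x - c)"
proof -
  have \<Omega>s: "\<Omega> \<in> sets lebesgue" using \<Omega> by (simp add: borel_open)
  have \<Omega>l: "\<Omega> \<in> lmeasurable" by (rule bounded_set_imp_lmeasurable[OF \<Omega>(2) \<Omega>s])
  have pos: "measure lebesgue \<Omega> \<noteq> 0"
    using \<Omega> open_not_negligible[of \<Omega>] negligible_iff_measure[of \<Omega>] \<Omega>l by auto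
  note iV = lipschitz_indicator_integrable[OF \<Omega>(1,2) V(1)]
  define c where "c = (LINT x|lebesgue. indicator \<Omega> x * V x) / measure lebesgue \<Omega>"
  define W where "W x = V x - c" for x
  have ic: "integrable lebesgue (\<lambda>x. indicator \<Omega> x * c :: real)"
    using \<Omega>l by (intro integrable_mult_left) (simp add: lmeasurable_iff_integrable)
  have lipW: "D-lipschitz_on UNIV W" using V(1) unfolding W_def lipschitz_on_def by (simp add: dist_real_def)
  have gW: "grad W x = grad V x" if "GDERIV V x :> grad V x" for x
  proof -
    have "GDERIV (\<lambda>_. c) x :> 0" by (simp add: gderiv_def)
    from GDERIV_diff[OF that this] show ?thesis by (simp add: W_def[abs_def] grad_eqI)
  qed
  have aeW: "AE x in lebesgue. x \<in> \<Omega> \<longrightarrow> grad W x = rot (B (grad U x))"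
    using V(2) lipschitz_ae_differentiable[OF V(1)] by eventually_elim (auto simp: gW)
  note fc = flux_component[OF \<Omega>(1) U]
  have "conjugate_solution \<Omega> f u W"
    unfolding conjugate_solution_def
  proof (intro conjI)
    show "Lip \<Omega> W" unfolding Lip_def using lipschitz_on_subset[OF lipW subset_UNIV] by blast
    show "has_distributional_partial \<Omega> 1 W (\<lambda>x. - flux f u 2 x)"
    proof (rule grad_eq_distributional_partial[OF \<Omega>(1,2) lipW, of _ "g C"])
      show "AE x in lebesgue. x \<in> \<Omega> \<longrightarrow> grad W x $ 1 = - flux f u 2 x"
        using aeW by eventually_elim (auto simp: flux_on_domain[OF \<Omega>(1) U(2)])
    qed (use fc(1)[of "-1"] fc(2) in auto)
    show "has_distributional_partial \<Omega> 2 W (flux f u 1)"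
    proof (rule grad_eq_distributional_partial[OF \<Omega>(1,2) lipW, of _ "g C"])
      show "AE x in lebesgue. x \<in> \<Omega> \<longrightarrow> grad W x $ 2 = flux f u 1 x"
        using aeW by eventually_elim (auto simp: flux_on_domain[OF \<Omega>(1) U(2)])
    qed (use fc(1)[of 1] fc(2) in auto)
    have "(LINT x:\<Omega>|lebesgue. W x) = (LINT x|lebesgue. indicator \<Omega> x * V x - indicator \<Omega> x * c)"
      by (simp add: set_lebesgue_integral_def W_def right_diff_distrib)
    also have "\<dots> = (LINT x|lebesgue. indicator \<Omega> x * V x) - measure lebesgue \<Omega> * c"
      by (simp add: Bochner_Integration.integral_diff[OF iV ic])
    also have "\<dots> = 0" using pos by (simp add: c_def)
    finally show "(LINT x:\<Omega>|lebesgue. W x) = 0" .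
  qed
  then show thesis using that[of c] by (simp add: W_def[abs_def])
qed

lemma conjugate_solution_unique:
  fixes u U v w :: "real ^ 2 \<Rightarrow> real"
  assumes \<Omega>: "open \<Omega>" "bounded \<Omega>" "connected \<Omega>" and U: "C-lipschitz_on UNIV U" "\<And>x. x \<in> \<Omega> \<Longrightarrow> U x = u x"
    and v: "conjugate_solution \<Omega> f u v" and w: "conjugate_solution \<Omega> f u w" and x: "x \<in> \<Omega>"
  shows "w x = v x"
proof -
  obtain D V where V: "D-lipschitz_on UNIV V" "\<And>x. x \<in> \<Omega> \<Longrightarrow> V x = v x"
    "AE x in lebesgue. x \<in> \<Omega> \<longrightarrow> grad V x = rot (B (grad U x))"
    by (rule conjugate_solution_grad[OF \<Omega>(1) U v]) (assumption, rule that)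
  obtain E W where W: "E-lipschitz_on UNIV W" "\<And>x. x \<in> \<Omega> \<Longrightarrow> W x = w x"
    "AE x in lebesgue. x \<in> \<Omega> \<longrightarrow> grad W x = rot (B (grad U x))"
    by (rule conjugate_solution_grad[OF \<Omega>(1) U w]) (assumption, rule that)
  define z where "z x = W x - V x" for x
  have lz: "(E + D)-lipschitz_on UNIV z" unfolding z_def by (intro lipschitz_on_diff V W)
  have "AE x in lebesgue. x \<in> \<Omega> \<longrightarrow> grad z x = 0"
    using V(3) W(3) lipschitz_ae_differentiable[OF V(1)] lipschitz_ae_differentiable[OF W(1)]
    by eventually_elim (use GDERIV_diff grad_eqI in \<open>force simp: z_def[abs_def]\<close>)
  then have const: "z y = z x" if "y \<in> \<Omega>" for y
    by (rule constant_of_AE_grad_zero[OF lz \<Omega>(1,3) _ that x])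
  have \<Omega>l: "\<Omega> \<in> lmeasurable" using \<Omega> by (intro bounded_set_imp_lmeasurable) (simp_all add: borel_open)
  have pos: "measure lebesgue \<Omega> \<noteq> 0"
    using \<Omega>(1) x open_not_negligible[of \<Omega>] negligible_iff_measure[of \<Omega>] \<Omega>l by auto
  have ic: "integrable lebesgue (\<lambda>y. indicator \<Omega> y * z x :: real)"
    using \<Omega>l by (intro integrable_mult_left) (simp add: lmeasurable_iff_integrable)
  have iv: "integrable lebesgue (\<lambda>y. indicator \<Omega> y * v y)"
  proof -
    have "integrable lebesgue (\<lambda>x. indicator \<Omega> x * V x)"
      by (rule lipschitz_indicator_integrable[OF \<Omega>(1,2) V(1)])
    moreover have "(\<lambda>y. indicator \<Omega> y * V y) = (\<lambda>y. indicator \<Omega> y * v y)" using V(2) by (auto simp: indicator_def)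
    ultimately show ?thesis by simp
  qed
  have "0 = (LINT y|lebesgue. indicator \<Omega> y * w y)"
    using w by (simp add: conjugate_solution_def set_lebesgue_integral_def)
  also have "\<dots> = (LINT y|lebesgue. indicator \<Omega> y * v y + indicator \<Omega> y * z x)"
  proof (intro Bochner_Integration.integral_cong refl)
    fix y show "indicator \<Omega> y * w y = indicator \<Omega> y * v y + indicator \<Omega> y * z x"
    proof (cases "y \<in> \<Omega>")
      case True then show ?thesis using const[OF True] V(2)[OF True] W(2)[OF True] by (simp add: z_def)
    qed simp
  qed
  also have "\<dots> = measure lebesgue \<Omega> * z x"
    using v by (simp add: Bochner_Integration.integral_add[OF iv ic] conjugate_solution_def set_lebesgue_integral_def)
  finally have "z x = 0" using pos by simp
  then show ?thesis using V(2)[OF x] W(2)[OF x] by (simp add: z_def)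
qed

lemma conjugate_potential_exists:
  fixes u U :: "real ^ 2 \<Rightarrow> real"
  assumes \<Omega>: "open \<Omega>" "bounded \<Omega>" "\<Omega> \<noteq> {}" and min: "is_minimizer \<Omega> \<psi> f u"
    and U: "C-lipschitz_on UNIV U" "\<And>x. x \<in> closure \<Omega> \<Longrightarrow> U x = u x"
    and bsc: "bounded_slope_condition \<Omega> \<psi> Q"
  obtains D V where "D-lipschitz_on UNIV V" "AE x in lebesgue. x \<in> \<Omega> \<longrightarrow> grad V x = rot (B (grad U x))"
  using bounded_slope_affine_or_convex[OF \<Omega>(1,2) bsc]
proof (elim disjE exE)
  fix p c assume aff: "\<forall>x\<in>frontier \<Omega>. \<psi> x = p \<bullet> x + c"
  have gU: "AE x in lebesgue. x \<in> \<Omega> \<longrightarrow> grad U x = p"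
    by (rule affine_boundary_grad_constant[OF \<Omega>(1,2) min U]) (use aff in auto)
  define q where "q = rot (B p)"
  have G: "GDERIV (\<lambda>x. q \<bullet> x) x :> q" for x
    by (auto simp: gderiv_def inner_commute intro!: derivative_eq_intros)
  have gq: "grad (\<lambda>x. q \<bullet> x) x = q" for x by (rule grad_eqI[OF G])
  have "(norm q)-lipschitz_on UNIV (\<lambda>x. q \<bullet> x)"
    by (rule lipschitz_of_GDERIV_bound[OF _ G]) auto
  moreover have "AE x in lebesgue. x \<in> \<Omega> \<longrightarrow> grad (\<lambda>x. q \<bullet> x) x = rot (B (grad U x))"
    using gU by eventually_elim (simp add: gq q_def[symmetric])
  ultimately show thesis by (rule that)
next
  assume conv: "convex \<Omega>"
  define G where "G x = indicator \<Omega> x *\<^sub>R rot (B (grad U x))" for x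
  have C0: "C \<ge> 0" by (rule lipschitz_on_nonneg[OF U(1)])
  have Gm: "G \<in> borel_measurable lebesgue"
  proof -
    have "continuous_on UNIV rot"
      by (subst continuous_on_componentwise)
         (auto simp: Basis_vec_def inner_axis forall_2 rot_def intro!: continuous_intros)
    then have "rot \<in> borel_measurable borel" by (rule borel_measurable_continuous_onI)
    then have "(\<lambda>x. rot (B (grad U x))) \<in> borel_measurable lebesgue"
      by (rule measurable_compose[OF B_grad_measurable[OF U(1)]])
    then show ?thesis unfolding G_def[abs_def]
      by (intro borel_measurable_scaleR open_indicator_measurable \<Omega>)
  qed
  interpret bounded_field \<Omega> G "g C"
  proof
    show "norm (G x) \<le> g C" for x
      using B_grad_bound[OF U(1) open_UNIV UNIV_I, of x] g_nonneg[OF C0] by (auto simp: G_def indicator_def)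
  qed (use \<Omega> Gm in \<open>auto simp: G_def\<close>)
  obtain v where v: "(g C)-lipschitz_on UNIV v" "AE x in lebesgue. x \<in> \<Omega> \<longrightarrow> grad v x = G x"
  proof (rule weak_poincare[OF conv \<Omega>(3)])
    fix \<phi> :: "real ^ 2 \<Rightarrow> real" and D :: real assume \<phi>: "D-lipschitz_on UNIV \<phi>" "closure {x. \<phi> x \<noteq> 0} \<subseteq> \<Omega>"
    have fr: "\<phi> x = 0" if "x \<in> frontier \<Omega>" for x
      using that \<phi>(2) closure_subset[of "{x. \<phi> x \<noteq> 0}"] \<Omega>(1) by (auto simp: frontier_def interior_open)
    have "(LINT x|lebesgue. G x $ 1 * grad \<phi> x $ 2 - G x $ 2 * grad \<phi> x $ 1)
       = (LINT x|lebesgue. - (indicator \<Omega> x * (B (grad U x) \<bullet> grad \<phi> x)))"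
      by (intro Bochner_Integration.integral_cong refl) (simp add: G_def inner_2 algebra_simps)
    also have "\<dots> = 0" using euler_lagrange[OF \<Omega>(1,2) min U \<phi>(1) fr] by simp
    finally show "(LINT x|lebesgue. G x $ 1 * grad \<phi> x $ 2 - G x $ 2 * grad \<phi> x $ 1) = 0" .
  qed blast
  have "AE x in lebesgue. x \<in> \<Omega> \<longrightarrow> grad v x = rot (B (grad U x))"
    using v(2) by eventually_elim (simp add: G_def)
  with v(1) show thesis by (rule that)
qed

end

section \<open>The dual divergence equation\<close>

lemma grad_nth:
  fixes F :: "real ^ 'n \<Rightarrow> real"
  assumes "(F has_derivative F') (at x)"
  shows "grad F x $ j = F' (axis j 1)"
proof -
  have "F differentiable (at x)" using assms by (auto simp: differentiable_def)
  from GDERIV_grad[OF this] have "(F has_derivative (\<lambda>h. h \<bullet> grad F x)) (at x)" by (simp add: gderiv_def)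
  from has_derivative_unique[OF assms this] show ?thesis by (simp add: inner_axis')
qed

lemma
  fixes w \<eta> :: "real ^ 2 \<Rightarrow> real"
  assumes w: "C-lipschitz_on UNIV w" and \<eta>: "D-lipschitz_on UNIV \<eta>"
    and S: "bounded S" "S \<in> sets lebesgue" "\<And>x. x \<notin> S \<Longrightarrow> \<eta> x = 0"
  shows integrable_mult_grad: "integrable lebesgue (\<lambda>x. w x * grad \<eta> x $ i)"
    and integrable_grad_mult: "integrable lebesgue (\<lambda>x. grad w x $ i * \<eta> x)"
    and integrable_grad_mult_grad: "integrable lebesgue (\<lambda>x. grad w x $ i * grad \<eta> x $ j)"
proof -
  have C0: "C \<ge> 0" "D \<ge> 0" using lipschitz_on_nonneg[OF w] lipschitz_on_nonneg[OF \<eta>] by auto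
  obtain K where K: "K \<ge> 0" "\<And>x. x \<in> S \<Longrightarrow> \<bar>w x\<bar> \<le> K"
    using lipschitz_bounded_on_bounded[OF lipschitz_on_subset[OF w subset_UNIV] S(1)] by metis
  obtain L where L: "L \<ge> 0" "\<And>x. x \<in> S \<Longrightarrow> \<bar>\<eta> x\<bar> \<le> L"
    using lipschitz_bounded_on_bounded[OF lipschitz_on_subset[OF \<eta> subset_UNIV] S(1)] by metis
  have gw: "\<bar>grad w x $ i\<bar> \<le> C" and g\<eta>: "\<bar>grad \<eta> x $ i\<bar> \<le> D" for x i
    using norm_grad_le[OF w open_UNIV UNIV_I, of x] component_le_norm_cart[of "grad w x" i]
      norm_grad_le[OF \<eta> open_UNIV UNIV_I, of x] component_le_norm_cart[of "grad \<eta> x" i] by linarith+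
  have z: "AE x in lebesgue. x \<notin> S \<longrightarrow> grad \<eta> x = 0"
    using AE_grad_zero_on_zero_set[OF \<eta>] by eventually_elim (auto simp: S(3))
  note meas = borel_measurable_lebesgueI[OF lipschitz_borel_measurable] grad_component_measurable
  show "integrable lebesgue (\<lambda>x. w x * grad \<eta> x $ i)"
  proof (rule integrable_bounded_support[OF _ _ S(1,2)])
    show "AE x in lebesgue. \<bar>w x * grad \<eta> x $ i\<bar> \<le> (K * D) * indicator S x"
      using z by eventually_elim (auto simp: indicator_def abs_mult intro!: mult_mono K g\<eta>)
  qed (intro borel_measurable_times meas(1)[OF w] meas(2)[OF \<eta>])
  show "integrable lebesgue (\<lambda>x. grad w x $ i * \<eta> x)"
  proof (rule integrable_bounded_support[OF _ _ S(1,2)])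
    show "AE x in lebesgue. \<bar>grad w x $ i * \<eta> x\<bar> \<le> (C * L) * indicator S x"
      by (intro AE_I2) (auto simp: indicator_def abs_mult S(3) intro!: mult_mono L gw C0)
  qed (intro borel_measurable_times meas(1)[OF \<eta>] meas(2)[OF w])
  show "integrable lebesgue (\<lambda>x. grad w x $ i * grad \<eta> x $ j)"
  proof (rule integrable_bounded_support[OF _ _ S(1,2)])
    show "AE x in lebesgue. \<bar>grad w x $ i * grad \<eta> x $ j\<bar> \<le> (C * D) * indicator S x"
      using z by eventually_elim (auto simp: indicator_def abs_mult intro!: mult_mono C0 gw g\<eta>)
  qed (intro borel_measurable_times meas(2)[OF \<eta>] meas(2)[OF w])
qed

text \<open>The operator of the dual equation with the coefficient as a free parameter, so that continuity in the
coefficient can be used.\<close>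
definition degenerate_op :: "real \<Rightarrow> real ^ 'n \<Rightarrow> real ^ 'n ^ 'n \<Rightarrow> real" where
  "degenerate_op a p X = - (1 - a) * ((X *v p) \<bullet> p) - (norm p)\<^sup>2 * a * trace X"

lemma dual_operator_eq: "dual_operator f p X = degenerate_op (alpha f (gprime f (norm p))) p X"
  by (simp add: dual_operator_def degenerate_op_def)

locale C2_lagrangean = radial_lagrangean +
  fixes lam :: real
  assumes C2: "C2_Holder_loc lam f"
begin

abbreviation g' :: "real \<Rightarrow> real" where "g' \<equiv> hderiv2 f"

lemma g_deriv: assumes "\<rho> > 0" shows "DERIV g \<rho> :> g' \<rho>"
proof -
  have "g differentiable (at \<rho>)"
    using C2 assms by (auto simp: C2_Holder_loc_def differentiable_on_def at_within_open[of _ "{0<..}"])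
  then show ?thesis by (simp add: hderiv2_def DERIV_deriv_iff_real_differentiable)
qed

lemma g'_cont: "continuous_on {0<..} g'" using C2 by (simp add: C2_Holder_loc_def)

text \<open>Only the weak inequality holds: the second derivative of a strictly convex function may vanish at some points.\<close>
lemma g'_nonneg: assumes "\<rho> > 0" shows "g' \<rho> \<ge> 0"
proof (rule ccontr)
  assume "\<not> ?thesis"
  then obtain d where d: "d > 0" "\<And>h. 0 < h \<Longrightarrow> h < d \<Longrightarrow> g (\<rho> + h) < g \<rho>"
    using DERIV_neg_dec_right[OF g_deriv[OF assms]] by (auto simp: not_le)
  then have "g (\<rho> + d/2) < g \<rho>" by simp
  then show False using g_mono[of \<rho> "\<rho> + d/2"] d(1) assms by simp
qed

text \<open>Where \<open>f''\<close> vanishes the inverse of \<open>f'\<close> is not differentiable. Adding \<open>\<epsilon> * \<rho>\<close> makes the derivative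
positive and the inverse \<open>1 / \<epsilon>\<close>-Lipschitz; \<open>reg_field \<epsilon>\<close> is the corresponding inverse of
\<open>B + \<epsilon> id\<close>, and \<open>reg_alpha \<epsilon>\<close> the derivative of the regularised
function in logarithmic coordinates.\<close>
definition reg_g :: "real \<Rightarrow> real \<Rightarrow> real" where "reg_g \<epsilon> \<rho> = g \<rho> + \<epsilon> * \<rho>"

definition reg_inv :: "real \<Rightarrow> real \<Rightarrow> real" where "reg_inv \<epsilon> = inv_into {0..} (reg_g \<epsilon>)"

lemma reg_g_strict_mono: "\<epsilon> \<ge> 0 \<Longrightarrow> 0 \<le> x \<Longrightarrow> x < y \<Longrightarrow> reg_g \<epsilon> x < reg_g \<epsilon> y"
  unfolding reg_g_def using g_strict_mono[of x y] mult_left_mono[of x y \<epsilon>] by simp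

lemma reg_inv_reg_g: assumes "\<epsilon> \<ge> 0" "\<rho> \<ge> 0" shows "reg_inv \<epsilon> (reg_g \<epsilon> \<rho>) = \<rho>"
  unfolding reg_inv_def
proof (rule inv_into_f_f)
  show "inj_on (reg_g \<epsilon>) {0..}"
    using reg_g_strict_mono[OF assms(1)] by (intro linorder_inj_onI) (auto simp: less_imp_neq)
qed (use assms in auto)

text \<open>The inverse is meaningful only on the range; values squeezed between two attained values are attained,
by the intermediate value theorem.\<close>
lemma reg_inv_between:
  assumes e: "\<epsilon> \<ge> 0" and \<rho>: "0 \<le> \<rho>1" "\<rho>1 \<le> \<rho>2" and s: "reg_g \<epsilon> \<rho>1 < s" "s < reg_g \<epsilon> \<rho>2"
  shows "\<rho>1 < reg_inv \<epsilon> s" "reg_inv \<epsilon> s < \<rho>2" "reg_g \<epsilon> (reg_inv \<epsilon> s) = s"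
proof -
  have "continuous_on {\<rho>1..\<rho>2} (reg_g \<epsilon>)"
    unfolding reg_g_def[abs_def] using \<rho> by (intro continuous_intros continuous_on_subset[OF g_cont]) auto
  then obtain \<rho> where r: "\<rho> \<ge> \<rho>1" "\<rho> \<le> \<rho>2" "reg_g \<epsilon> \<rho> = s"
    using IVT'[of "reg_g \<epsilon>" \<rho>1 s \<rho>2] s \<rho> by auto
  then have "reg_inv \<epsilon> s = \<rho>" using reg_inv_reg_g[OF e, of \<rho>] \<rho> by auto
  then show "\<rho>1 < reg_inv \<epsilon> s" "reg_inv \<epsilon> s < \<rho>2" "reg_g \<epsilon> (reg_inv \<epsilon> s) = s"
    using r s by (auto simp: less_le)
qed

lemma reg_inv_0: "reg_inv 0 = gprime f"
  by (simp add: reg_inv_def gprime_def reg_g_def[abs_def])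

definition reg_field :: "real \<Rightarrow> real ^ 2 \<Rightarrow> real ^ 2" where
  "reg_field \<epsilon> p = (reg_inv \<epsilon> (norm p) / norm p) *\<^sub>R p"

definition reg_alpha :: "real \<Rightarrow> real \<Rightarrow> real" where
  "reg_alpha \<epsilon> \<rho> = \<rho> * (g' \<rho> + \<epsilon>) / reg_g \<epsilon> \<rho>"

lemma B_reg_field:
  assumes "reg_inv \<epsilon> (norm p) > 0" "reg_g \<epsilon> (reg_inv \<epsilon> (norm p)) = norm p" "p \<noteq> 0"
  shows "B (reg_field \<epsilon> p) + \<epsilon> *\<^sub>R reg_field \<epsilon> p = p" "norm (reg_field \<epsilon> p) = reg_inv \<epsilon> (norm p)"
proof -
  define \<rho> where "\<rho> = reg_inv \<epsilon> (norm p)"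
  have \<rho>: "\<rho> > 0" "g \<rho> + \<epsilon> * \<rho> = norm p" using assms by (auto simp: \<rho>_def reg_g_def)
  show n: "norm (reg_field \<epsilon> p) = reg_inv \<epsilon> (norm p)" using assms by (simp add: reg_field_def)
  then have nz: "reg_field \<epsilon> p \<noteq> 0" using assms by auto
  have "B (reg_field \<epsilon> p) + \<epsilon> *\<^sub>R reg_field \<epsilon> p = ((g \<rho> / \<rho> + \<epsilon>) * (\<rho> / norm p)) *\<^sub>R p"
    using nz n by (simp add: B_def reg_field_def \<rho>_def[symmetric] algebra_simps)
  also have "(g \<rho> / \<rho> + \<epsilon>) * (\<rho> / norm p) = 1" using \<rho> assms(3) by (simp add: field_simps)
  finally show "B (reg_field \<epsilon> p) + \<epsilon> *\<^sub>R reg_field \<epsilon> p = p" by simp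
qed

lemma strong_monotone_bound:
  assumes "\<epsilon> > 0" shows "\<epsilon> * norm (p - q) \<le> norm ((B p + \<epsilon> *\<^sub>R p) - (B q + \<epsilon> *\<^sub>R q))"
proof -
  define d where "d = (B p + \<epsilon> *\<^sub>R p) - (B q + \<epsilon> *\<^sub>R q)"
  have "\<epsilon> * (norm (p - q) * norm (p - q)) \<le> (p - q) \<bullet> d"
  proof -
    have "(p - q) \<bullet> d = (p - q) \<bullet> (B p - B q) + \<epsilon> * ((p - q) \<bullet> (p - q))"
      by (simp add: d_def algebra_simps)
    then show ?thesis using B_mono[of p q] by (simp add: dot_square_norm power2_eq_square)
  qed
  also have "\<dots> \<le> norm (p - q) * norm d" by (rule norm_cauchy_schwarz)
  finally show ?thesis unfolding d_def[symmetric] by (cases "p = q") auto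
qed

text \<open>The inverse function theorem in one variable; the required continuity is the Lipschitz bound.\<close>
lemma reg_inv_DERIV:
  assumes e: "\<epsilon> > 0" and s: "m1 < s" "s < m2"
    and inv: "\<And>s. m1 < s \<Longrightarrow> s < m2 \<Longrightarrow> reg_inv \<epsilon> s > 0 \<and> reg_g \<epsilon> (reg_inv \<epsilon> s) = s"
  shows "DERIV (reg_inv \<epsilon>) s :> inverse (g' (reg_inv \<epsilon> s) + \<epsilon>)"
proof (rule DERIV_inverse_function[OF _ _ s])
  have pos: "reg_inv \<epsilon> s > 0" using inv s by blast
  show "DERIV (reg_g \<epsilon>) (reg_inv \<epsilon> s) :> g' (reg_inv \<epsilon> s) + \<epsilon>"
    unfolding reg_g_def[abs_def] using g_deriv[OF pos] by (auto intro!: derivative_eq_intros)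
  show "g' (reg_inv \<epsilon> s) + \<epsilon> \<noteq> 0" using g'_nonneg[OF pos] e by simp
  show "reg_g \<epsilon> (reg_inv \<epsilon> y) = y" if "m1 < y" "y < m2" for y using inv that by blast
  have lip: "\<epsilon> * \<bar>reg_inv \<epsilon> y - reg_inv \<epsilon> z\<bar> \<le> \<bar>y - z\<bar>" if yz: "m1 < y" "y < m2" "m1 < z" "z < m2" for y z
  proof -
    define a b where "a = reg_inv \<epsilon> y" and "b = reg_inv \<epsilon> z"
    have ab: "a > 0" "b > 0" "g a + \<epsilon> * a = y" "g b + \<epsilon> * b = z" using inv yz by (auto simp: a_def b_def reg_g_def)
    consider "a \<le> b" | "b \<le> a" by linarith
    then show ?thesis
    proof cases
      case 1
      then have "g a \<le> g b" "\<epsilon> * a \<le> \<epsilon> * b" using ab e by (auto intro: g_mono)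
      then show ?thesis unfolding a_def[symmetric] b_def[symmetric] using 1 ab(3,4) e by (simp add: algebra_simps)
    next
      case 2
      then have "g b \<le> g a" "\<epsilon> * b \<le> \<epsilon> * a" using ab e by (auto intro: g_mono)
      then show ?thesis unfolding a_def[symmetric] b_def[symmetric] using 2 ab(3,4) e by (simp add: algebra_simps)
    qed
  qed
  have "(1/\<epsilon>)-lipschitz_on {m1<..<m2} (reg_inv \<epsilon>)"
    using lip e by (intro lipschitz_onI) (auto simp: dist_real_def field_simps)
  then have "continuous_on {m1<..<m2} (reg_inv \<epsilon>)" by (rule lipschitz_on_continuous_on)
  then show "isCont (reg_inv \<epsilon>) s" using s by (simp add: continuous_on_eq_continuous_at)
qed

text \<open>With \<open>s = |P|\<close>, \<open>\<rho> = reg_inv \<epsilon> s\<close> and \<open>b\<close> the derivative of the regularised function at \<open>\<rho>\<close>,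
the product rule gives \<open>(\<rho> / s) tr Y + ((1 / b - \<rho> / s) / s\<^sup>2) (Y P \<bullet> P)\<close>. The coefficient
is \<open>\<alpha> = \<rho> b / s\<close>, so \<open>1 / b = \<rho> / (\<alpha> s)\<close>, and the factor \<open>\<rho> / (\<alpha> s\<^sup>3)\<close>
can be taken out.\<close>
lemma divergence_reg_field:
  fixes P :: "real ^ 2 \<Rightarrow> real ^ 2"
  assumes e: "\<epsilon> > 0" and P: "(P has_derivative (\<lambda>h. Y *v h)) (at x)"
    and m: "0 \<le> m1" "m1 < norm (P x)" "norm (P x) < m2"
    and inv: "\<And>s. m1 < s \<Longrightarrow> s < m2 \<Longrightarrow> reg_inv \<epsilon> s > 0 \<and> reg_g \<epsilon> (reg_inv \<epsilon> s) = s"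
    and \<rho>: "\<rho> = reg_inv \<epsilon> (norm (P x))"
  shows "grad (\<lambda>x. reg_field \<epsilon> (P x) $ 1) x $ 1 + grad (\<lambda>x. reg_field \<epsilon> (P x) $ 2) x $ 2
     = - (\<rho> / (norm (P x) ^ 3 * reg_alpha \<epsilon> \<rho>)) * degenerate_op (reg_alpha \<epsilon> \<rho>) (P x) Y"
    and "reg_alpha \<epsilon> \<rho> > 0"
proof -
  define s b where "s = norm (P x)" and "b = g' \<rho> + \<epsilon>"
  have s0: "s > 0" using m unfolding s_def by linarith
  have nz: "P x \<noteq> 0" using s0 unfolding s_def by simp
  have \<rho>0: "\<rho> > 0" "reg_g \<epsilon> \<rho> = s" using inv[of s] m by (auto simp: \<rho> s_def)
  have b0: "b > 0" using g'_nonneg[OF \<rho>0(1)] e by (simp add: b_def)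
  have al: "reg_alpha \<epsilon> \<rho> = \<rho> * b / s" by (simp add: reg_alpha_def b_def \<rho>0)
  then show al0: "reg_alpha \<epsilon> \<rho> > 0" using \<rho>0 b0 s0 by simp
  have \<gamma>: "DERIV (reg_inv \<epsilon>) s :> inverse b"
    using reg_inv_DERIV[OF e, of m1 s m2] m inv by (simp add: s_def b_def \<rho>)
  define \<kappa>' where "\<kappa>' = (inverse b * s - \<rho>) / (s * s)"
  have \<kappa>: "DERIV (\<lambda>s. reg_inv \<epsilon> s / s) s :> \<kappa>'"
    using DERIV_divide[OF \<gamma> DERIV_ident] s0 by (simp add: \<kappa>'_def \<rho> s_def)
  have N: "((\<lambda>x. norm (P x)) has_derivative (\<lambda>h. (Y *v h) \<bullet> sgn (P x))) (at x)"
    by (rule has_derivative_compose[OF P has_derivative_norm[OF nz]])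
  have \<kappa>N: "((\<lambda>x. reg_inv \<epsilon> (norm (P x)) / norm (P x)) has_derivative (\<lambda>h. \<kappa>' * ((Y *v h) \<bullet> sgn (P x)))) (at x)"
    by (rule has_derivative_compose[OF N, where g="\<lambda>s. reg_inv \<epsilon> s / s" and g'="\<lambda>h. \<kappa>' * h"])
       (use \<kappa> in \<open>simp add: has_field_derivative_def s_def\<close>)
  have Pi: "((\<lambda>x. P x $ i) has_derivative (\<lambda>h. (Y *v h) $ i)) (at x)" for i
    by (rule bounded_linear.has_derivative[OF bounded_linear_vec_nth P])
  have gi: "grad (\<lambda>x. reg_field \<epsilon> (P x) $ i) x $ j = \<rho> / s * Y $ i $ j + \<kappa>' * (column j Y \<bullet> sgn (P x)) * P x $ i" for i j
    using grad_nth[OF has_derivative_mult[OF \<kappa>N Pi[of i]], of j]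
    by (simp add: reg_field_def \<rho> s_def matrix_vector_mult_basis column_def)
  have sum: "(column 1 Y \<bullet> sgn (P x)) * P x $ 1 + (column 2 Y \<bullet> sgn (P x)) * P x $ 2 = ((Y *v P x) \<bullet> P x) / s"
    by (simp add: sgn_div_norm s_def inner_2 column_def matrix_vector_mult_def sum_2 add_divide_distrib divide_inverse algebra_simps)
  define q where "q = (Y *v P x) \<bullet> P x"
  have "grad (\<lambda>x. reg_field \<epsilon> (P x) $ 1) x $ 1 + grad (\<lambda>x. reg_field \<epsilon> (P x) $ 2) x $ 2
     = \<rho> / s * trace Y + \<kappa>' * ((column 1 Y \<bullet> sgn (P x)) * P x $ 1 + (column 2 Y \<bullet> sgn (P x)) * P x $ 2)"
    unfolding gi by (simp add: trace_def sum_2 algebra_simps)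
  also have "\<dots> = \<rho> / s * trace Y + \<kappa>' * (q / s)" by (simp add: sum q_def)
  also have "\<dots> = - (\<rho> / (s ^ 3 * (\<rho> * b / s))) * (- (1 - \<rho> * b / s) * q - s\<^sup>2 * (\<rho> * b / s) * trace Y)"
    using s0 b0 \<rho>0(1) by (simp add: \<kappa>'_def field_simps power2_eq_square power3_eq_cube)
  finally show "grad (\<lambda>x. reg_field \<epsilon> (P x) $ 1) x $ 1 + grad (\<lambda>x. reg_field \<epsilon> (P x) $ 2) x $ 2
     = - (\<rho> / (norm (P x) ^ 3 * reg_alpha \<epsilon> \<rho>)) * degenerate_op (reg_alpha \<epsilon> \<rho>) (P x) Y"
    by (simp add: al degenerate_op_def q_def s_def)
qed

text \<open>Where the operator is positive the divergence is negative; multiply by \<open>\<eta> \<ge> 0\<close> and integrate by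
parts. The regularised field is Lipschitz by the strong monotonicity of \<open>B + \<epsilon> id\<close>, so the
integration by parts formula for Lipschitz functions applies to its components.\<close>
lemma reg_field_weak_supersolution:
  fixes P :: "real ^ 2 \<Rightarrow> real ^ 2"
  assumes e: "\<epsilon> > 0" and S: "open S" "bounded S"
    and P: "\<And>x. x \<in> S \<Longrightarrow> (P has_derivative (\<lambda>h. Y x *v h)) (at x)"
    and Plip: "\<And>x y. x \<in> S \<Longrightarrow> y \<in> S \<Longrightarrow> norm (P x - P y) \<le> L * norm (x - y)" and L0: "L \<ge> 0"
    and m: "0 \<le> m1" "\<And>x. x \<in> S \<Longrightarrow> m1 < norm (P x) \<and> norm (P x) < m2"
    and inv: "\<And>s. m1 < s \<Longrightarrow> s < m2 \<Longrightarrow> reg_inv \<epsilon> s > 0 \<and> reg_g \<epsilon> (reg_inv \<epsilon> s) = s"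
    and pos: "\<And>x. x \<in> S \<Longrightarrow> 0 < degenerate_op (reg_alpha \<epsilon> (reg_inv \<epsilon> (norm (P x)))) (P x) (Y x)"
    and \<eta>: "D-lipschitz_on UNIV \<eta>" "\<And>x. 0 \<le> \<eta> x" "\<And>x. x \<notin> S \<Longrightarrow> \<eta> x = 0"
  shows "(\<lambda>x. indicator S x *\<^sub>R reg_field \<epsilon> (P x)) \<in> borel_measurable lebesgue"
    and "0 \<le> (LINT x|lebesgue. indicator S x * (reg_field \<epsilon> (P x) \<bullet> grad \<eta> x))"
proof -
  have Ss: "S \<in> sets lebesgue" using S by (simp add: borel_open)
  have bnd: "bounded {x. \<eta> x \<noteq> 0}" by (rule bounded_subset[OF S(2)]) (use \<eta>(3) in auto)
  have Beq: "B (reg_field \<epsilon> (P x)) + \<epsilon> *\<^sub>R reg_field \<epsilon> (P x) = P x" if "x \<in> S" for x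
  proof (rule B_reg_field(1))
    show "reg_inv \<epsilon> (norm (P x)) > 0" "reg_g \<epsilon> (reg_inv \<epsilon> (norm (P x))) = norm (P x)"
      using inv m(2)[OF that] by blast+
    show "P x \<noteq> 0" using m(1) m(2)[OF that] by auto
  qed
  have lipW: "(L / \<epsilon>)-lipschitz_on S (\<lambda>x. reg_field \<epsilon> (P x) $ i)" for i
  proof (rule lipschitz_onI)
    fix x y assume xy: "x \<in> S" "y \<in> S"
    have "\<epsilon> * norm (reg_field \<epsilon> (P x) - reg_field \<epsilon> (P y)) \<le> norm (P x - P y)"
      using strong_monotone_bound[OF e, of "reg_field \<epsilon> (P x)" "reg_field \<epsilon> (P y)"] by (simp add: Beq xy)
    also have "\<dots> \<le> L * norm (x - y)" by (rule Plip[OF xy])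
    finally have "norm (reg_field \<epsilon> (P x) - reg_field \<epsilon> (P y)) \<le> L / \<epsilon> * norm (x - y)" using e by (simp add: field_simps)
    then show "dist (reg_field \<epsilon> (P x) $ i) (reg_field \<epsilon> (P y) $ i) \<le> L / \<epsilon> * dist x y"
      using component_le_norm_cart[of "reg_field \<epsilon> (P x) - reg_field \<epsilon> (P y)" i] by (simp add: dist_real_def dist_norm)
  qed (use e L0 in simp)
  have "\<exists>w. (L / \<epsilon>)-lipschitz_on UNIV w \<and> (\<forall>x\<in>S. w x = reg_field \<epsilon> (P x) $ i)" for i
    by (rule lipschitz_extension[OF lipW[of i]]) blast
  then obtain W where W: "\<And>i. (L / \<epsilon>)-lipschitz_on UNIV (W i)" "\<And>i x. x \<in> S \<Longrightarrow> W i x = reg_field \<epsilon> (P x) $ i" by metis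
  have "(\<lambda>x. indicator S x *\<^sub>R (\<chi> i. W i x)) \<in> borel_measurable lebesgue"
  proof (intro borel_measurable_scaleR open_indicator_measurable S(1) borel_measurable_lebesgueI borel_measurable_continuous_onI)
    show "continuous_on UNIV (\<lambda>x. \<chi> i. W i x)"
      by (intro continuous_on_vec_lambda lipschitz_on_continuous_on[OF W(1)])
  qed
  also have "(\<lambda>x. indicator S x *\<^sub>R (\<chi> i. W i x)) = (\<lambda>x. indicator S x *\<^sub>R reg_field \<epsilon> (P x))"
    by (auto simp: fun_eq_iff vec_eq_iff W(2) indicator_def)
  finally show "(\<lambda>x. indicator S x *\<^sub>R reg_field \<epsilon> (P x)) \<in> borel_measurable lebesgue" .
  have gW: "grad (W i) x = grad (\<lambda>x. reg_field \<epsilon> (P x) $ i) x" if "x \<in> S" for i x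
    by (rule grad_cong_open[OF S(1) that W(2)])
  note I1 = integrable_mult_grad[OF W(1) \<eta>(1) S(2) Ss \<eta>(3)] and I2 = integrable_grad_mult[OF W(1) \<eta>(1) S(2) Ss \<eta>(3)]
  have "(LINT x|lebesgue. indicator S x * (reg_field \<epsilon> (P x) \<bullet> grad \<eta> x)) = (LINT x|lebesgue. W 1 x * grad \<eta> x $ 1 + W 2 x * grad \<eta> x $ 2)"
  proof (rule integral_cong_AE)
    have "(\<lambda>x. (indicator S x *\<^sub>R reg_field \<epsilon> (P x)) \<bullet> grad \<eta> x) \<in> borel_measurable lebesgue"
      by (intro borel_measurable_inner grad_measurable[OF \<eta>(1)]) fact
    then show "(\<lambda>x. indicator S x * (reg_field \<epsilon> (P x) \<bullet> grad \<eta> x)) \<in> borel_measurable lebesgue" by simp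
    show "(\<lambda>x. W 1 x * grad \<eta> x $ 1 + W 2 x * grad \<eta> x $ 2) \<in> borel_measurable lebesgue"
      by (rule borel_measurable_integrable[OF Bochner_Integration.integrable_add[OF I1 I1]])
    show "AE x in lebesgue. indicator S x * (reg_field \<epsilon> (P x) \<bullet> grad \<eta> x) = W 1 x * grad \<eta> x $ 1 + W 2 x * grad \<eta> x $ 2"
      using AE_grad_zero_on_zero_set[OF \<eta>(1)] by eventually_elim (auto simp: indicator_def inner_2 W(2) \<eta>(3))
  qed
  also have "\<dots> = (LINT x|lebesgue. W 1 x * grad \<eta> x $ 1) + (LINT x|lebesgue. W 2 x * grad \<eta> x $ 2)"
    by (rule Bochner_Integration.integral_add[OF I1 I1])
  also have "\<dots> = - ((LINT x|lebesgue. grad (W 1) x $ 1 * \<eta> x) + (LINT x|lebesgue. grad (W 2) x $ 2 * \<eta> x))"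
    by (simp add: integration_by_parts[OF W(1) \<eta>(1) bnd])
  also have "\<dots> = (LINT x|lebesgue. - (grad (W 1) x $ 1 * \<eta> x + grad (W 2) x $ 2 * \<eta> x))"
    unfolding Bochner_Integration.integral_minus neg_equal_iff_equal
    by (rule Bochner_Integration.integral_add[OF I2 I2, symmetric])
  also have "\<dots> \<ge> 0"
  proof (rule Bochner_Integration.integral_nonneg)
    fix x
    show "0 \<le> - (grad (W 1) x $ 1 * \<eta> x + grad (W 2) x $ 2 * \<eta> x)"
    proof (cases "x \<in> S")
      case True
      define \<rho> where "\<rho> = reg_inv \<epsilon> (norm (P x))"
      note dv = divergence_reg_field[OF e P[OF True] m(1) _ _ inv \<rho>_def]
      have m': "m1 < norm (P x)" "norm (P x) < m2" using m(2)[OF True] by auto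
      have "\<rho> > 0" using inv m' by (auto simp: \<rho>_def)
      moreover have "reg_alpha \<epsilon> \<rho> > 0" using dv(2) m' by blast
      moreover have "norm (P x) > 0" using m(1) m' by linarith
      ultimately have "(\<rho> / (norm (P x) ^ 3 * reg_alpha \<epsilon> \<rho>)) * degenerate_op (reg_alpha \<epsilon> \<rho>) (P x) (Y x) \<ge> 0"
        using pos[OF True] by (simp add: \<rho>_def)
      then have "grad (W 1) x $ 1 + grad (W 2) x $ 2 \<le> 0"
        unfolding gW[OF True] using dv(1) m' by simp
      then have "0 \<le> (- (grad (W 1) x $ 1 + grad (W 2) x $ 2)) * \<eta> x" using \<eta>(2) by (intro mult_nonneg_nonneg) auto
      then show ?thesis by (simp add: algebra_simps)
    qed (simp add: \<eta>(3))
  qed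
  finally show "0 \<le> (LINT x|lebesgue. indicator S x * (reg_field \<epsilon> (P x) \<bullet> grad \<eta> x))" .
qed

end

section \<open>Viscosity solutions\<close>

lemma degenerate_op_expand:
  fixes p :: "real ^ 2"
  shows "degenerate_op a p X = - (1 - a) * ((X $ 1 $ 1 * p $ 1 + X $ 1 $ 2 * p $ 2) * p $ 1 + (X $ 2 $ 1 * p $ 1 + X $ 2 $ 2 * p $ 2) * p $ 2)
     - (p $ 1 * p $ 1 + p $ 2 * p $ 2) * a * (X $ 1 $ 1 + X $ 2 $ 2)"
  by (simp add: degenerate_op_def inner_2 matrix_vector_mult_def sum_2 trace_def power2_norm_eq_inner)

text \<open>The effect on the operator of adding a multiple of \<open>|x - x0|\<^sup>2\<close> to a test function.\<close>
lemma degenerate_op_perturb: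
  fixes p :: "real ^ 2"
  shows "degenerate_op a p (X + k *\<^sub>R mat 1) = degenerate_op a p X - k * (1 + a) * (norm p)\<^sup>2"
  by (simp add: degenerate_op_expand mat_def power2_norm_eq_inner inner_2 algebra_simps)

context C2_lagrangean
begin

lemma rot_B: "rot (B q) = B (rot q)"
proof -
  have "rot q = 0 \<longleftrightarrow> q = 0" using norm_rot[of q] by (metis norm_eq_zero)
  then show ?thesis by (auto simp: B_def vec_eq_iff forall_2)
qed

text \<open>The values of \<open>f'\<close> at the regularised inverses converge to \<open>f' \<sigma>\<close>, and \<open>f'\<close> is strictly increasing.\<close>
lemma reg_inv_tendsto:
  assumes e: "\<epsilon> \<longlonglongrightarrow> 0" "\<And>n. \<epsilon> n \<ge> 0"
    and \<sigma>: "\<sigma> \<ge> 0" "g \<sigma> = s" and \<gamma>: "\<And>n. 0 \<le> reg_inv (\<epsilon> n) s \<and> reg_inv (\<epsilon> n) s \<le> R \<and> reg_g (\<epsilon> n) (reg_inv (\<epsilon> n) s) = s"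
  shows "(\<lambda>n. reg_inv (\<epsilon> n) s) \<longlonglongrightarrow> \<sigma>"
proof -
  define \<gamma>n where "\<gamma>n n = reg_inv (\<epsilon> n) s" for n
  have \<gamma>n: "0 \<le> \<gamma>n n" "\<gamma>n n \<le> R" "g (\<gamma>n n) = s - \<epsilon> n * \<gamma>n n" for n
    using \<gamma>[of n] by (auto simp: \<gamma>n_def reg_g_def)
  have "(\<lambda>n. \<epsilon> n * \<gamma>n n) \<longlonglongrightarrow> 0"
  proof (rule Lim_null_comparison)
    show "\<forall>\<^sub>F n in sequentially. norm (\<epsilon> n * \<gamma>n n) \<le> \<epsilon> n * R"
      using e(2) \<gamma>n by (auto simp: abs_mult intro!: always_eventually mult_left_mono)
    show "(\<lambda>n. \<epsilon> n * R) \<longlonglongrightarrow> 0" using tendsto_mult_right[OF e(1), of R] by simp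
  qed
  then have "(\<lambda>n. s - \<epsilon> n * \<gamma>n n) \<longlonglongrightarrow> s - 0" by (intro tendsto_intros)
  then have lim: "(\<lambda>n. g (\<gamma>n n)) \<longlonglongrightarrow> g \<sigma>" by (simp add: \<gamma>n(3) \<sigma>(2))
  have "\<gamma>n \<longlonglongrightarrow> \<sigma>"
  proof (rule order_tendstoI)
    fix y assume y: "y < \<sigma>"
    show "\<forall>\<^sub>F n in sequentially. y < \<gamma>n n"
    proof (cases "y < 0")
      case True then show ?thesis using \<gamma>n(1) by (auto intro!: always_eventually intro: less_le_trans)
    next
      case False
      then have "g y < g \<sigma>" using y by (intro g_strict_mono) auto
      from order_tendstoD(1)[OF lim this] show ?thesis
      proof eventually_elim
        case (elim n) then show ?case using g_mono[OF \<gamma>n(1), of n y] by (meson not_le)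
      qed
    qed
  next
    fix y assume y: "\<sigma> < y"
    then have "g \<sigma> < g y" using \<sigma>(1) by (intro g_strict_mono) auto
    from order_tendstoD(2)[OF lim this] show "\<forall>\<^sub>F n in sequentially. \<gamma>n n < y"
    proof eventually_elim
      case (elim n) then show ?case using g_mono[of y "\<gamma>n n"] y \<sigma>(1) by (meson le_less_trans less_imp_le not_le)
    qed
  qed
  then show ?thesis by (simp add: \<gamma>n_def[abs_def])
qed

text \<open>The comparison argument. If the operator is positive at a contact point, a strict
weak supersolution of the dual equation touches \<open>v\<close> from above there. Lifting \<open>v\<close> slightly
gives a truncated difference \<open>\<eta>\<close> with compact support, and testing the two weak (in)equations with \<open>\<eta>\<close>
forces \<open>\<nabla>\<eta> = 0\<close>.\<close>
lemma conjugate_viscosity_subsolution: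
  fixes U V v :: "real ^ 2 \<Rightarrow> real"
  assumes \<Omega>: "open \<Omega>" and U: "C-lipschitz_on UNIV U" and V: "D-lipschitz_on UNIV V" "\<And>x. x \<in> \<Omega> \<Longrightarrow> V x = v x"
    and gV: "AE x in lebesgue. x \<in> \<Omega> \<longrightarrow> grad V x = rot (B (grad U x))"
  shows "viscosity_subsolution \<Omega> (dual_operator f) v"
  unfolding viscosity_subsolution_def
proof (intro allI impI, elim conjE, rule ccontr)
  fix \<phi> :: "real ^ 2 \<Rightarrow> real" and x0
  assume C2\<phi>: "C2_on \<Omega> \<phi>" and x0: "x0 \<in> \<Omega>" and touch: "\<forall>\<^sub>F x in nhds x0. v x - \<phi> x \<le> v x0 - \<phi> x0"
    and "\<not> dual_operator f (grad \<phi> x0) (hessian \<phi> x0) \<le> 0"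
  then have Fpos: "dual_operator f (grad \<phi> x0) (hessian \<phi> x0) > 0" by simp
  define p where "p = grad \<phi> x0"
  have p0: "p \<noteq> 0" using Fpos by (auto simp: dual_operator_def p_def)
  have C0: "C \<ge> 0" by (rule lipschitz_on_nonneg[OF U])
  have G\<phi>: "GDERIV \<phi> x :> grad \<phi> x" if "x \<in> \<Omega>" for x
    using C2\<phi> that by (intro GDERIV_grad) (auto simp: C2_on_def)
  have H\<phi>: "(grad \<phi> has_derivative (\<lambda>h. hessian \<phi> x *v h)) (at x)" if "x \<in> \<Omega>" for x
    using C2\<phi> that unfolding C2_on_def hessian_def by (simp add: jacobian_works)
  obtain r0 where r0: "r0 > 0" "ball x0 r0 \<subseteq> \<Omega>" "\<And>x. x \<in> ball x0 r0 \<Longrightarrow> V x - \<phi> x \<le> V x0 - \<phi> x0"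
  proof -
    obtain A where A: "open A" "x0 \<in> A" "\<And>x. x \<in> A \<Longrightarrow> v x - \<phi> x \<le> v x0 - \<phi> x0"
      using touch by (auto simp: eventually_nhds)
    have "open (A \<inter> \<Omega>)" "x0 \<in> A \<inter> \<Omega>" using A \<Omega> x0 by auto
    then obtain r where "r > 0" "ball x0 r \<subseteq> A \<inter> \<Omega>" using openE by blast
    then show thesis using A(3) V(2) x0 by (intro that[of r]) (auto simp: subset_iff)
  qed

  \<comment> \<open>The inverse of \<open>f'\<close> is meaningful only on its range. Since \<open>V\<close> is \<open>g C\<close>-Lipschitz near
    \<open>x0\<close>, a function touching it from above cannot be steeper, so \<open>norm p\<close> is in the range.\<close>
  have plow: "norm p \<le> g C"
  proof -
    have lipV: "(g C)-lipschitz_on (ball x0 r0) V"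
    proof (rule lipschitz_on_of_AE_grad_bound[OF V(1)])
      show "AE x in lebesgue. x \<in> ball x0 r0 \<longrightarrow> norm (grad V x) \<le> g C"
        using gV by eventually_elim (use r0(2) B_grad_bound[OF U open_UNIV UNIV_I] in auto)
      show "g C \<ge> 0" by (rule g_nonneg[OF C0])
    qed auto
    have "((\<lambda>t. (\<phi> (x0 + t *\<^sub>R (- p)) - \<phi> x0) / t) \<longlongrightarrow> (- p) \<bullet> p) (at 0)"
      using GDERIV_direction[OF G\<phi>[OF x0], of "- p"] by (simp add: DERIV_def p_def)
    then have lim: "((\<lambda>t. (\<phi> (x0 + t *\<^sub>R (- p)) - \<phi> x0) / t) \<longlongrightarrow> (- p) \<bullet> p) (at_right 0)"
      by (rule tendsto_mono[OF at_le, rotated]) simp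
    have "((\<lambda>t. x0 + t *\<^sub>R (- p)) \<longlongrightarrow> x0 + 0 *\<^sub>R (- p)) (at_right 0)" by (intro tendsto_intros)
    then have "\<forall>\<^sub>F t in at_right 0. x0 + t *\<^sub>R (- p) \<in> ball x0 r0" using r0(1) by (intro topological_tendstoD) auto
    then have "\<forall>\<^sub>F t in at_right 0. - (g C * norm p) \<le> (\<phi> (x0 + t *\<^sub>R (- p)) - \<phi> x0) / t"
      using eventually_at_right_less[of 0]
    proof eventually_elim
      case (elim t)
      have "\<bar>V (x0 + t *\<^sub>R (- p)) - V x0\<bar> \<le> g C * (t * norm p)"
        using lipschitz_onD[OF lipV elim(1), of x0] r0(1) elim(2) by (simp add: dist_norm)
      then have "- (g C * (t * norm p)) \<le> \<phi> (x0 + t *\<^sub>R (- p)) - \<phi> x0" using r0(3)[OF elim(1)] by linarith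
      then show ?case using elim(2) by (simp add: field_simps)
    qed
    then have "- (g C * norm p) \<le> (- p) \<bullet> p" by (intro tendsto_lowerbound[OF lim]) auto
    then have "norm p * norm p \<le> g C * norm p" by (simp add: dot_square_norm power2_eq_square)
    then show ?thesis using p0 by simp
  qed

  define \<rho>0 where "\<rho>0 = reg_inv 0 (norm p)"
  have "reg_g 0 0 < norm p" "norm p < reg_g 0 (C + 1)"
    using p0 plow g_strict_mono[of C "C + 1"] C0 by (auto simp: reg_g_def d0)
  from reg_inv_between[OF _ _ _ this] C0
  have \<rho>0: "\<rho>0 > 0" "g \<rho>0 = norm p" by (auto simp: \<rho>0_def reg_g_def)
  define a0 where "a0 = reg_alpha 0 \<rho>0"
  have a0: "a0 \<ge> 0" using \<rho>0 g'_nonneg[OF \<rho>0(1)] by (simp add: a0_def reg_alpha_def reg_g_def)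
  have "alpha f (gprime f (norm p)) = a0"
    using \<rho>0 by (simp add: alpha_def a0_def reg_alpha_def reg_g_def \<rho>0_def reg_inv_0)
  then have Fop: "degenerate_op a0 p (hessian \<phi> x0) > 0" using Fpos by (simp add: dual_operator_eq p_def)
  \<comment> \<open>By \<open>degenerate_op_perturb\<close> the quadratic \<open>c * (norm (x - x0))\<^sup>2\<close> uses up half of the
    positivity of the operator.\<close>
  define c where "c = degenerate_op a0 p (hessian \<phi> x0) / (4 * (1 + a0) * (norm p)\<^sup>2)"
  have c0: "c > 0" using Fop a0 p0 by (simp add: c_def)
  define P where "P x = grad \<phi> x + (2 * c) *\<^sub>R (x - x0)" for x
  define Y where "Y x = hessian \<phi> x + (2 * c) *\<^sub>R mat 1" for x
  define \<psi> where "\<psi> x = \<phi> x + c * ((x - x0) \<bullet> (x - x0))" for x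
  have Px0: "P x0 = p" by (simp add: P_def p_def)
  have "degenerate_op a0 p (Y x0) = degenerate_op a0 p (hessian \<phi> x0) - 2 * c * (1 + a0) * (norm p)\<^sup>2"
    unfolding Y_def by (rule degenerate_op_perturb)
  also have "2 * c * (1 + a0) * (norm p)\<^sup>2 = degenerate_op a0 p (hessian \<phi> x0) / 2"
  proof -
    define k where "k = (1 + a0) * (norm p)\<^sup>2"
    have "k \<noteq> 0" using a0 p0 by (simp add: k_def)
    moreover have "c = degenerate_op a0 p (hessian \<phi> x0) / (4 * k)" by (simp only: c_def k_def mult.assoc)
    ultimately have "2 * c * k = degenerate_op a0 p (hessian \<phi> x0) / 2" by simp
    then show ?thesis by (simp only: k_def mult.assoc)
  qed
  finally have Yop: "degenerate_op a0 p (Y x0) > 0" using Fop by simp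
  have Pd: "(P has_derivative (\<lambda>h. Y x *v h)) (at x)" if "x \<in> \<Omega>" for x
  proof -
    have "(P has_derivative (\<lambda>h. hessian \<phi> x *v h + (2 * c) *\<^sub>R h)) (at x)"
      unfolding P_def by (auto intro!: derivative_eq_intros H\<phi>[OF that])
    moreover have "Y x *v h = hessian \<phi> x *v h + (2 * c) *\<^sub>R h" for h
      by (simp add: Y_def matrix_vector_mult_add_rdistrib flip: scaleR_matrix_vector_assoc)
    ultimately show ?thesis by simp
  qed
  have G\<psi>: "GDERIV \<psi> x :> P x" if "x \<in> \<Omega>" for x
  proof -
    have "GDERIV (\<lambda>x. c * ((x - x0) \<bullet> (x - x0))) x :> (2 * c) *\<^sub>R (x - x0)"
      by (auto simp: gderiv_def inner_commute algebra_simps intro!: derivative_eq_intros)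
    from GDERIV_add[OF G\<phi>[OF that] this] show ?thesis by (simp add: \<psi>_def[abs_def] P_def)
  qed
  have contY: "continuous_on \<Omega> Y" unfolding Y_def using C2\<phi> by (intro continuous_intros) (simp add: C2_on_def)
  have isP: "isCont P x0" using has_derivative_continuous[OF Pd[OF x0]] .
  have isY: "isCont Y x0" using contY \<Omega> x0 by (simp add: continuous_on_eq_continuous_at)

  \<comment> \<open>Positivity persists jointly in the point, in the modulus of the dual gradient and in the
    regularisation parameter.\<close>
  define \<Phi> where "\<Phi> z = degenerate_op (reg_alpha (snd (snd z)) (fst (snd z))) (P (fst z)) (Y (fst z))" for z :: "(real ^ 2) \<times> real \<times> real"
  have "isCont \<Phi> (x0, \<rho>0, 0)"
  proof -
    let ?z = "(x0, \<rho>0, 0 :: real)"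
    have iP: "isCont (\<lambda>z :: (real ^ 2) \<times> real \<times> real. P (fst z)) ?z" by (rule isCont_o2[where f=fst and g=P]) (use isP in auto)
    have iY: "isCont (\<lambda>z :: (real ^ 2) \<times> real \<times> real. Y (fst z)) ?z" by (rule isCont_o2[where f=fst and g=Y]) (use isY in auto)
    have ig: "isCont (\<lambda>z :: (real ^ 2) \<times> real \<times> real. g (fst (snd z))) ?z"
      by (rule isCont_o2[where f="\<lambda>z. fst (snd z)" and g=g]) (use DERIV_isCont[OF g_deriv[OF \<rho>0(1)]] in \<open>auto intro!: continuous_intros\<close>)
    have "isCont g' \<rho>0" using g'_cont \<rho>0(1) by (simp add: continuous_on_eq_continuous_at)
    then have ig': "isCont (\<lambda>z :: (real ^ 2) \<times> real \<times> real. g' (fst (snd z))) ?z"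
      by (intro isCont_o2[where f="\<lambda>z. fst (snd z)" and g=g']) (auto intro!: continuous_intros)
    have i\<rho>: "isCont (\<lambda>z :: (real ^ 2) \<times> real \<times> real. fst (snd z)) ?z" "isCont (\<lambda>z :: (real ^ 2) \<times> real \<times> real. snd (snd z)) ?z"
      by (intro continuous_fst continuous_snd continuous_ident)+
    have ia: "isCont (\<lambda>z :: (real ^ 2) \<times> real \<times> real. reg_alpha (snd (snd z)) (fst (snd z))) ?z"
      unfolding reg_alpha_def reg_g_def
      by (intro isCont_divide isCont_mult isCont_add i\<rho> ig ig') (use \<rho>0 p0 in simp)
    have iPi: "isCont (\<lambda>z :: (real ^ 2) \<times> real \<times> real. P (fst z) $ i) ?z" for i
      by (rule continuous_component[OF iP])
    have iYij: "isCont (\<lambda>z :: (real ^ 2) \<times> real \<times> real. Y (fst z) $ i $ j) ?z" for i j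
      by (rule continuous_component[OF continuous_component[OF iY]])
    show ?thesis
      unfolding \<Phi>_def[abs_def] degenerate_op_expand
      by (intro isCont_diff isCont_mult isCont_minus isCont_add continuous_const ia iPi iYij)
  qed
  moreover have "\<Phi> (x0, \<rho>0, 0) > 0" using Yop by (simp add: \<Phi>_def a0_def Px0)
  ultimately obtain e0 where e0: "e0 > 0" "\<And>z. dist z (x0, \<rho>0, 0) < e0 \<Longrightarrow> \<bar>\<Phi> z - \<Phi> (x0, \<rho>0, 0)\<bar> < \<Phi> (x0, \<rho>0, 0)"
    unfolding continuous_at_eps_delta dist_real_def by meson
  \<comment> \<open>The distance in the product is at most the sum of three coordinate distances.\<close>
  define e where "e = e0 / 3"
  have e: "e > 0" using e0(1) by (simp add: e_def)
  have \<Phi>pos: "degenerate_op (reg_alpha \<epsilon> \<rho>) (P x) (Y x) > 0" if "dist x x0 < e" "\<bar>\<rho> - \<rho>0\<bar> < e" "\<bar>\<epsilon>\<bar> < e" for x \<rho> \<epsilon>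
  proof -
    have "dist (x, \<rho>, \<epsilon>) (x0, \<rho>0, 0) \<le> dist x x0 + dist (\<rho>, \<epsilon>) (\<rho>0, 0)"
      unfolding dist_Pair_Pair[of x] by (rule sqrt_sum_squares_le_sum) auto
    also have "dist (\<rho>, \<epsilon>) (\<rho>0, 0) \<le> dist \<rho> \<rho>0 + dist \<epsilon> 0"
      unfolding dist_Pair_Pair[of \<rho>] by (rule sqrt_sum_squares_le_sum) auto
    finally have "dist (x, \<rho>, \<epsilon>) (x0, \<rho>0, 0) < e0" using that by (simp add: e_def dist_real_def)
    from e0(2)[OF this] show ?thesis by (simp add: \<Phi>_def)
  qed

  \<comment> \<open>The window \<open>{\<rho>1<..<\<rho>2}\<close> around \<open>\<rho>0\<close> stays away from zero and within the range of
    positivity. For \<open>\<epsilon> \<le> \<epsilon>1\<close> all moduli in \<open>{m1<..<m2}\<close> have their regularised inverse in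
    this window: \<open>\<epsilon> * \<rho>1 \<le> m1 - g \<rho>1\<close> controls the lower end, and the upper end only
    moves up with \<open>\<epsilon>\<close>.\<close>
  define e' where "e' = min e \<rho>0 / 2"
  define \<rho>1 \<rho>2 where "\<rho>1 = \<rho>0 - e'" and "\<rho>2 = \<rho>0 + e'"
  have \<rho>12: "0 < \<rho>1" "\<rho>1 < \<rho>0" "\<rho>0 < \<rho>2" "\<And>\<rho>. \<rho>1 < \<rho> \<Longrightarrow> \<rho> < \<rho>2 \<Longrightarrow> \<bar>\<rho> - \<rho>0\<bar> < e"
    using e \<rho>0(1) by (auto simp: \<rho>1_def \<rho>2_def e'_def)
  define m1 m2 where "m1 = (g \<rho>1 + norm p) / 2" and "m2 = g \<rho>2"
  have g12: "0 < g \<rho>1" "g \<rho>1 < norm p" "norm p < m2"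
    using \<rho>12 g_strict_mono[of \<rho>1 \<rho>0] g_strict_mono[of \<rho>0 \<rho>2] g_pos[of \<rho>1] \<rho>0 by (auto simp: m2_def)
  have m: "0 \<le> m1" "g \<rho>1 < m1" "m1 < norm p" "norm p < m2" using g12 by (auto simp: m1_def)
  define \<epsilon>1 where "\<epsilon>1 = min (e / 2) ((m1 - g \<rho>1) / \<rho>1)"
  have \<epsilon>1: "\<epsilon>1 > 0" "\<epsilon>1 < e" using e m \<rho>12 by (auto simp: \<epsilon>1_def)
  have inv: "\<rho>1 < reg_inv \<epsilon> s \<and> reg_inv \<epsilon> s < \<rho>2 \<and> reg_g \<epsilon> (reg_inv \<epsilon> s) = s"
    if \<epsilon>: "0 \<le> \<epsilon>" "\<epsilon> \<le> \<epsilon>1" and s: "m1 < s" "s < m2" for \<epsilon> s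
  proof -
    have "\<epsilon> * \<rho>1 \<le> \<epsilon>1 * \<rho>1" using \<epsilon> \<rho>12(1) by (intro mult_right_mono) auto
    also have "\<epsilon>1 * \<rho>1 \<le> (m1 - g \<rho>1) / \<rho>1 * \<rho>1" using \<rho>12(1) by (intro mult_right_mono) (auto simp: \<epsilon>1_def)
    also have "\<dots> = m1 - g \<rho>1" using \<rho>12(1) by simp
    finally have "reg_g \<epsilon> \<rho>1 < s" using s by (simp add: reg_g_def)
    moreover have "0 \<le> \<epsilon> * \<rho>2" using \<epsilon> \<rho>12 by (intro mult_nonneg_nonneg) auto
    then have "s < reg_g \<epsilon> \<rho>2" using s by (simp add: reg_g_def m2_def)
    ultimately show ?thesis using reg_inv_between[OF \<epsilon>(1), of \<rho>1 \<rho>2 s] \<rho>12 by auto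
  qed

  obtain r' where r': "r' > 0" "r' \<le> r0" "r' \<le> e" "\<And>x. x \<in> ball x0 r' \<Longrightarrow> m1 < norm (P x) \<and> norm (P x) < m2"
  proof -
    have "((\<lambda>x. norm (P x)) \<longlongrightarrow> norm (P x0)) (nhds x0)"
      by (subst tendsto_at_iff_tendsto_nhds[symmetric]) (rule tendsto_norm[OF isP[unfolded isCont_def]])
    then have "\<forall>\<^sub>F x in nhds x0. m1 < norm (P x) \<and> norm (P x) < m2"
      unfolding Px0 using m by (intro eventually_conj order_tendstoD) auto
    then obtain d where "d > 0" "\<And>x. dist x x0 < d \<Longrightarrow> m1 < norm (P x) \<and> norm (P x) < m2"
      by (auto simp: eventually_nhds_metric)
    then show thesis using r0(1) e by (intro that[of "min d (min r0 e)"]) (auto simp: dist_commute)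
  qed
  define r where "r = r' / 2"
  define S where "S = ball x0 r"
  have r: "r > 0" "cball x0 r \<subseteq> ball x0 r'" using r'(1) by (auto simp: r_def)
  have S: "open S" "bounded S" "S \<in> sets lebesgue" by (auto simp: S_def)
  have clS: "closure S = cball x0 r" and frS: "frontier S = sphere x0 r" using r by (auto simp: S_def)
  have S\<Omega>: "cball x0 r \<subseteq> \<Omega>" using r(2) r0(2) subset_ball[OF r'(2), of x0] by blast
  have Scl: "S \<subseteq> cball x0 r" by (auto simp: S_def)
  have Pm: "m1 < norm (P x) \<and> norm (P x) < m2" if "x \<in> cball x0 r" for x using r'(4) r(2) that by blast

  \<comment> \<open>Less than the gap \<open>c * r\<^sup>2\<close> on the sphere of radius \<open>r\<close>, so the lifted difference is
    negative there and its positive part extends by zero.\<close>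
  define \<delta> where "\<delta> = c * r\<^sup>2 / 4"
  have \<delta>: "\<delta> > 0" using c0 r by (simp add: \<delta>_def)
  define z where "z x = V x - \<psi> x - (V x0 - \<phi> x0) + \<delta>" for x
  have zle: "z x \<le> \<delta> - c * (norm (x - x0))\<^sup>2" if "x \<in> cball x0 r" for x
  proof -
    have "x \<in> ball x0 r0" using that r(2) subset_ball[OF r'(2), of x0] by blast
    from r0(3)[OF this] show ?thesis by (simp add: z_def \<psi>_def dot_square_norm)
  qed
  have lip\<psi>: "m2-lipschitz_on (cball x0 r) \<psi>"
    by (rule lipschitz_of_GDERIV_bound[OF convex_cball G\<psi>]) (use S\<Omega> Pm m in \<open>auto intro: less_imp_le\<close>)
  have "(D + m2)-lipschitz_on (cball x0 r) (\<lambda>x. V x - \<psi> x)"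
    by (rule lipschitz_on_diff[OF lipschitz_on_subset[OF V(1) subset_UNIV] lip\<psi>])
  moreover have "dist (z x) (z y) = dist (V x - \<psi> x) (V y - \<psi> y)" for x y by (simp add: z_def dist_real_def algebra_simps)
  ultimately have "(D + m2)-lipschitz_on (cball x0 r) z" unfolding lipschitz_on_def by simp
  then have lipz: "(D + m2)-lipschitz_on (closure S) (\<lambda>x. max 0 (z x))" unfolding clS by (rule lipschitz_pos_part)
  define \<eta> where "\<eta> x = (if x \<in> S then max 0 (z x) else 0)" for x
  define E where "E = D + m2"
  have lip\<eta>: "E-lipschitz_on UNIV \<eta>"
    unfolding \<eta>_def[abs_def] E_def
  proof (rule lipschitz_extend_by_zero[OF lipz])
    fix x assume "x \<in> frontier S"
    then have "norm (x - x0) = r" by (simp add: frS dist_norm norm_minus_commute)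
    then have "z x \<le> \<delta> - c * r\<^sup>2" using zle[of x] by (simp add: dist_norm norm_minus_commute)
    also have "\<dots> \<le> 0" using c0 by (simp add: \<delta>_def)
    finally show "max 0 (z x) = 0" by simp
  qed
  have \<eta>0: "0 \<le> \<eta> x" "x \<notin> S \<Longrightarrow> \<eta> x = 0" for x by (auto simp: \<eta>_def)
  have bnd\<eta>: "bounded {x. \<eta> x \<noteq> 0}" by (rule bounded_subset[OF S(2)]) (use \<eta>0(2) in auto)
  have E0: "E \<ge> 0" by (rule lipschitz_on_nonneg[OF lip\<eta>])
  have g\<eta>: "AE x in lebesgue. (0 < \<eta> x \<longrightarrow> grad \<eta> x = B (rot (grad U x)) - P x) \<and> (\<eta> x = 0 \<longrightarrow> grad \<eta> x = 0)"
    using gV lipschitz_ae_differentiable[OF V(1)] AE_grad_zero_on_zero_set[OF lip\<eta>]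
  proof eventually_elim
    case (elim x)
    have "grad \<eta> x = B (rot (grad U x)) - P x" if pos: "0 < \<eta> x"
    proof -
      have xS: "x \<in> S" using pos \<eta>0(2)[of x] by fastforce
      then have x\<Omega>: "x \<in> \<Omega>" using Scl S\<Omega> by blast
      have "open {y. 0 < \<eta> y}"
        using lipschitz_on_continuous_on[OF lip\<eta>] by (intro open_Collect_less continuous_on_const)
      then have "grad \<eta> x = grad z x"
        by (rule grad_cong_open[OF open_Int[OF S(1)]]) (use xS pos in \<open>auto simp: \<eta>_def\<close>)
      also have "grad z x = grad V x - P x"
      proof (rule grad_eqI)
        have "GDERIV (\<lambda>x. (V x0 - \<phi> x0) - \<delta>) x :> 0" by (simp add: gderiv_def)
        from GDERIV_diff[OF GDERIV_diff[OF elim(2) G\<psi>[OF x\<Omega>]] this]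
        show "GDERIV z x :> grad V x - P x" by (simp add: z_def[abs_def] algebra_simps)
      qed
      finally show ?thesis using elim(1) x\<Omega> by (simp add: rot_B)
    qed
    then show ?case using elim(3) by blast
  qed

  obtain L where L: "L \<ge> 0" "\<And>x y. x \<in> S \<Longrightarrow> y \<in> S \<Longrightarrow> norm (P x - P y) \<le> L * norm (x - y)"
  proof -
    have "continuous_on (cball x0 r) (\<lambda>x. \<Sum>i\<in>UNIV. \<Sum>j\<in>UNIV. \<bar>Y x $ i $ j\<bar>)"
      by (intro continuous_intros continuous_on_subset[OF contY S\<Omega>])
    then have "compact ((\<lambda>x. \<Sum>i\<in>UNIV. \<Sum>j\<in>UNIV. \<bar>Y x $ i $ j\<bar>) ` cball x0 r)"
      by (intro compact_continuous_image) auto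
    then have "bounded ((\<lambda>x. \<Sum>i\<in>UNIV. \<Sum>j\<in>UNIV. \<bar>Y x $ i $ j\<bar>) ` cball x0 r)"
      by (rule compact_imp_bounded)
    then obtain L where "\<forall>y \<in> (\<lambda>x. \<Sum>i\<in>UNIV. \<Sum>j\<in>UNIV. \<bar>Y x $ i $ j\<bar>) ` cball x0 r. norm y \<le> L"
      unfolding bounded_iff by (elim exE)
    then have L: "\<bar>\<Sum>i\<in>UNIV. \<Sum>j\<in>UNIV. \<bar>Y x $ i $ j\<bar>\<bar> \<le> L" if "x \<in> cball x0 r" for x
      using bspec[OF _ imageI[OF that]] unfolding real_norm_def by fast
    have "x0 \<in> cball x0 r" using r(1) by simp
    from L[OF this] have L0: "L \<ge> 0" by linarith
    have "norm (P x - P y) \<le> L * norm (x - y)" if "x \<in> S" "y \<in> S" for x y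
    proof (rule differentiable_bound[of S P "\<lambda>x h. Y x *v h"])
      fix x assume "x \<in> S"
      then have x: "x \<in> cball x0 r" "x \<in> \<Omega>" using Scl S\<Omega> by auto
      show "(P has_derivative (\<lambda>h. Y x *v h)) (at x within S)" by (rule has_derivative_at_withinI[OF Pd[OF x(2)]])
      show "onorm (\<lambda>h. Y x *v h) \<le> L" using onorm_le_matrix_component_sum[of "Y x"] L[OF x(1)] by linarith
    qed (use that in \<open>auto simp: S_def\<close>)
    with L0 show thesis by (rule that)
  qed

  define \<epsilon> where "\<epsilon> n = \<epsilon>1 * (1 / real (Suc n))" for n
  have \<epsilon>: "0 < \<epsilon> n" "\<epsilon> n \<le> \<epsilon>1" for n using \<epsilon>1(1) by (auto simp: \<epsilon>_def divide_le_eq)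
  have \<epsilon>lim: "\<epsilon> \<longlonglongrightarrow> 0" unfolding \<epsilon>_def[abs_def] using tendsto_mult[OF tendsto_const step_tendsto_0, of \<epsilon>1] by simp
  \<comment> \<open>For \<open>\<epsilon> = 0\<close> this is the inverse of \<open>B\<close> itself, that is, the field of the limit equation.\<close>
  define W where "W \<epsilon> x = indicator S x *\<^sub>R reg_field \<epsilon> (P x)" for \<epsilon> x
  have ws: "W (\<epsilon> n) \<in> borel_measurable lebesgue" "0 \<le> (LINT x|lebesgue. W (\<epsilon> n) x \<bullet> grad \<eta> x)" for n
  proof -
    have pos: "0 < degenerate_op (reg_alpha (\<epsilon> n) (reg_inv (\<epsilon> n) (norm (P x)))) (P x) (Y x)" if "x \<in> S" for x
    proof (rule \<Phi>pos)
      show "dist x x0 < e" using that r'(1,3) by (simp add: S_def r_def dist_commute)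
      have "x \<in> cball x0 r" using that Scl by blast
      from Pm[OF this] inv[of "\<epsilon> n" "norm (P x)"] \<epsilon>[of n]
      show "\<bar>reg_inv (\<epsilon> n) (norm (P x)) - \<rho>0\<bar> < e" by (intro \<rho>12(4)) auto
      show "\<bar>\<epsilon> n\<bar> < e" using \<epsilon>[of n] \<epsilon>1(2) by simp
    qed
    have inv': "reg_inv (\<epsilon> n) s > 0 \<and> reg_g (\<epsilon> n) (reg_inv (\<epsilon> n) s) = s" if "m1 < s" "s < m2" for s
      using inv[of "\<epsilon> n" s] \<epsilon>[of n] that \<rho>12(1) by auto
    have Pm': "m1 < norm (P x) \<and> norm (P x) < m2" if "x \<in> S" for x using Pm Scl that by blast
    have Pd': "(P has_derivative (\<lambda>h. Y x *v h)) (at x)" if "x \<in> S" for x using Pd Scl S\<Omega> that by blast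
    note R = reg_field_weak_supersolution[OF \<epsilon>(1) S(1,2) Pd' L(2,1) m(1) Pm' inv' pos lip\<eta> \<eta>0]
    show "W (\<epsilon> n) \<in> borel_measurable lebesgue" unfolding W_def[abs_def] by (rule R(1))
    show "0 \<le> (LINT x|lebesgue. W (\<epsilon> n) x \<bullet> grad \<eta> x)" unfolding W_def using R(2) by simp
  qed
  have Wlim: "(\<lambda>n. W (\<epsilon> n) x) \<longlonglongrightarrow> W 0 x" for x
  proof (cases "x \<in> S")
    case True
    then have s: "m1 < norm (P x)" "norm (P x) < m2" using Pm Scl by auto
    have "(\<lambda>n. reg_inv (\<epsilon> n) (norm (P x))) \<longlonglongrightarrow> reg_inv 0 (norm (P x))"
    proof (rule reg_inv_tendsto[OF \<epsilon>lim, of _ _ \<rho>2])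
      show "0 \<le> reg_inv 0 (norm (P x))" "g (reg_inv 0 (norm (P x))) = norm (P x)"
        using inv[of 0 "norm (P x)"] s \<epsilon>1(1) \<rho>12(1) by (auto simp: reg_g_def)
      show "0 \<le> \<epsilon> n" for n using \<epsilon>(1)[of n] by simp
      show "0 \<le> reg_inv (\<epsilon> n) (norm (P x)) \<and> reg_inv (\<epsilon> n) (norm (P x)) \<le> \<rho>2 \<and> reg_g (\<epsilon> n) (reg_inv (\<epsilon> n) (norm (P x))) = norm (P x)" for n
        using inv[of "\<epsilon> n" "norm (P x)"] s \<epsilon>[of n] \<rho>12(1) by auto
    qed
    then show ?thesis unfolding W_def reg_field_def using s m(1) by (intro tendsto_intros) auto
  qed (simp add: W_def)
  have Wb: "norm (W \<epsilon>' x) \<le> \<rho>2 * indicator S x" if "0 \<le> \<epsilon>'" "\<epsilon>' \<le> \<epsilon>1" for \<epsilon>' x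
  proof (cases "x \<in> S")
    case True
    then have s: "m1 < norm (P x)" "norm (P x) < m2" using Pm Scl by auto
    have "P x \<noteq> 0" using s(1) m(1) by auto
    with inv[OF that s] \<rho>12(1) show ?thesis using True by (simp add: W_def reg_field_def)
  qed (simp add: W_def)
  have W0m: "W 0 \<in> borel_measurable lebesgue" by (rule borel_measurable_LIMSEQ_metric[OF ws(1) Wlim])
  have dotb: "\<bar>W \<epsilon>' x \<bullet> grad \<eta> x\<bar> \<le> (\<rho>2 * E) * indicator S x" if "0 \<le> \<epsilon>'" "\<epsilon>' \<le> \<epsilon>1" for \<epsilon>' x
  proof -
    have "\<bar>W \<epsilon>' x \<bullet> grad \<eta> x\<bar> \<le> norm (W \<epsilon>' x) * norm (grad \<eta> x)" by (rule Cauchy_Schwarz_ineq2)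
    also have "\<dots> \<le> (\<rho>2 * indicator S x) * E"
      using \<rho>12 by (intro mult_mono Wb[OF that] norm_grad_le[OF lip\<eta> open_UNIV UNIV_I]) auto
    finally show ?thesis by (simp add: mult_ac)
  qed
  have W0pos: "0 \<le> (LINT x|lebesgue. W 0 x \<bullet> grad \<eta> x)"
  proof (rule LIMSEQ_le_const)
    show "(\<lambda>n. LINT x|lebesgue. W (\<epsilon> n) x \<bullet> grad \<eta> x) \<longlonglongrightarrow> (LINT x|lebesgue. W 0 x \<bullet> grad \<eta> x)"
    proof (rule dominated_convergence_bounded_support[OF _ _ _ _ S(2,3)])
      show "AE x in lebesgue. (\<lambda>n. W (\<epsilon> n) x \<bullet> grad \<eta> x) \<longlonglongrightarrow> W 0 x \<bullet> grad \<eta> x"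
        by (intro AE_I2 tendsto_intros Wlim)
      show "AE x in lebesgue. \<bar>W (\<epsilon> n) x \<bullet> grad \<eta> x\<bar> \<le> (\<rho>2 * E) * indicator S x" for n
        using \<epsilon>[of n] by (intro AE_I2 dotb) auto
    qed (intro borel_measurable_inner ws(1) W0m grad_measurable[OF lip\<eta>])+
  qed (use ws(2) in auto)
  have iW: "integrable lebesgue (\<lambda>x. W 0 x \<bullet> grad \<eta> x)"
    by (rule integrable_bounded_support[OF _ _ S(2,3)])
       (use dotb[of 0] \<epsilon>1(1) in \<open>auto intro!: borel_measurable_inner W0m grad_measurable[OF lip\<eta>] AE_I2\<close>)

  note IG = integrable_grad_mult_grad[OF U lip\<eta> S(2,3) \<eta>0(2)]
  have Teq: "rot (grad U x) \<bullet> grad \<eta> x = grad U x $ 1 * grad \<eta> x $ 2 - grad U x $ 2 * grad \<eta> x $ 1" for x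
    by (simp add: inner_2)
  have iT: "integrable lebesgue (\<lambda>x. rot (grad U x) \<bullet> grad \<eta> x)"
    unfolding Teq by (rule Bochner_Integration.integrable_diff[OF IG IG])
  \<comment> \<open>The dual equation for \<open>v\<close>: a rotated gradient is weakly divergence free.\<close>
  have T0: "(LINT x|lebesgue. rot (grad U x) \<bullet> grad \<eta> x) = 0"
  proof -
    have "(LINT x|lebesgue. rot (grad U x) \<bullet> grad \<eta> x) = (LINT x|lebesgue. grad U x $ 1 * grad \<eta> x $ 2) - (LINT x|lebesgue. grad U x $ 2 * grad \<eta> x $ 1)"
      unfolding Teq by (rule Bochner_Integration.integral_diff[OF IG IG])
    then show ?thesis using integral_grad_jacobian_symmetric[OF U lip\<eta> bnd\<eta>, of 1 2] by simp
  qed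

  \<comment> \<open>The integrand of the comparison. Where \<open>\<eta> > 0\<close>, the gradient of \<open>\<eta>\<close> is
    \<open>B (rot (grad U x)) - B (W 0 x)\<close>, so \<open>K\<close> is nonnegative by monotonicity, while its integral is at
    most zero.\<close>
  define K where "K x = (rot (grad U x) - W 0 x) \<bullet> grad \<eta> x" for x
  have K: "K = (\<lambda>x. rot (grad U x) \<bullet> grad \<eta> x - W 0 x \<bullet> grad \<eta> x)"
    by (simp add: K_def fun_eq_iff inner_diff_left)
  have Kint: "integrable lebesgue K" unfolding K by (rule Bochner_Integration.integrable_diff[OF iT iW])
  have Kle: "(LINT x|lebesgue. K x) \<le> 0"
    unfolding K Bochner_Integration.integral_diff[OF iT iW] using T0 W0pos by simp
  have BW: "P x = B (W 0 x)" if "x \<in> S" for x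
  proof -
    have s: "m1 < norm (P x)" "norm (P x) < m2" using that Pm Scl by auto
    have "P x \<noteq> 0" using s(1) m(1) by auto
    with inv[of 0, OF _ _ s] \<epsilon>1(1) \<rho>12(1) show ?thesis
      using B_reg_field(1)[of 0 "P x"] that by (simp add: W_def)
  qed
  have supS: "x \<in> S" if "0 < \<eta> x" for x using that \<eta>0(2)[of x] by fastforce
  have Knn: "AE x in lebesgue. 0 \<le> K x"
    using g\<eta>
  proof eventually_elim
    case (elim x)
    show ?case
    proof (cases "\<eta> x = 0")
      case True then show ?thesis using elim by (simp add: K_def)
    next
      case False
      then have pos: "0 < \<eta> x" using \<eta>0(1)[of x] by simp
      then show ?thesis using elim BW[OF supS[OF pos]] B_mono[of "rot (grad U x)" "W 0 x"] by (simp add: K_def)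
    qed
  qed
  have "(LINT x|lebesgue. K x) = 0" using Kle Bochner_Integration.integral_nonneg_AE[OF Knn] by linarith
  then have "AE x in lebesgue. K x = 0" using integral_nonneg_eq_0_iff_AE[OF Kint Knn] by simp
  then have "AE x in lebesgue. x \<in> UNIV \<longrightarrow> grad \<eta> x = 0"
    using g\<eta>
  proof eventually_elim
    case (elim x)
    show ?case
    proof (cases "\<eta> x = 0")
      case True then show ?thesis using elim by simp
    next
      case False
      then have pos: "0 < \<eta> x" using \<eta>0(1)[of x] by simp
      then have eq: "grad \<eta> x = B (rot (grad U x)) - B (W 0 x)" using elim BW[OF supS[OF pos]] by simp
      have "rot (grad U x) = W 0 x"
      proof (rule ccontr)
        assume "rot (grad U x) \<noteq> W 0 x"
        from B_strict_mono[OF this] show False using elim(1) unfolding K_def eq by simp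
      qed
      then show ?thesis using eq by simp
    qed
  qed
  then have const: "\<eta> x = \<eta> y" for x y
    by (rule constant_of_AE_grad_zero[OF lip\<eta> open_UNIV connected_UNIV _ UNIV_I UNIV_I])
  have "S \<noteq> UNIV" using S(2) not_bounded_UNIV by metis
  then obtain y where "y \<notin> S" by blast
  then have "\<eta> x0 = 0" unfolding const[of x0 y] by (rule \<eta>0(2))
  moreover have "\<eta> x0 = \<delta>"
  proof -
    have "\<psi> x0 = \<phi> x0" unfolding \<psi>_def by simp
    then have "z x0 = \<delta>" unfolding z_def by linarith
    moreover have "x0 \<in> S" unfolding S_def using r(1) by simp
    then have "\<eta> x0 = max 0 (z x0)" by (simp only: \<eta>_def if_True)
    ultimately show ?thesis using \<delta> by linarith
  qed
  ultimately show False using \<delta> by linarith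
qed

end

lemma grad_uminus: "grad (\<lambda>x. - w x) x = - grad w x"
proof (cases "w differentiable (at x)")
  case True
  from GDERIV_cmult[OF GDERIV_grad[OF this], of "-1"] show ?thesis by (simp add: grad_eqI)
next
  case False
  then have "\<not> (\<lambda>x. - w x) differentiable (at x)"
    using differentiable_minus[of "\<lambda>x. - w x" "at x"] by auto
  with False show ?thesis by (simp add: grad_eq_0_if_not_differentiable)
qed

lemma hessian_eqI:
  assumes "(grad w has_derivative (\<lambda>h. A *v h)) (at x)"
  shows "hessian w x = A"
  unfolding hessian_def jacobian_def using frechet_derivative_at[OF assms, symmetric] by (simp only: matrix_of_matrix_vector_mul)

text \<open>A function touching \<open>v\<close> from below is the negative of one touching \<open>- v\<close> from above.\<close>
lemma viscosity_supersolution_of_uminus: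
  assumes odd: "\<And>p X. F (- p) (- X) = - F p X"
    and sub: "viscosity_subsolution \<Omega> F (\<lambda>x. - v x)"
  shows "viscosity_supersolution \<Omega> F v"
  unfolding viscosity_supersolution_def
proof (intro allI impI, elim conjE)
  fix \<phi> :: "real ^ 'a \<Rightarrow> real" and x0 assume C2: "C2_on \<Omega> \<phi>" and x0: "x0 \<in> \<Omega>" and touch: "\<forall>\<^sub>F x in nhds x0. v x0 - \<phi> x0 \<le> v x - \<phi> x"
  have g: "grad (\<lambda>x. - \<phi> x) = (\<lambda>x. - grad \<phi> x)" by (rule ext) (rule grad_uminus)
  have neg: "- A *v k = - (A *v k)" for A :: "real ^ 'a ^ 'a" and k
    by (simp add: vec_eq_iff matrix_vector_mult_def sum_negf)
  have h: "hessian (\<lambda>x. - \<phi> x) x = - hessian \<phi> x" if "x \<in> \<Omega>" for x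
  proof (rule hessian_eqI)
    have "(grad \<phi> has_derivative (\<lambda>h. hessian \<phi> x *v h)) (at x)"
      using C2 that unfolding C2_on_def hessian_def by (simp add: jacobian_works)
    from has_derivative_minus[OF this]
    show "(grad (\<lambda>x. - \<phi> x) has_derivative (\<lambda>h. - hessian \<phi> x *v h)) (at x)"
      by (simp add: g neg)
  qed
  have "C2_on \<Omega> (\<lambda>x. - \<phi> x)"
    unfolding C2_on_def
  proof (intro conjI ballI)
    have "continuous_on \<Omega> (\<lambda>x. - hessian \<phi> x)" using C2 by (intro continuous_on_minus) (simp add: C2_on_def)
    then show "continuous_on \<Omega> (hessian (\<lambda>x. - \<phi> x))" by (rule continuous_on_eq) (simp add: h)
  qed (use C2 in \<open>auto simp: C2_on_def g\<close>)
  moreover have "\<forall>\<^sub>F x in nhds x0. - v x - - \<phi> x \<le> - v x0 - - \<phi> x0" using touch by (rule eventually_mono) simp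
  ultimately have "F (grad (\<lambda>x. - \<phi> x) x0) (hessian (\<lambda>x. - \<phi> x) x0) \<le> 0"
    using sub x0 unfolding viscosity_subsolution_def by blast
  then show "F (grad \<phi> x0) (hessian \<phi> x0) \<ge> 0" by (simp add: g h[OF x0] odd)
qed

lemma dual_operator_odd: "dual_operator f (- p) (- X) = - dual_operator f p X"
proof -
  have "(- X) *v (- p) = X *v p" by (simp add: matrix_vector_mult_def)
  moreover have "trace (- X) = - trace X" by (simp add: trace_def sum_negf)
  ultimately show ?thesis by (simp add: dual_operator_def algebra_simps)
qed

context C2_lagrangean
begin

lemma conjugate_viscosity_solution:
  fixes u U v :: "real ^ 2 \<Rightarrow> real"
  assumes \<Omega>: "open \<Omega>" and U: "C-lipschitz_on UNIV U" "\<And>x. x \<in> \<Omega> \<Longrightarrow> U x = u x"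
    and v: "conjugate_solution \<Omega> f u v"
  shows "viscosity_solution \<Omega> (dual_operator f) v"
proof -
  obtain D V where V: "D-lipschitz_on UNIV V" "\<And>x. x \<in> \<Omega> \<Longrightarrow> V x = v x"
    and gV: "AE x in lebesgue. x \<in> \<Omega> \<longrightarrow> grad V x = rot (B (grad U x))"
    by (rule conjugate_solution_grad[OF \<Omega> U v]) (assumption, rule that)
  have minus: "rot (B (- q)) = - rot (B q)" for q by (simp add: vec_eq_iff forall_2 B_def)
  have "continuous_on \<Omega> v"
    using lipschitz_on_continuous_on[OF lipschitz_on_subset[OF V(1) subset_UNIV]] by (rule continuous_on_eq) (rule V(2))
  moreover have "viscosity_subsolution \<Omega> (dual_operator f) v"
    by (rule conjugate_viscosity_subsolution[OF \<Omega> U(1) V gV])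
  moreover have "viscosity_supersolution \<Omega> (dual_operator f) v"
  proof (rule viscosity_supersolution_of_uminus[where F="dual_operator f", OF dual_operator_odd])
    have U': "C-lipschitz_on UNIV (\<lambda>x. - U x)" and V': "D-lipschitz_on UNIV (\<lambda>x. - V x)"
      using U(1) V(1) by simp_all
    have "AE x in lebesgue. x \<in> \<Omega> \<longrightarrow> grad (\<lambda>x. - V x) x = rot (B (grad (\<lambda>x. - U x) x))"
      using gV by eventually_elim (simp add: grad_uminus minus)
    then show "viscosity_subsolution \<Omega> (dual_operator f) (\<lambda>x. - v x)"
      by (intro conjugate_viscosity_subsolution[OF \<Omega> U' V']) (simp_all add: V(2))
  qed
  ultimately show ?thesis by (simp add: viscosity_solution_def)
qed

end

theorem theorem3p4:
  fixes \<Omega> :: "(real ^ 2) set" and \<psi> :: "real ^ 2 \<Rightarrow> real"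
    and lam :: real and f :: "real \<Rightarrow> real"
    and fn :: "nat \<Rightarrow> real \<Rightarrow> real" and u :: "nat \<Rightarrow> real ^ 2 \<Rightarrow> real"
  assumes "\<Omega> \<noteq> {}" "open \<Omega>" "connected \<Omega>" "bounded \<Omega>" "simply_connected \<Omega>"
    and "continuous_on (frontier \<Omega>) \<psi>"
    and "\<exists>Q. bounded_slope_condition \<Omega> \<psi> Q"
    and "admissible_Lagrangean lam f"
    and "\<And>n. strictly_convex_on {0..} (fn n)"
    and "\<And>n. C1_halfline (fn n)"
    and "\<And>n. C2_Holder_loc lam (fn n)"
    and "\<And>n. hderiv (fn n) 0 = 0"
    and "uniform_limit {0..} fn f sequentially"
    and "\<And>n. is_minimizer \<Omega> \<psi> (fn n) (u n)"
  shows "(\<forall>n. \<exists>v. conjugate_solution \<Omega> (fn n) (u n) v \<and>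
              (\<forall>w. conjugate_solution \<Omega> (fn n) (u n) w \<longrightarrow> (\<forall>x\<in>\<Omega>. w x = v x)))
       \<and> (\<forall>n. \<forall>v. conjugate_solution \<Omega> (fn n) (u n) v \<longrightarrow>
              (\<exists>c>0. ((\<lambda>\<rho>. \<rho> * hderiv2 (fn n) \<rho> / hderiv (fn n) \<rho>) \<longlongrightarrow> c) (at_right 0)) \<longrightarrow>
              viscosity_solution \<Omega> (dual_operator (fn n)) v)"
proof (intro conjI allI impI)
  fix n
  interpret C2_lagrangean "fn n" lam
    using assms(9-12) by unfold_locales auto
  obtain C where "C-lipschitz_on (closure \<Omega>) (u n)"
    using assms(14)[of n] by (auto simp: is_minimizer_def is_arg_min_def Lip_def)
  then obtain U where U: "C-lipschitz_on UNIV U" "\<And>x. x \<in> closure \<Omega> \<Longrightarrow> U x = u n x"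
    by (rule lipschitz_extension) blast
  have U\<Omega>: "U x = u n x" if "x \<in> \<Omega>" for x using U(2) closure_subset that by blast
  obtain Q where Q: "bounded_slope_condition \<Omega> \<psi> Q" using assms(7) by blast
  obtain D V where "D-lipschitz_on UNIV V"
      "AE x in lebesgue. x \<in> \<Omega> \<longrightarrow> grad V x = rot (B (grad U x))"
    by (rule conjugate_potential_exists[OF assms(2,4,1) assms(14) U Q]) (assumption, rule that)
  then obtain c where c: "conjugate_solution \<Omega> (fn n) (u n) (\<lambda>x. V x - c)"
    by (rule conjugate_solution_of_grad[OF assms(2,4,1) U(1) U\<Omega>, rotated]) blast+
  show "\<exists>v. conjugate_solution \<Omega> (fn n) (u n) v \<and>
      (\<forall>w. conjugate_solution \<Omega> (fn n) (u n) w \<longrightarrow> (\<forall>x\<in>\<Omega>. w x = v x))"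
    using c conjugate_solution_unique[OF assms(2,4,3) U(1) U\<Omega> c] by blast
  show "viscosity_solution \<Omega> (dual_operator (fn n)) v" if "conjugate_solution \<Omega> (fn n) (u n) v" for v
    by (rule conjugate_viscosity_solution[OF assms(2) U(1) U\<Omega> that])
qed

end
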